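(* Let $R$ be a Noetherian and $F$-finite ring of characteristic $p$ (an $\mathbb{F}_q$-algebra). Assume that $R$ is $F$-split, i.e. there is an $R$-linear map $C: F_*R\to R$ splitting the Frobenius $F:R\to F_*R$ (that is, $C\circ F=\mathrm{id}_R$). (a) The Cartier module $(R,C)$ has only finitely many Cartier submodules. (b) If $R$ is moreover complete local, then the injective hull $E_R$ of the residue field of $R$ has some left $R[F]$-module structure (extending its $R$-module structure) such that $E_R$ has only finitely many $R[F]$-submodules. (c) If, in addition to the assumptions of (b), $(R,\mathfrak{m})$ is quasi-Gorenstein, then the top local cohomology module $H^d_{\mathfrak m}(R)$, $d=\dim R$, with its standard left $R[F]$-module structure, has only finitely many $R[F]$-submodules.
   Context: Let $p$ be a prime, $q$ a power of $p$, and $F$ the $q$-th power Frobenius; $R$ is $F$-finite if $F:R\to R$ is a finite ring homomorphism, and $F_*R$ is $R$ viewed as an $R$-module via $F$. A Cartier submodule of $(R,C)$ is an ideal $I\subseteq R$ with $C(I)\subseteq I$. $R[F]$ is the ring obtained from $R$ by adjoining a non-commutative variable $F$ with $r^qF=Fr$ for $r\in R$; a left $R[F]$-module is an $R$-module $N$ with an additive map $F:N\to N$ satisfying $F(rn)=r^qF(n)$. $(R,\mathfrak m)$ is quasi-Gorenstein if $H^d_{\mathfrak m}(R)\cong E_R$. The standard left $R[F]$-structure on $H^d_{\mathfrak m}(R)$ is the one induced functorially by the Frobenius of $R$. *)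

theory Defs
  imports "HOL-Algebra.Ring_Divisibility" "HOL-Algebra.QuotRing" "HOL-Algebra.Ideal_Product"
    "HOL-Algebra.Module" "HOL-Computational_Algebra.Primes" "HOL-Library.Extended_Nat"
begin

section \<open>Modules\<close>

definition mod_hom ::
  "('a, 'r) ring_scheme \<Rightarrow> ('a, 'm, 's) module_scheme \<Rightarrow> ('a, 'n, 't) module_scheme \<Rightarrow> ('m \<Rightarrow> 'n) set"
  where "mod_hom R M N =
    {h. h \<in> carrier M \<rightarrow> carrier N \<and>
        (\<forall>x\<in>carrier M. \<forall>y\<in>carrier M. h (x \<oplus>\<^bsub>M\<^esub> y) = h x \<oplus>\<^bsub>N\<^esub> h y) \<and>
        (\<forall>r\<in>carrier R. \<forall>x\<in>carrier M. h (r \<odot>\<^bsub>M\<^esub> x) = r \<odot>\<^bsub>N\<^esub> h x)}"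

definition mod_isomorphic ::
  "('a, 'r) ring_scheme \<Rightarrow> ('a, 'm, 's) module_scheme \<Rightarrow> ('a, 'n, 't) module_scheme \<Rightarrow> bool"
  where "mod_isomorphic R M N \<longleftrightarrow> (\<exists>h\<in>mod_hom R M N. bij_betw h (carrier M) (carrier N))"

definition fin_gen_module :: "('a, 'r) ring_scheme \<Rightarrow> ('a, 'm, 's) module_scheme \<Rightarrow> bool"
  where "fin_gen_module R M \<longleftrightarrow>
    module R M \<and>
    (\<exists>A. finite A \<and> A \<subseteq> carrier M \<and> (\<lambda>N. submodule N R M) hull A = carrier M)"

definition regular_module :: "('a, 'r) ring_scheme \<Rightarrow> ('a, 'a) module"
  where "regular_module R =
    \<lparr>carrier = carrier R, monoid.mult = monoid.mult R, one = one R, zero = zero R, add = add R,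
     smult = monoid.mult R\<rparr>"

definition restrict_scalars ::
  "('a \<Rightarrow> 'b) \<Rightarrow> ('b, 'm, 's) module_scheme \<Rightarrow> ('a, 'm) module"
  where "restrict_scalars f M =
    \<lparr>carrier = carrier M, monoid.mult = monoid.mult M, one = one M, zero = zero M, add = add M,
     smult = (\<lambda>r x. f r \<odot>\<^bsub>M\<^esub> x)\<rparr>"

text \<open>The fields \<open>mult\<close> and \<open>one\<close> of a module record carry no meaning for \<^locale>\<open>module\<close>; they are
  filled here as in \<^const>\<open>FactRing\<close>.\<close>

definition quot_module :: "('a, 'm, 's) module_scheme \<Rightarrow> 'm set \<Rightarrow> ('a, 'm set) module"
  where "quot_module M N =
    \<lparr>carrier = a_rcosets\<^bsub>M\<^esub> N, monoid.mult = rcoset_mult M N, one = N +>\<^bsub>M\<^esub> \<one>\<^bsub>M\<^esub>, zero = N, add = set_add M,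
     smult = (\<lambda>r X. \<Union>x\<in>X. N +>\<^bsub>M\<^esub> (r \<odot>\<^bsub>M\<^esub> x))\<rparr>"

text \<open>A definition cannot quantify over all types, so the test modules \<open>M\<close> and \<open>N\<close> have
  their carriers in the type \<open>'a\<close> of the elements of \<open>R\<close>.  They include \<open>R\<close> and its ideals, so
  by Baer's criterion this is injectivity with respect to \<open>R\<close>-modules of any type.\<close>

definition injective_module :: "('a, 'r) ring_scheme \<Rightarrow> ('a, 'e, 's) module_scheme \<Rightarrow> bool"
  where "injective_module R E \<longleftrightarrow>
    module R E \<and>
    (\<forall>(M :: ('a, 'a) module) (N :: ('a, 'a) module). \<forall>i\<in>mod_hom R M N. \<forall>g\<in>mod_hom R M E.
       module R M \<and> module R N \<and> inj_on i (carrier M) \<longrightarrow>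
       (\<exists>h\<in>mod_hom R N E. \<forall>x\<in>carrier M. h (i x) = g x))"

definition injective_hull ::
  "('a, 'r) ring_scheme \<Rightarrow> ('a, 'm, 's) module_scheme \<Rightarrow> ('a, 'e, 't) module_scheme \<Rightarrow> bool"
  where "injective_hull R M E \<longleftrightarrow>
    injective_module R E \<and>
    (\<exists>i\<in>mod_hom R M E. inj_on i (carrier M) \<and>
       (\<forall>N. submodule N R E \<and> N \<noteq> {\<zero>\<^bsub>E\<^esub>} \<longrightarrow> N \<inter> i ` carrier M \<noteq> {\<zero>\<^bsub>E\<^esub>}))"


section \<open>Frobenius, Cartier modules and modules over \<open>R[F]\<close>\<close>

definition frob :: "('a, 'r) ring_scheme \<Rightarrow> nat \<Rightarrow> 'a \<Rightarrow> 'a"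
  where "frob R q r = r [^]\<^bsub>R\<^esub> q"

definition frob_push :: "('a, 'r) ring_scheme \<Rightarrow> nat \<Rightarrow> ('a, 'a) module"
  where "frob_push R q = restrict_scalars (frob R q) (regular_module R)"

definition F_finite :: "('a, 'r) ring_scheme \<Rightarrow> nat \<Rightarrow> bool"
  where "F_finite R q \<longleftrightarrow> frob R q \<in> ring_hom R R \<and> fin_gen_module R (frob_push R q)"

definition frob_splitting :: "('a, 'r) ring_scheme \<Rightarrow> nat \<Rightarrow> ('a \<Rightarrow> 'a) \<Rightarrow> bool"
  where "frob_splitting R q C \<longleftrightarrow>
    C \<in> mod_hom R (frob_push R q) (regular_module R) \<and> (\<forall>r\<in>carrier R. C (frob R q r) = r)"

definition cartier_submodule :: "('a, 'r) ring_scheme \<Rightarrow> ('a \<Rightarrow> 'a) \<Rightarrow> 'a set \<Rightarrow> bool"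
  where "cartier_submodule R C I \<longleftrightarrow> ideal I R \<and> C ` I \<subseteq> I"

definition RF_module ::
  "('a, 'r) ring_scheme \<Rightarrow> nat \<Rightarrow> ('a, 'm, 's) module_scheme \<Rightarrow> ('m \<Rightarrow> 'm) \<Rightarrow> bool"
  where "RF_module R q N \<phi> \<longleftrightarrow>
    module R N \<and> \<phi> \<in> carrier N \<rightarrow> carrier N \<and>
    (\<forall>x\<in>carrier N. \<forall>y\<in>carrier N. \<phi> (x \<oplus>\<^bsub>N\<^esub> y) = \<phi> x \<oplus>\<^bsub>N\<^esub> \<phi> y) \<and>
    (\<forall>r\<in>carrier R. \<forall>x\<in>carrier N. \<phi> (r \<odot>\<^bsub>N\<^esub> x) = (r [^]\<^bsub>R\<^esub> q) \<odot>\<^bsub>N\<^esub> \<phi> x)"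

definition RF_submodule ::
  "('a, 'r) ring_scheme \<Rightarrow> ('a, 'm, 's) module_scheme \<Rightarrow> ('m \<Rightarrow> 'm) \<Rightarrow> 'm set \<Rightarrow> bool"
  where "RF_submodule R N \<phi> H \<longleftrightarrow> submodule H R N \<and> \<phi> ` H \<subseteq> H"


section \<open>Complete local rings and dimension\<close>

definition local_ring :: "('a, 'r) ring_scheme \<Rightarrow> 'a set \<Rightarrow> bool"
  where "local_ring R \<mm> \<longleftrightarrow> cring R \<and> {I. maximalideal I R} = {\<mm>}"

text \<open>Bijectivity of \<open>R \<longrightarrow> lim\<^sub>n R/I\<^sup>n\<close>: a family of cosets \<open>c n \<in> R/I\<^sup>n\<close> is compatible with the
  transition maps iff \<open>c (n+1) \<subseteq> c n\<close> for all \<open>n\<close>.\<close>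

definition adically_complete :: "('a, 'r) ring_scheme \<Rightarrow> 'a set \<Rightarrow> bool"
  where "adically_complete R I \<longleftrightarrow>
    bij_betw (\<lambda>a n. (I [^]\<^bsub>ideals_set R\<^esub> n) +>\<^bsub>R\<^esub> a) (carrier R)
      {c :: nat \<Rightarrow> 'a set. \<forall>n. c n \<in> carrier (R Quot (I [^]\<^bsub>ideals_set R\<^esub> n)) \<and> c (Suc n) \<subseteq> c n}"

definition complete_local_ring :: "('a, 'r) ring_scheme \<Rightarrow> 'a set \<Rightarrow> bool"
  where "complete_local_ring R \<mm> \<longleftrightarrow> local_ring R \<mm> \<and> adically_complete R \<mm>"

definition residue_module :: "('a, 'r) ring_scheme \<Rightarrow> 'a set \<Rightarrow> ('a, 'a set) module"
  where "residue_module R \<mm> = quot_module (regular_module R) \<mm>"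

definition krull_dim :: "('a, 'r) ring_scheme \<Rightarrow> enat"
  where "krull_dim R =
    Sup {enat n | n. \<exists>P. (\<forall>i\<le>n. primeideal (P i) R) \<and> (\<forall>i<n. P i \<subset> P (Suc i))}"

definition ideal_radical :: "('a, 'r) ring_scheme \<Rightarrow> 'a set \<Rightarrow> 'a set"
  where "ideal_radical R I = {a \<in> carrier R. \<exists>n::nat. a [^]\<^bsub>R\<^esub> n \<in> I}"


section \<open>Localization at one element\<close>

text \<open>The pair \<open>(a, m)\<close> stands for \<open>a / f\<^sup>m\<close>.\<close>

definition loc_rel :: "('a, 'r) ring_scheme \<Rightarrow> 'a \<Rightarrow> (('a \<times> nat) \<times> ('a \<times> nat)) set"
  where "loc_rel R f =
    {((a, m), (b, n)) | a m b n. a \<in> carrier R \<and> b \<in> carrier R \<and>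
       (\<exists>k::nat. (f [^]\<^bsub>R\<^esub> k) \<otimes>\<^bsub>R\<^esub> ((f [^]\<^bsub>R\<^esub> n) \<otimes>\<^bsub>R\<^esub> a) = (f [^]\<^bsub>R\<^esub> k) \<otimes>\<^bsub>R\<^esub> ((f [^]\<^bsub>R\<^esub> m) \<otimes>\<^bsub>R\<^esub> b))}"

definition loc_frac :: "('a, 'r) ring_scheme \<Rightarrow> 'a \<Rightarrow> 'a \<Rightarrow> nat \<Rightarrow> ('a \<times> nat) set"
  where "loc_frac R f a m = loc_rel R f `` {(a, m)}"

definition localization :: "('a, 'r) ring_scheme \<Rightarrow> 'a \<Rightarrow> ('a, ('a \<times> nat) set) module"
  where "localization R f =
    \<lparr>carrier = {loc_frac R f a m | a m. a \<in> carrier R},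
     monoid.mult = (\<lambda>X Y. \<Union>(a, m)\<in>X. \<Union>(b, n)\<in>Y. loc_frac R f (a \<otimes>\<^bsub>R\<^esub> b) (m + n)),
     one = loc_frac R f \<one>\<^bsub>R\<^esub> 0,
     zero = loc_frac R f \<zero>\<^bsub>R\<^esub> 0,
     add = (\<lambda>X Y. \<Union>(a, m)\<in>X. \<Union>(b, n)\<in>Y.
              loc_frac R f (((f [^]\<^bsub>R\<^esub> n) \<otimes>\<^bsub>R\<^esub> a) \<oplus>\<^bsub>R\<^esub> ((f [^]\<^bsub>R\<^esub> m) \<otimes>\<^bsub>R\<^esub> b)) (m + n)),
     smult = (\<lambda>r X. \<Union>(a, m)\<in>X. loc_frac R f (r \<otimes>\<^bsub>R\<^esub> a) m)\<rparr>"

text \<open>The canonical map \<open>R\<^sub>f \<longrightarrow> R\<^sub>f\<^sub>g\<close>, \<open>a / f\<^sup>m \<mapsto> a g\<^sup>m / (f g)\<^sup>m\<close>.\<close>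

definition loc_map :: "('a, 'r) ring_scheme \<Rightarrow> 'a \<Rightarrow> 'a \<Rightarrow> ('a \<times> nat) set \<Rightarrow> ('a \<times> nat) set"
  where "loc_map R f g X =
    (\<Union>(a, m)\<in>X. loc_frac R (f \<otimes>\<^bsub>R\<^esub> g) (a \<otimes>\<^bsub>R\<^esub> (g [^]\<^bsub>R\<^esub> m)) m)"

definition loc_frob :: "('a, 'r) ring_scheme \<Rightarrow> nat \<Rightarrow> 'a \<Rightarrow> ('a \<times> nat) set \<Rightarrow> ('a \<times> nat) set"
  where "loc_frob R q f X = (\<Union>(a, m)\<in>X. loc_frac R f (a [^]\<^bsub>R\<^esub> q) (q * m))"


section \<open>Local cohomology\<close>

text \<open>For a Noetherian ring \<open>R\<close> and a sequence \<open>x\<^sub>0, \<dots>, x\<^sub>n\<^sub>-\<^sub>1\<close> generating an ideal with the same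
  radical as \<open>I\<close>, the local cohomology \<open>H\<^sup>i\<^sub>I(R)\<close> is the \<open>i\<close>-th cohomology of the Cech complex
  \<open>0 \<longrightarrow> R \<longrightarrow> \<Oplus>\<^sub>j R\<^bsub>x\<^sub>j\<^esub> \<longrightarrow> \<Oplus>\<^bsub>j<k\<^esub> R\<^bsub>x\<^sub>j x\<^sub>k\<^esub> \<longrightarrow> \<dots> \<longrightarrow> R\<^bsub>x\<^sub>0 \<dots> x\<^sub>n\<^sub>-\<^sub>1\<^esub> \<longrightarrow> 0\<close>.
  A cochain of degree \<open>i\<close> is a family indexed by the subsets \<open>S \<subseteq> {0, \<dots>, n-1}\<close> with \<open>i\<close> elements,
  with the \<open>S\<close>-component in the localization at \<open>\<Prod>\<^bsub>j\<in>S\<^esub> x\<^sub>j\<close>.\<close>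

definition generates_up_to_radical :: "('a, 'r) ring_scheme \<Rightarrow> 'a list \<Rightarrow> 'a set \<Rightarrow> bool"
  where "generates_up_to_radical R xs I \<longleftrightarrow>
    set xs \<subseteq> carrier R \<and> ideal_radical R (Idl\<^bsub>R\<^esub> (set xs)) = ideal_radical R I"

definition cech_index :: "'a list \<Rightarrow> nat \<Rightarrow> nat set set"
  where "cech_index xs i = {S. S \<subseteq> {..<length xs} \<and> card S = i}"

definition cech_elt :: "('a, 'r) ring_scheme \<Rightarrow> 'a list \<Rightarrow> nat set \<Rightarrow> 'a"
  where "cech_elt R xs S = finprod R (\<lambda>j. xs ! j) S"

definition cech_cochains ::
  "('a, 'r) ring_scheme \<Rightarrow> 'a list \<Rightarrow> nat \<Rightarrow> ('a, nat set \<Rightarrow> ('a \<times> nat) set) module"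
  where "cech_cochains R xs i =
    (let L = (\<lambda>S. localization R (cech_elt R xs S)) in
     \<lparr>carrier = (\<Pi>\<^sub>E S\<in>cech_index xs i. carrier (L S)),
      monoid.mult = (\<lambda>c c'. \<lambda>S\<in>cech_index xs i. c S \<otimes>\<^bsub>L S\<^esub> c' S),
      one = (\<lambda>S\<in>cech_index xs i. \<one>\<^bsub>L S\<^esub>),
      zero = (\<lambda>S\<in>cech_index xs i. \<zero>\<^bsub>L S\<^esub>),
      add = (\<lambda>c c'. \<lambda>S\<in>cech_index xs i. c S \<oplus>\<^bsub>L S\<^esub> c' S),
      smult = (\<lambda>r c. \<lambda>S\<in>cech_index xs i. r \<odot>\<^bsub>L S\<^esub> c S)\<rparr>)"

definition cech_diff ::
  "('a, 'r) ring_scheme \<Rightarrow> 'a list \<Rightarrow> nat \<Rightarrow> (nat set \<Rightarrow> ('a \<times> nat) set) \<Rightarrow> (nat set \<Rightarrow> ('a \<times> nat) set)"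
  where "cech_diff R xs i c =
    (\<lambda>S\<in>cech_index xs (Suc i).
       let L = localization R (cech_elt R xs S) in
       finsum L (\<lambda>j.
         let y = loc_map R (cech_elt R xs (S - {j})) (xs ! j) (c (S - {j})) in
         if even (card {k\<in>S. k < j}) then y else \<ominus>\<^bsub>L\<^esub> y) S)"

definition cech_cocycles ::
  "('a, 'r) ring_scheme \<Rightarrow> 'a list \<Rightarrow> nat \<Rightarrow> (nat set \<Rightarrow> ('a \<times> nat) set) set"
  where "cech_cocycles R xs i =
    {c \<in> carrier (cech_cochains R xs i). cech_diff R xs i c = \<zero>\<^bsub>cech_cochains R xs (Suc i)\<^esub>}"

definition cech_coboundaries ::
  "('a, 'r) ring_scheme \<Rightarrow> 'a list \<Rightarrow> nat \<Rightarrow> (nat set \<Rightarrow> ('a \<times> nat) set) set"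
  where "cech_coboundaries R xs i =
    (case i of 0 \<Rightarrow> {\<zero>\<^bsub>cech_cochains R xs 0\<^esub>}
     | Suc j \<Rightarrow> cech_diff R xs j ` carrier (cech_cochains R xs j))"

definition local_cohomology ::
  "('a, 'r) ring_scheme \<Rightarrow> 'a list \<Rightarrow> nat \<Rightarrow> ('a, (nat set \<Rightarrow> ('a \<times> nat) set) set) module"
  where "local_cohomology R xs i =
    quot_module ((cech_cochains R xs i)\<lparr>carrier := cech_cocycles R xs i\<rparr>) (cech_coboundaries R xs i)"

text \<open>The standard Frobenius action on local cohomology: the Frobenius of \<open>R\<close> induces the Frobenius
  of each localization, these commute with the Cech differential, and the action is the map
  they induce on cohomology classes.\<close>

definition cech_frob ::
  "('a, 'r) ring_scheme \<Rightarrow> nat \<Rightarrow> 'a list \<Rightarrow> nat \<Rightarrow> (nat set \<Rightarrow> ('a \<times> nat) set) \<Rightarrow> (nat set \<Rightarrow> ('a \<times> nat) set)"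
  where "cech_frob R q xs i c = (\<lambda>S\<in>cech_index xs i. loc_frob R q (cech_elt R xs S) (c S))"

definition local_cohomology_frob ::
  "('a, 'r) ring_scheme \<Rightarrow> nat \<Rightarrow> 'a list \<Rightarrow> nat
    \<Rightarrow> (nat set \<Rightarrow> ('a \<times> nat) set) set \<Rightarrow> (nat set \<Rightarrow> ('a \<times> nat) set) set"
  where "local_cohomology_frob R q xs i X =
    (\<Union>c\<in>X. cech_coboundaries R xs i +>\<^bsub>cech_cochains R xs i\<^esub> cech_frob R q xs i c)"

end

theory Submission
  imports Defs
begin

text \<open>
  All three statements rest on the lattice of Cartier submodules of \<open>(R, C)\<close>.  Since \<open>C\<close> splits
  the Frobenius, these are radical ideals, and they are closed under sums, intersections and colons.
  Noetherian induction on \<open>J\<close> shows that only finitely many of them contain a given one,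
  \<open>J\<close> (\<open>finite_cartier_above\<close>).  If \<open>J\<close> is proper and not prime, it is the intersection of two larger Cartier
  submodules \<open>J\<^sub>1\<close> and \<open>J\<^sub>2\<close>, and any Cartier \<open>I \<supseteq> J\<close> equals \<open>(I + J\<^sub>1) \<inter> (I + J\<^sub>2)\<close>.  If \<open>J\<close> is a prime
  \<open>P\<close>, what is needed is one element \<open>c \<notin> P\<close> that lies in every Cartier submodule strictly
  above \<open>P\<close>, a test element (\<open>cartier_test_element\<close>).  It comes from Gaussian elimination on
  generators of \<open>F\<^sub>*R\<close> in which \<open>C\<close> computes the pivots: the result is \<open>c I \<subseteq> I\<^sup>2 + P\<close>, so that some
  power of \<open>c\<close> is in \<open>I\<close> by Nakayama's lemma, and \<open>c\<close> itself because \<open>I\<close> is radical.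

  For modules over \<open>R[F]\<close> let \<open>E\<close> be the injective hull of the residue field of the complete ring
  \<open>R\<close>.  By Matlis duality every endomorphism of \<open>E\<close> is multiplication by an element of \<open>R\<close>, so a
  submodule \<open>N\<close> of \<open>E\<close> is determined by its annihilator (\<open>double_annihilator\<close>).  If a Frobenius
  action \<open>\<phi>\<close> has the property that \<open>a \<phi>(x) = 0\<close> implies \<open>C(a) x = 0\<close>, then the annihilator of a
  stable submodule is a Cartier submodule, and there are finitely many stable submodules
  (\<open>finite_stable_submodules\<close>).

  On \<open>E\<close> such an action is the Matlis dual of \<open>C\<close>: an \<open>R\<close>-linear map \<open>\<tau>: F\<^sub>*E \<longrightarrow> E\<close> that is nonzero on
  the socle makes \<open>E\<close> isomorphic to \<open>Hom(F\<^sub>*R, E)\<close> by \<open>y \<mapsto> (a \<mapsto> \<tau>(a y))\<close>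
  (\<open>q_lin_representable\<close>, \<open>trace_nondegenerate\<close>), and \<open>\<phi>(x)\<close> is the element that corresponds to
  \<open>a \<mapsto> C(a) x\<close>.  On local cohomology the standard Frobenius has the property as well: \<open>C\<close> extends
  to the Cech complex, where \<open>C(a \<phi>(c)) = C(a) c\<close> (\<open>local_cohomology_split\<close>).
\<close>

section \<open>Ideals in Noetherian rings\<close>

lemma (in noetherian_ring) noetherian_induct [consumes 1, case_names step]:
  assumes "ideal J R"
    and step: "\<And>J. ideal J R \<Longrightarrow> (\<And>K. ideal K R \<Longrightarrow> J \<subset> K \<Longrightarrow> P K) \<Longrightarrow> P J"
  shows "P J"
proof (rule ccontr)
  assume "\<not> P J"
  define S where "S = {J. ideal J R \<and> \<not> P J}"
  have "\<exists>M\<in>S. \<forall>X\<in>S. M \<subseteq> X \<longrightarrow> X = M"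
  proof (rule subset_Zorn_nonempty)
    show "S \<noteq> {}" using \<open>\<not> P J\<close> assms(1) by (auto simp: S_def)
    fix D assume D: "D \<noteq> {}" "subset.chain S D"
    then have "subset.chain {I. ideal I R} D"
      by (auto simp: S_def pred_on.chain_def)
    with D have "\<Union>D \<in> D" by (intro ideal_chain_is_trivial)
    with D show "\<Union>D \<in> S" by (auto simp: pred_on.chain_def)
  qed
  then obtain M where M: "ideal M R" "\<not> P M" "\<And>X. ideal X R \<Longrightarrow> \<not> P X \<Longrightarrow> M \<subseteq> X \<Longrightarrow> X = M"
    by (auto simp: S_def)
  have "P M" by (rule step[OF M(1)]) (use M(3) in blast)
  with M(2) show False ..
qed

context cring
begin

lemma ideal_zero: "ideal J R \<Longrightarrow> \<zero> \<in> J"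
  by (rule additive_subgroup.zero_closed[OF ideal.axioms(1)])

lemma ideal_add: "ideal J R \<Longrightarrow> x \<in> J \<Longrightarrow> y \<in> J \<Longrightarrow> x \<oplus> y \<in> J"
  by (rule additive_subgroup.a_closed[OF ideal.axioms(1)])

lemma ideal_neg: "ideal J R \<Longrightarrow> x \<in> J \<Longrightarrow> \<ominus> x \<in> J"
  by (simp add: additive_subgroup.a_inv_closed ideal.axioms(1))

lemma ideal_minus: "ideal J R \<Longrightarrow> x \<in> J \<Longrightarrow> y \<in> J \<Longrightarrow> x \<ominus> y \<in> J"
  unfolding a_minus_def by (intro ideal_add ideal_neg)

lemma ideal_mult: "ideal J R \<Longrightarrow> x \<in> J \<Longrightarrow> r \<in> carrier R \<Longrightarrow> r \<otimes> x \<in> J"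
  by (rule ideal.I_l_closed)

lemma ideal_mult': "ideal J R \<Longrightarrow> x \<in> J \<Longrightarrow> r \<in> carrier R \<Longrightarrow> x \<otimes> r \<in> J"
  by (rule ideal.I_r_closed)

lemma ideal_carrier: "ideal J R \<Longrightarrow> x \<in> J \<Longrightarrow> x \<in> carrier R"
  by (rule ideal.Icarr)

lemma ideal_minus_cancel:
  assumes "ideal J R" "x \<in> carrier R" "y \<in> J" "x \<ominus> y \<in> J"
  shows "x \<in> J"
proof -
  have "x = (x \<ominus> y) \<oplus> y"
    using assms ideal_carrier[OF assms(1,3)] by (simp add: a_minus_def a_assoc l_neg)
  then show ?thesis using assms ideal_add by metis
qed

lemma idealI_cring:
  assumes "J \<subseteq> carrier R" "\<zero> \<in> J" "\<And>x y. x \<in> J \<Longrightarrow> y \<in> J \<Longrightarrow> x \<oplus> y \<in> J"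
    and mult: "\<And>r x. r \<in> carrier R \<Longrightarrow> x \<in> J \<Longrightarrow> r \<otimes> x \<in> J"
  shows "ideal J R"
proof (rule idealI[OF ring_axioms])
  have neg: "\<ominus> x \<in> J" if "x \<in> J" for x
  proof -
    have "\<ominus> x = (\<ominus> \<one>) \<otimes> x" using that assms(1) by (auto simp: l_minus)
    then show ?thesis using mult[of "\<ominus> \<one>" x] that by simp
  qed
  show "subgroup J (add_monoid R)"
    by (rule add.subgroupI) (use assms neg in auto)
  show "x \<otimes> a \<in> J" if "a \<in> J" "x \<in> carrier R" for a x using mult that by blast
  show "a \<otimes> x \<in> J" if "a \<in> J" "x \<in> carrier R" for a x
    using mult[of x a] that assms(1) m_comm[of a x] by auto
qed

abbreviation adjoin :: "'a set \<Rightarrow> 'a \<Rightarrow> 'a set" where "adjoin J a \<equiv> J <+>\<^bsub>R\<^esub> PIdl a"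

lemma adjoin_iff:
  "x \<in> adjoin J a \<longleftrightarrow> (\<exists>j\<in>J. \<exists>r\<in>carrier R. x = j \<oplus> r \<otimes> a)"
  by (auto simp: set_add_def' cgenideal_def)

lemma adjoin_ideal: "ideal J R \<Longrightarrow> a \<in> carrier R \<Longrightarrow> ideal (adjoin J a) R"
  by (intro add_ideals cgenideal_ideal)

lemma sum_left: "ideal I R \<Longrightarrow> ideal J R \<Longrightarrow> I \<subseteq> I <+>\<^bsub>R\<^esub> J"
proof
  fix x assume "ideal I R" "ideal J R" "x \<in> I"
  then have "x = x \<oplus> \<zero>" "\<zero> \<in> J" by (auto simp: ideal_zero ideal_carrier)
  with \<open>x \<in> I\<close> show "x \<in> I <+>\<^bsub>R\<^esub> J" by (auto simp: set_add_def')
qed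

lemma sum_right: "ideal I R \<Longrightarrow> ideal J R \<Longrightarrow> J \<subseteq> I <+>\<^bsub>R\<^esub> J"
proof
  fix x assume "ideal I R" "ideal J R" "x \<in> J"
  then have "x = \<zero> \<oplus> x" "\<zero> \<in> I" by (auto simp: ideal_zero ideal_carrier)
  with \<open>x \<in> J\<close> show "x \<in> I <+>\<^bsub>R\<^esub> J" by (auto simp: set_add_def')
qed

lemma adjoin_gt:
  assumes "ideal J R" "a \<in> carrier R" "a \<notin> J"
  shows "J \<subset> adjoin J a"
  using sum_left[OF assms(1) cgenideal_ideal[OF assms(2)]] sum_right[OF assms(1) cgenideal_ideal[OF assms(2)]]
    cgenideal_self[OF assms(2)] assms(3) by blast

lemma colon_ideal:
  assumes "ideal J R" "A \<subseteq> carrier R"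
  shows "ideal {x \<in> carrier R. \<forall>a\<in>A. a \<otimes> x \<in> J} R"
proof (rule idealI_cring, goal_cases)
  case (4 r x)
  have "a \<otimes> (r \<otimes> x) = r \<otimes> (a \<otimes> x)" if "a \<in> A" for a
    using that 4 assms(2) by (auto simp: m_lcomm)
  with 4 show ?case using assms by (auto simp: ideal_mult)
qed (use assms in \<open>auto simp: ideal_zero ideal_add r_distr subset_iff\<close>)

lemma nat_pow_mem_ideal:
  assumes "ideal J R" "x \<in> J" "n > 0"
  shows "x [^] (n::nat) \<in> J"
  using assms by (cases n) (auto simp: ideal_mult ideal_carrier)

end

lemma (in primeideal) prime_pow:
  assumes "c \<in> carrier R" "c [^] (k::nat) \<in> I" shows "c \<in> I"
  using assms(2)
proof (induction k)
  case 0
  then have "\<one> \<in> I" by simp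
  then show ?case using one_imp_carrier I_notcarr by blast
next
  case (Suc k)
  then show ?case using I_prime[of "c [^] k" c] assms(1) by auto
qed

text \<open>This is Nakayama's lemma in the form of the determinant trick: it would give some \<open>c\<^sup>k - a\<close>
  with \<open>a \<in> I\<close> that carries \<open>I\<close> into \<open>P\<close>.  Instead of a determinant, the proof shrinks an ideal
  \<open>J \<supseteq> P\<close> with \<open>u I \<subseteq> J\<close> one generator at a time, where \<open>u\<close> stays congruent to a power
  of \<open>c\<close> modulo \<open>I\<close>.\<close>

lemma (in noetherian_ring) mem_radical_of_mult_into_square:
  assumes "cring R" and P: "primeideal P R" and I: "ideal I R" and PI: "P \<subset> I" and c: "c \<in> carrier R"
    and sq: "\<And>x. x \<in> I \<Longrightarrow> c \<otimes> x \<in> (I \<cdot> I) <+>\<^bsub>R\<^esub> P"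
  shows "\<exists>k::nat. c [^] k \<in> I"
proof -
  interpret cring R by fact
  interpret P: primeideal P R by fact
  have Pi: "ideal P R" by (rule P.ideal_axioms)
  have II: "I \<subseteq> carrier R" using ideal_carrier[OF I] by blast
  define U where "U = {u \<in> carrier R. \<exists>k::nat. c [^] k \<ominus> u \<in> I}"
  have one_mem: "\<one> \<in> U"
    using ideal_zero[OF I] by (auto simp: U_def a_minus_def r_neg intro!: exI[of _ 0])
  have descend: "\<exists>u\<in>U. \<forall>x\<in>I. u \<otimes> x \<in> J" if "ideal J R" "P \<subseteq> J" "J \<subseteq> I" for J
    using that
  proof (induction rule: noetherian_induct)
    case (step J)
    show ?case
    proof (cases "J = I")
      case True
      then show ?thesis using one_mem II by (auto simp: subset_iff intro!: bexI[of _ \<one>])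
    next
      case False
      then obtain x where x: "x \<in> I" "x \<notin> J" using step by blast
      then have xc: "x \<in> carrier R" using II by blast
      let ?K = "J <+>\<^bsub>R\<^esub> PIdl x"
      have "?K \<subseteq> I"
        using step(4) x(1) I by (auto simp: adjoin_iff intro!: ideal_add ideal_mult)
      moreover have "P \<subseteq> ?K" using step(3) adjoin_gt[OF step(1) xc x(2)] by blast
      ultimately obtain u where u: "u \<in> U" "\<And>z. z \<in> I \<Longrightarrow> u \<otimes> z \<in> ?K"
        using step(2)[OF adjoin_ideal[OF step(1) xc] adjoin_gt[OF step(1) xc x(2)]] by blast
      obtain k where uc: "u \<in> carrier R" and k: "c [^] (k::nat) \<ominus> u \<in> I" using u(1) by (auto simp: U_def)
      \<comment> \<open>By hypothesis \<open>c x \<in> I\<^sup>2 + P\<close>, and \<open>u\<close> carries \<open>I\<^sup>2 + P\<close> into \<open>I x + J\<close>, which removes the generator \<open>x\<close>.\<close>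
      define W where "W = {y \<in> carrier R. \<exists>v\<in>I. \<exists>j\<in>J. u \<otimes> y = v \<otimes> x \<oplus> j}"
      have WI: "y \<in> W" if "y \<in> carrier R" "v \<in> I" "j \<in> J" "u \<otimes> y = v \<otimes> x \<oplus> j" for y v j
        using that by (auto simp: W_def)
      have Wadd: "y \<oplus> z \<in> W" if yz: "y \<in> W" "z \<in> W" for y z
      proof -
        obtain v j v' j' where *: "v \<in> I" "j \<in> J" "u \<otimes> y = v \<otimes> x \<oplus> j" "v' \<in> I" "j' \<in> J" "u \<otimes> z = v' \<otimes> x \<oplus> j'"
          "y \<in> carrier R" "z \<in> carrier R"
          using yz unfolding W_def by blast
        then have **: "v \<in> carrier R" "v' \<in> carrier R" "j \<in> carrier R" "j' \<in> carrier R"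
          using II step(1) by (auto intro: ideal_carrier)
        have "u \<otimes> (y \<oplus> z) = (v \<oplus> v') \<otimes> x \<oplus> (j \<oplus> j')"
          using * ** uc xc by (simp add: r_distr l_distr a_ac)
        then show ?thesis by (intro WI) (use * ** I step(1) in \<open>auto intro: ideal_add\<close>)
      qed
      have PW: "y \<in> W" if "y \<in> P" for y
      proof -
        have "u \<otimes> y = \<zero> \<otimes> x \<oplus> u \<otimes> y" "u \<otimes> y \<in> J"
          using that uc xc step(1,3) P.Icarr by (auto intro!: ideal_mult)
        then show ?thesis using that I P.Icarr by (intro WI) (auto intro: ideal_zero)
      qed
      have IIW: "y \<in> W" if "y \<in> I \<cdot> I" for y
        using that
      proof (induction rule: ideal_prod.induct)
        case (prod a b)
        obtain t j where *: "t \<in> carrier R" "j \<in> J" "u \<otimes> b = j \<oplus> t \<otimes> x"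
          using u(2)[OF prod(2)] by (auto simp: adjoin_iff)
        have **: "a \<in> carrier R" "b \<in> carrier R" "j \<in> carrier R"
          using prod II * step(1) by (auto intro: ideal_carrier)
        have "u \<otimes> (a \<otimes> b) = a \<otimes> (u \<otimes> b)" using ** uc by (simp add: m_lcomm)
        also have "\<dots> = (a \<otimes> t) \<otimes> x \<oplus> a \<otimes> j"
          using * ** xc by (simp add: r_distr m_assoc a_comm)
        finally show ?case
          by (intro WI) (use prod * ** step(1) I in \<open>auto intro: ideal_mult ideal_mult'\<close>)
      qed (rule Wadd)
      have "c \<otimes> x \<in> W"
        using sq[OF x(1)] IIW PW Wadd by (auto simp: set_add_def')
      then obtain v j where vj: "v \<in> I" "j \<in> J" "u \<otimes> (c \<otimes> x) = v \<otimes> x \<oplus> j"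
        by (auto simp: W_def)
      have vjc: "v \<in> carrier R" "j \<in> carrier R" using vj II step(1) by (auto intro: ideal_carrier)
      define w where "w = (u \<otimes> c \<ominus> v) \<otimes> u"
      have wx: "(u \<otimes> c \<ominus> v) \<otimes> x = j"
      proof -
        have "(u \<otimes> c \<ominus> v) \<otimes> x = u \<otimes> (c \<otimes> x) \<ominus> v \<otimes> x"
          using uc c vjc xc by (simp add: a_minus_def l_distr l_minus m_assoc)
        also have "\<dots> = j" using vj(3) vjc xc by (simp add: a_minus_def a_ac r_neg)
        finally show ?thesis .
      qed
      have "w \<otimes> z \<in> J" if z: "z \<in> I" for z
      proof -
        have zc: "z \<in> carrier R" using z II by blast
        obtain t l where *: "t \<in> carrier R" "l \<in> J" "u \<otimes> z = l \<oplus> t \<otimes> x"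
          using u(2)[OF z] by (auto simp: adjoin_iff)
        have lc: "l \<in> carrier R" using * step(1) ideal_carrier by blast
        have "w \<otimes> z = (u \<otimes> c \<ominus> v) \<otimes> (l \<oplus> t \<otimes> x)"
          using uc c vjc zc by (simp add: w_def m_assoc flip: *(3))
        also have "\<dots> = (u \<otimes> c \<ominus> v) \<otimes> l \<oplus> t \<otimes> ((u \<otimes> c \<ominus> v) \<otimes> x)"
          using uc c vjc * lc xc by (simp add: r_distr m_lcomm)
        finally show ?thesis
          using wx * vj uc c vjc step(1) by (auto intro!: ideal_add ideal_mult)
      qed
      moreover have "w \<in> U"
      proof -
        have ukc: "c [^] k \<in> carrier R" using c by simp
        define i where "i = c [^] k \<ominus> u"
        have i: "i \<in> I" "i \<in> carrier R" using k II by (auto simp: i_def)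
        have "c [^] (k + 1 + k) \<ominus> w
            = i \<otimes> (c \<otimes> c [^] k) \<oplus> (u \<otimes> c) \<otimes> i \<oplus> v \<otimes> u"
        proof -
          have "c [^] k = u \<oplus> i" using ukc uc by (simp add: i_def a_minus_def a_ac r_neg r_neg1 r_neg2)
          moreover have "c [^] (k + 1 + k) = c [^] k \<otimes> (c \<otimes> c [^] k)"
            using c by (simp add: nat_pow_mult[symmetric] m_ac)
          ultimately show ?thesis
            using uc i c vjc unfolding w_def
            by (simp add: a_minus_def l_distr r_distr l_minus r_minus minus_add m_ac a_ac r_neg r_neg1 r_neg2)
        qed
        also have "\<dots> \<in> I"
          using i vj uc c I by (intro ideal_add) (auto intro: ideal_mult ideal_mult')
        finally have "c [^] (k + 1 + k) \<ominus> w \<in> I" .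
        moreover have "w \<in> carrier R" using uc c vjc by (simp add: w_def)
        ultimately show ?thesis unfolding U_def by (intro CollectI conjI exI[of _ "k + 1 + k"])
      qed
      ultimately show ?thesis by blast
    qed
  qed
  from descend[OF Pi subset_refl] PI obtain u where u: "u \<in> U" "\<And>x. x \<in> I \<Longrightarrow> u \<otimes> x \<in> P" by blast
  obtain x where x: "x \<in> I" "x \<notin> P" using PI by blast
  have "u \<in> P" using u x P.I_prime[of u x] II by (auto simp: U_def)
  then have "u \<in> I" using PI by blast
  moreover obtain k where "c [^] (k::nat) \<ominus> u \<in> I" using u(1) by (auto simp: U_def)
  ultimately show ?thesis using ideal_minus_cancel[OF I, of "c [^] k" u] c by auto
qed


section \<open>Frobenius split rings\<close>

locale F_split_ring = cring R + noetherian_ring R for R (structure) +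
  fixes q :: nat and C :: "'a \<Rightarrow> 'a"
  assumes q_ge_2: "2 \<le> q" and F_finite: "F_finite R q" and splitting: "frob_splitting R q C"
begin

lemma frob_add: "x \<in> carrier R \<Longrightarrow> y \<in> carrier R \<Longrightarrow> (x \<oplus> y) [^] q = x [^] q \<oplus> y [^] q"
  using F_finite ring_hom_add[of "frob R q" R R x y] by (simp add: F_finite_def frob_def)

lemma frob_zero: "\<zero> [^] q = \<zero>"
  using q_ge_2 by (cases q) auto

lemma frob_neg: "x \<in> carrier R \<Longrightarrow> (\<ominus> x) [^] q = \<ominus> (x [^] q)"
  using frob_add[of "\<ominus> x" x] by (simp add: l_neg frob_zero minus_equality)

lemma pow_q: "x \<in> carrier R \<Longrightarrow> x [^] q = x [^] (q - 1) \<otimes> x"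
  using q_ge_2 nat_pow_Suc[of x "q - 1"] by (simp del: nat_pow_Suc)

lemma pow_q2: assumes "x \<in> carrier R" shows "x [^] q = x [^] (q - 2) \<otimes> (x \<otimes> x)"
proof -
  obtain n where n: "q = Suc (Suc n)" using q_ge_2 le_Suc_ex[of 2 q] by auto
  show ?thesis using assms unfolding n by (simp add: m_assoc)
qed

lemma C_closed [simp]: "x \<in> carrier R \<Longrightarrow> C x \<in> carrier R"
  and C_add: "x \<in> carrier R \<Longrightarrow> y \<in> carrier R \<Longrightarrow> C (x \<oplus> y) = C x \<oplus> C y"
  and C_smult: "r \<in> carrier R \<Longrightarrow> x \<in> carrier R \<Longrightarrow> C (r [^] q \<otimes> x) = r \<otimes> C x"
  and C_pow: "r \<in> carrier R \<Longrightarrow> C (r [^] q) = r"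
  using splitting
  by (auto simp: frob_splitting_def mod_hom_def frob_push_def restrict_scalars_def regular_module_def frob_def)

lemma C_zero: "C \<zero> = \<zero>"
  using C_pow[of \<zero>] by (simp add: frob_zero)

lemma C_smult': "r \<in> carrier R \<Longrightarrow> x \<in> carrier R \<Longrightarrow> C (x \<otimes> r [^] q) = C x \<otimes> r"
  using C_smult[of r x] by (simp add: m_comm)

text \<open>These are the \<open>R\<close>-submodules of \<open>F\<^sub>*R\<close>.\<close>

definition frob_closed :: "'a set \<Rightarrow> bool" where
  "frob_closed S \<longleftrightarrow> S \<subseteq> carrier R \<and> \<zero> \<in> S \<and> (\<forall>x\<in>S. \<forall>y\<in>S. x \<oplus> y \<in> S) \<and>
    (\<forall>r\<in>carrier R. \<forall>x\<in>S. r [^] q \<otimes> x \<in> S)"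

lemma frob_generators:
  obtains gs where "set gs \<subseteq> carrier R" "\<And>S. frob_closed S \<Longrightarrow> set gs \<subseteq> S \<Longrightarrow> S = carrier R"
proof -
  let ?M = "frob_push R q"
  have simps [simp]: "carrier ?M = carrier R" "zero ?M = \<zero>" "add ?M = add R" "smult ?M r x = r [^] q \<otimes> x" for r x
    by (auto simp: frob_push_def restrict_scalars_def regular_module_def frob_def)
  obtain A where A: "finite A" "A \<subseteq> carrier R" "(\<lambda>N. submodule N R ?M) hull A = carrier R" and M: "module R ?M"
    using F_finite by (auto simp: F_finite_def fin_gen_module_def)
  interpret M: module R ?M by (rule M)
  obtain gs where gs: "set gs = A" using finite_list[OF A(1)] by blast
  have neg: "\<ominus>\<^bsub>?M\<^esub> x = (\<ominus> \<one>) [^] q \<otimes> x" if "x \<in> carrier R" for x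
    using M.smult_l_minus[of \<one> x] M.smult_one[of x] that by simp
  show thesis
  proof (rule that)
    show "set gs \<subseteq> carrier R" using A gs by simp
    fix S assume "frob_closed S" and gsS: "set gs \<subseteq> S"
    then have S: "S \<subseteq> carrier R" "\<zero> \<in> S" "\<And>x y. x \<in> S \<Longrightarrow> y \<in> S \<Longrightarrow> x \<oplus> y \<in> S"
      "\<And>r x. r \<in> carrier R \<Longrightarrow> x \<in> S \<Longrightarrow> r [^] q \<otimes> x \<in> S" by (auto simp: frob_closed_def)
    have "submodule S R ?M"
      by (rule M.submoduleI) (use S neg in auto)
    then have "carrier R \<subseteq> S" using hull_minimal[of A S "\<lambda>N. submodule N R ?M"] A gsS gs by auto
    then show "S = carrier R" using S(1) by blast
  qed
qed

text \<open>The \<open>R\<close>-submodule of \<open>F\<^sub>*R\<close> generated by \<open>B\<close>.\<close>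

definition frob_span :: "'a set \<Rightarrow> 'a set" where
  "frob_span B = {x. \<forall>S. frob_closed S \<longrightarrow> B \<subseteq> S \<longrightarrow> x \<in> S}"

lemma frob_span_induct: "x \<in> frob_span B \<Longrightarrow> frob_closed S \<Longrightarrow> B \<subseteq> S \<Longrightarrow> x \<in> S"
  by (simp add: frob_span_def)

lemma frob_span_carrier: "B \<subseteq> carrier R \<Longrightarrow> x \<in> frob_span B \<Longrightarrow> x \<in> carrier R"
  by (erule frob_span_induct) (auto simp: frob_closed_def)

lemma frob_span_zero: "\<zero> \<in> frob_span B"
  and frob_span_add: "x \<in> frob_span B \<Longrightarrow> y \<in> frob_span B \<Longrightarrow> x \<oplus> y \<in> frob_span B"
  and frob_span_smult: "r \<in> carrier R \<Longrightarrow> x \<in> frob_span B \<Longrightarrow> r [^] q \<otimes> x \<in> frob_span B"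
  and frob_span_base: "b \<in> B \<Longrightarrow> b \<in> frob_span B"
  by (auto simp: frob_span_def frob_closed_def)

lemma frob_span_empty: "x \<in> frob_span {} \<Longrightarrow> x = \<zero>"
  using frob_span_induct[of x "{}" "{\<zero>}"] by (auto simp: frob_closed_def)

lemma frob_span_insert:
  assumes x: "x \<in> frob_span (insert b B)" and b: "b \<in> carrier R" and B: "B \<subseteq> carrier R"
  obtains r y where "r \<in> carrier R" "y \<in> frob_span B" "x = r [^] q \<otimes> b \<oplus> y"
proof -
  define S where "S = {r [^] q \<otimes> b \<oplus> y | r y. r \<in> carrier R \<and> y \<in> frob_span B}"
  note c = frob_span_carrier[OF B]
  have SI: "z \<in> S" if "r \<in> carrier R" "y \<in> frob_span B" "z = r [^] q \<otimes> b \<oplus> y" for z r y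
    using that by (auto simp: S_def)
  have "frob_closed S"
    unfolding frob_closed_def
  proof (intro conjI ballI)
    show "S \<subseteq> carrier R" using b c by (auto simp: S_def)
    show "\<zero> \<in> S" by (rule SI[of \<zero> \<zero>]) (use b frob_span_zero in \<open>auto simp: frob_zero\<close>)
    fix z assume "z \<in> S"
    then obtain r y where z: "r \<in> carrier R" "y \<in> frob_span B" "z = r [^] q \<otimes> b \<oplus> y" by (auto simp: S_def)
    show "a [^] q \<otimes> z \<in> S" if a: "a \<in> carrier R" for a
      by (rule SI[OF _ frob_span_smult[OF a z(2)], of "a \<otimes> r"])
        (use z a b c in \<open>auto simp: nat_pow_distrib r_distr m_assoc\<close>)
    fix z' assume "z' \<in> S"
    then obtain r' y' where z': "r' \<in> carrier R" "y' \<in> frob_span B" "z' = r' [^] q \<otimes> b \<oplus> y'" by (auto simp: S_def)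
    show "z \<oplus> z' \<in> S"
      by (rule SI[OF _ frob_span_add[OF z(2) z'(2)], of "r \<oplus> r'"])
        (use z z' b c in \<open>auto simp: frob_add l_distr a_ac\<close>)
  qed
  moreover have "insert b B \<subseteq> S"
  proof -
    have "b \<in> S" by (rule SI[of \<one> \<zero>]) (use b frob_span_zero in auto)
    moreover have "y \<in> S" if "y \<in> B" for y
      by (rule SI[of \<zero> y]) (use that b B frob_span_base in \<open>auto simp: frob_zero\<close>)
    ultimately show ?thesis by blast
  qed
  ultimately have "x \<in> S" by (rule frob_span_induct[OF x])
  then show thesis using that by (auto simp: S_def)
qed

lemma frob_span_image:
  assumes T: "\<And>x. x \<in> carrier R \<Longrightarrow> T x \<in> carrier R" "T \<zero> = \<zero>"
    "\<And>x y. x \<in> carrier R \<Longrightarrow> y \<in> carrier R \<Longrightarrow> T (x \<oplus> y) = T x \<oplus> T y"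
    "\<And>r x. r \<in> carrier R \<Longrightarrow> x \<in> carrier R \<Longrightarrow> T (r [^] q \<otimes> x) = r [^] q \<otimes> T x"
    and B: "B \<subseteq> carrier R" and x: "x \<in> frob_span B"
  shows "T x \<in> frob_span (T ` B)"
proof -
  have "frob_closed {x \<in> carrier R. T x \<in> frob_span (T ` B)}"
    unfolding frob_closed_def using T by (auto simp: frob_span_zero frob_span_add frob_span_smult)
  then have "x \<in> {x \<in> carrier R. T x \<in> frob_span (T ` B)}"
    by (rule frob_span_induct[OF x]) (use B frob_span_base in auto)
  then show ?thesis by simp
qed

lemma frob_mem: "ideal I R \<Longrightarrow> r \<in> I \<Longrightarrow> r [^] q \<in> I"
  using q_ge_2 by (auto intro: nat_pow_mem_ideal)

lemma frob_mem_square: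
  assumes "ideal I R" "r \<in> I" "b \<in> carrier R"
  shows "r [^] q \<otimes> b \<in> I \<cdot> I"
proof -
  have r: "r \<in> carrier R" using assms ideal_carrier by blast
  have "r [^] q \<otimes> b = r \<otimes> (r [^] (q - 2) \<otimes> b \<otimes> r)"
    using r assms by (simp add: pow_q2 m_ac)
  moreover have "r [^] (q - 2) \<otimes> b \<otimes> r \<in> I" by (rule ideal_mult) (use assms r in auto)
  ultimately show ?thesis using assms(2) by (simp add: ideal_prod.prod)
qed

section \<open>The lattice of Cartier submodules\<close>

abbreviation "cartier \<equiv> cartier_submodule R C"

lemma cartier_radical:
  assumes "cartier I" "x \<in> carrier R" "x [^] q \<in> I"
  shows "x \<in> I"
  using assms C_pow[of x] by (auto simp: cartier_submodule_def)

text \<open>Cartier submodules are radical because \<open>x = C(x\<^sup>q)\<close>.\<close>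

lemma cartier_sqrt:
  assumes I: "cartier I" and x: "x \<in> carrier R" "x \<otimes> x \<in> I"
  shows "x \<in> I"
proof (rule cartier_radical[OF I x(1)])
  show "x [^] q \<in> I"
    unfolding pow_q2[OF x(1)] by (rule ideal_mult) (use I x in \<open>auto simp: cartier_submodule_def\<close>)
qed

lemma cartier_pow:
  assumes I: "cartier I" and x: "x \<in> carrier R" "x [^] (k::nat) \<in> I"
  shows "x \<in> I"
  using x(2)
proof (induction k rule: less_induct)
  case (less k)
  have Ii: "ideal I R" using I by (simp add: cartier_submodule_def)
  consider "k = 0" | "k = 1" | "k \<ge> 2" by linarith
  then show ?case
  proof cases
    case 1
    then have "\<one> \<in> I" using less by simp
    then show ?thesis using Ii x(1) ideal_mult[of I \<one> x] by simp
  next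
    case 2
    then show ?thesis using less x(1) by simp
  next
    case 3
    let ?j = "k - 1"
    have "x [^] ?j \<otimes> x [^] ?j = x [^] (k - 2) \<otimes> x [^] k"
    proof -
      have "?j + ?j = k - 2 + k" using 3 by linarith
      then show ?thesis by (metis nat_pow_mult x(1))
    qed
    also have "\<dots> \<in> I" using Ii less.prems x(1) by (auto intro: ideal_mult)
    finally have "x [^] ?j \<in> I" using cartier_sqrt[OF I, of "x [^] ?j"] x(1) by simp
    then show ?thesis using less.IH[of ?j] 3 by simp
  qed
qed

lemma cartier_carrier: "cartier (carrier R)"
  by (auto simp: cartier_submodule_def oneideal)

text \<open>Colons take the place of primary decomposition; what makes them work is
  \<open>a C(x) = C(a\<^sup>q x)\<close>.\<close>

lemma cartier_colon:
  assumes J: "cartier J" and A: "A \<subseteq> carrier R"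
  shows "cartier {x \<in> carrier R. \<forall>a\<in>A. a \<otimes> x \<in> J}"
proof -
  have Ji: "ideal J R" using J by (simp add: cartier_submodule_def)
  have "a \<otimes> C x \<in> J" if ax: "x \<in> carrier R" "a \<in> carrier R" "a \<otimes> x \<in> J" for a x
  proof -
    have "a [^] q \<otimes> x = a [^] (q - 1) \<otimes> (a \<otimes> x)" using ax by (simp add: pow_q m_assoc)
    then have "a [^] q \<otimes> x \<in> J" using Ji ax by (auto intro: ideal_mult)
    then show ?thesis using J ax C_smult[of a x] by (auto simp: cartier_submodule_def)
  qed
  then show ?thesis using A colon_ideal[OF Ji A] by (auto simp: cartier_submodule_def)
qed

lemma cartier_sum:
  assumes "cartier I" "cartier J"
  shows "cartier (I <+>\<^bsub>R\<^esub> J)"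
proof -
  have i: "ideal I R" "ideal J R" using assms by (auto simp: cartier_submodule_def)
  have "C ` (I <+>\<^bsub>R\<^esub> J) \<subseteq> I <+>\<^bsub>R\<^esub> J"
  proof
    fix y assume "y \<in> C ` (I <+>\<^bsub>R\<^esub> J)"
    then obtain a b where "a \<in> I" "b \<in> J" "y = C (a \<oplus> b)" by (auto simp: set_add_def')
    then have "y = C a \<oplus> C b" "C a \<in> I" "C b \<in> J"
      using i assms C_add ideal_carrier by (auto simp: cartier_submodule_def)
    then show "y \<in> I <+>\<^bsub>R\<^esub> J" by (auto simp: set_add_def')
  qed
  then show ?thesis using add_ideals[OF i] by (simp add: cartier_submodule_def)
qed

lemma cartier_Inter:
  assumes S: "\<And>I. I \<in> S \<Longrightarrow> cartier I" "S \<noteq> {}"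
  shows "cartier (\<Inter>S)"
  unfolding cartier_submodule_def
proof
  show "ideal (\<Inter>S) R" using S by (intro i_Intersect) (auto simp: cartier_submodule_def)
  show "C ` \<Inter>S \<subseteq> \<Inter>S"
  proof (intro image_subsetI InterI)
    fix x I assume "x \<in> \<Inter>S" "I \<in> S"
    then have "x \<in> I" by blast
    then show "C x \<in> I" using S(1)[OF \<open>I \<in> S\<close>] by (auto simp: cartier_submodule_def)
  qed
qed

text \<open>Gaussian elimination on the list \<open>bs\<close>, where entries in \<open>P\<close> are simply dropped.  For \<open>b \<notin> P\<close> the map
  \<open>T(t) = b\<^sup>q t - C(b\<^sup>q\<^sup>-\<^sup>1 t)\<^sup>q b\<close> is linear on \<open>F\<^sub>*R\<close> and kills \<open>b\<close>, so it passes to the shorter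
  list.  For \<open>t\<close> in a Cartier submodule \<open>I\<close> it agrees with \<open>b\<^sup>q t\<close> up to an element of \<open>I\<^sup>2\<close>, as
  \<open>C(b\<^sup>q\<^sup>-\<^sup>1 t) \<in> I\<close> and \<open>q \<ge> 2\<close>.  It is essential that \<open>c\<close> does not depend on \<open>I\<close>.\<close>

lemma cartier_eliminate:
  assumes P: "primeideal P R" and bs: "set bs \<subseteq> carrier R"
  shows "\<exists>c\<in>carrier R. c \<notin> P \<and> (\<forall>I x. cartier I \<longrightarrow> P \<subseteq> I \<longrightarrow>
    x \<in> frob_span (set bs) \<longrightarrow> x \<in> I \<longrightarrow> c \<otimes> x \<in> (I \<cdot> I) <+>\<^bsub>R\<^esub> P)"
  using bs
proof (induction "length bs" arbitrary: bs)
  case 0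
  interpret P: primeideal P R by (rule P)
  have "\<one> \<otimes> x \<in> (I \<cdot> I) <+>\<^bsub>R\<^esub> P" if I: "cartier I" and x: "x \<in> frob_span (set bs)" for I x
  proof -
    have "ideal (I \<cdot> I) R" using I by (auto simp: cartier_submodule_def intro: ideal_prod_is_ideal)
    then have "\<zero> \<in> (I \<cdot> I) <+>\<^bsub>R\<^esub> P" using ideal_zero add_ideals P.ideal_axioms by blast
    moreover have "x = \<zero>" using x 0 frob_span_empty by simp
    ultimately show ?thesis by simp
  qed
  then show ?case using P.one_imp_carrier P.I_notcarr by (intro bexI[of _ \<one>]) auto
next
  case (Suc n)
  interpret P: primeideal P R by (rule P)
  have Pi: "ideal P R" by (rule P.ideal_axioms)
  obtain b bs1 where bs: "bs = b # bs1" "length bs1 = n" using Suc(2) by (metis length_Suc_conv)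
  have b: "b \<in> carrier R" and bs1: "set bs1 \<subseteq> carrier R" using Suc(3) bs by auto
  have Q: "ideal ((I \<cdot> I) <+>\<^bsub>R\<^esub> P) R" "I \<cdot> I \<subseteq> (I \<cdot> I) <+>\<^bsub>R\<^esub> P" "P \<subseteq> (I \<cdot> I) <+>\<^bsub>R\<^esub> P"
    if "cartier I" for I
    using that Pi ideal_prod_is_ideal[of I I] add_ideals sum_left sum_right by (auto simp: cartier_submodule_def)
  show ?case
  proof (cases "b \<in> P")
    case True
    obtain c where c: "c \<in> carrier R" "c \<notin> P" and IH: "\<And>I x. \<lbrakk>cartier I; P \<subseteq> I;
        x \<in> frob_span (set bs1); x \<in> I\<rbrakk> \<Longrightarrow> c \<otimes> x \<in> (I \<cdot> I) <+>\<^bsub>R\<^esub> P"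
      using Suc(1)[of bs1] bs bs1 by metis
    have "c \<otimes> x \<in> (I \<cdot> I) <+>\<^bsub>R\<^esub> P" if I: "cartier I" and PI: "P \<subseteq> I"
      and x: "x \<in> frob_span (set bs)" "x \<in> I" for I x
    proof -
      have Ii: "ideal I R" using I by (simp add: cartier_submodule_def)
      obtain r y where ry: "r \<in> carrier R" "y \<in> frob_span (set bs1)" "x = r [^] q \<otimes> b \<oplus> y"
        using frob_span_insert[of x b "set bs1"] x b bs1 bs by auto
      have y: "y \<in> carrier R" by (rule frob_span_carrier[OF bs1 ry(2)])
      have rb: "r [^] q \<otimes> b \<in> P" using ry True Pi by (auto intro: ideal_mult)
      have "y \<ominus> (\<ominus> (r [^] q \<otimes> b)) \<in> I" using x ry(1) y b by (simp add: ry(3) a_minus_def a_comm)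
      then have "y \<in> I" using ideal_minus_cancel[OF Ii y] ideal_neg[OF Pi rb] PI by blast
      then have "c \<otimes> y \<in> (I \<cdot> I) <+>\<^bsub>R\<^esub> P" using IH[OF I PI ry(2)] by simp
      moreover have "c \<otimes> (r [^] q \<otimes> b) \<in> (I \<cdot> I) <+>\<^bsub>R\<^esub> P"
        using ideal_mult[OF Pi rb c(1)] Q(3)[OF I] by blast
      moreover have "c \<otimes> x = c \<otimes> (r [^] q \<otimes> b) \<oplus> c \<otimes> y" using c ry y b by (simp add: r_distr)
      ultimately show ?thesis using ideal_add[OF Q(1)[OF I]] by simp
    qed
    then show ?thesis using c by blast
  next
    case False
    define L where "L = (\<lambda>t. C (b [^] (q - 1) \<otimes> t))"
    define T where "T = (\<lambda>t. b [^] q \<otimes> t \<ominus> L t [^] q \<otimes> b)"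
    have L_closed [simp]: "L t \<in> carrier R" if "t \<in> carrier R" for t using that b by (simp add: L_def)
    have L_add: "L (x \<oplus> y) = L x \<oplus> L y" if "x \<in> carrier R" "y \<in> carrier R" for x y
      using that b by (simp add: L_def r_distr C_add)
    have L_smult: "L (r [^] q \<otimes> x) = r \<otimes> L x" if "r \<in> carrier R" "x \<in> carrier R" for r x
      using that b C_smult[of r "b [^] (q - 1) \<otimes> x"] by (simp add: L_def m_lcomm)
    have L_b: "L b = b" using b by (simp only: L_def C_pow pow_q[symmetric])
    have T_add: "T (x \<oplus> y) = T x \<oplus> T y" if "x \<in> carrier R" "y \<in> carrier R" for x y
      using that b by (simp add: T_def L_add frob_add a_minus_def r_distr l_distr minus_add a_ac)
    have T_smult: "T (r [^] q \<otimes> x) = r [^] q \<otimes> T x" if "r \<in> carrier R" "x \<in> carrier R" for r x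
    proof -
      have "T (r [^] q \<otimes> x) = b [^] q \<otimes> (r [^] q \<otimes> x) \<ominus> (r [^] q \<otimes> L x [^] q) \<otimes> b"
        using that by (simp only: T_def L_smult nat_pow_distrib L_closed)
      then show ?thesis using that b by (simp add: T_def a_minus_def r_distr r_minus m_ac)
    qed
    have T_zero: "T \<zero> = \<zero>" using b by (simp add: T_def L_def C_zero frob_zero a_minus_def)
    have T_closed: "T x \<in> carrier R" if "x \<in> carrier R" for x using that b by (simp add: T_def)
    have T_b: "T b = \<zero>" using b by (simp add: T_def L_b a_minus_def r_neg)
    have "n = length (map T bs1)" "set (map T bs1) \<subseteq> carrier R" using bs bs1 T_closed by auto
    from Suc(1)[OF this] obtain c where c: "c \<in> carrier R" "c \<notin> P" and IH: "\<And>I x. \<lbrakk>cartier I; P \<subseteq> I;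
        x \<in> frob_span (set (map T bs1)); x \<in> I\<rbrakk> \<Longrightarrow> c \<otimes> x \<in> (I \<cdot> I) <+>\<^bsub>R\<^esub> P"
      by metis
    let ?c = "c \<otimes> b [^] q"
    have "?c \<otimes> x \<in> (I \<cdot> I) <+>\<^bsub>R\<^esub> P" if I: "cartier I" and PI: "P \<subseteq> I"
      and x: "x \<in> frob_span (set bs)" "x \<in> I" for I x
    proof -
      have Ii: "ideal I R" using I by (simp add: cartier_submodule_def)
      obtain r y where ry: "r \<in> carrier R" "y \<in> frob_span (set bs1)" "x = r [^] q \<otimes> b \<oplus> y"
        using frob_span_insert[of x b "set bs1"] x b bs1 bs by auto
      have y: "y \<in> carrier R" by (rule frob_span_carrier[OF bs1 ry(2)])
      have xc: "x \<in> carrier R" using ideal_carrier[OF Ii x(2)] .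
      have "T x = T y" using ry y b T_closed by (simp add: ry(3) T_add T_smult T_b)
      then have Tx: "T x \<in> frob_span (set (map T bs1))"
        using frob_span_image[OF T_closed T_zero T_add T_smult bs1 ry(2)] by simp
      have Lx: "L x \<in> I" using Ii x b I by (auto simp: L_def cartier_submodule_def ideal_mult)
      have LI: "L x [^] q \<otimes> b \<in> I \<cdot> I" by (rule frob_mem_square[OF Ii Lx b])
      have "L x [^] q \<otimes> b \<in> I" by (rule ideal_mult'[OF Ii frob_mem[OF Ii Lx] b])
      moreover have "b [^] q \<otimes> x \<in> I" using ideal_mult[OF Ii x(2)] b by simp
      ultimately have "T x \<in> I" unfolding T_def by (rule ideal_minus[OF Ii, rotated])
      then have "c \<otimes> T x \<in> (I \<cdot> I) <+>\<^bsub>R\<^esub> P" using IH[OF I PI Tx] by simp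
      moreover have "c \<otimes> (L x [^] q \<otimes> b) \<in> (I \<cdot> I) <+>\<^bsub>R\<^esub> P"
        using ideal_mult[OF Q(1)[OF I] _ c(1)] LI Q(2)[OF I] by blast
      moreover have "?c \<otimes> x = c \<otimes> T x \<oplus> c \<otimes> (L x [^] q \<otimes> b)"
        using c b xc by (simp add: T_def a_minus_def r_distr r_minus m_assoc a_assoc l_neg)
      ultimately show ?thesis using ideal_add[OF Q(1)[OF I]] by simp
    qed
    moreover have "?c \<notin> P" using P.prime_pow[OF b, of q] P.I_prime[of c "b [^] q"] b c False by auto
    ultimately show ?thesis using c b by (intro bexI[of _ ?c]) auto
  qed
qed

text \<open>The usual construction of a test element goes through the regular locus of \<open>R/P\<close>.  Elimination on
  generators of \<open>F\<^sub>*R\<close> gives \<open>c I \<subseteq> I\<^sup>2 + P\<close> directly.\<close>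

lemma cartier_test_element:
  assumes P: "primeideal P R"
  obtains c where "c \<in> carrier R" "c \<notin> P" "\<And>I. cartier I \<Longrightarrow> P \<subset> I \<Longrightarrow> c \<in> I"
proof -
  obtain gs where gs: "set gs \<subseteq> carrier R" "\<And>S. frob_closed S \<Longrightarrow> set gs \<subseteq> S \<Longrightarrow> S = carrier R"
    using frob_generators by blast
  have span: "x \<in> frob_span (set gs)" if "x \<in> carrier R" for x
    unfolding frob_span_def using gs(2) that by blast
  obtain c where c: "c \<in> carrier R" "c \<notin> P" and elim: "\<And>I x. \<lbrakk>cartier I; P \<subseteq> I;
      x \<in> frob_span (set gs); x \<in> I\<rbrakk> \<Longrightarrow> c \<otimes> x \<in> (I \<cdot> I) <+>\<^bsub>R\<^esub> P"
    using cartier_eliminate[OF P gs(1)] by metis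
  have "c \<in> I" if I: "cartier I" and PI: "P \<subset> I" for I
  proof -
    have Ii: "ideal I R" using I by (simp add: cartier_submodule_def)
    have "\<exists>k::nat. c [^] k \<in> I"
      by (rule mem_radical_of_mult_into_square[OF cring_axioms P Ii PI c(1)])
        (use elim[OF I] PI span ideal_carrier[OF Ii] in blast)
    then show ?thesis using cartier_pow[OF I c(1)] by blast
  qed
  then show thesis using that c by blast
qed

text \<open>For prime \<open>J\<close> every other Cartier submodule above \<open>J\<close> contains the smallest one above \<open>J\<close> and
  its test element.  For \<open>a b \<in> J\<close> with \<open>a, b \<notin> J\<close> the two larger ideals are \<open>J\<^sub>1 = (J : a)\<close> and
  \<open>J\<^sub>2 = (J : J\<^sub>1)\<close>; any \<open>x \<in> (I + J\<^sub>1) \<inter> (I + J\<^sub>2)\<close> has \<open>x\<^sup>2 \<in> I + J\<^sub>1 J\<^sub>2 \<subseteq> I\<close>.\<close>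

lemma finite_cartier_above:
  assumes "cartier J"
  shows "finite {I. cartier I \<and> J \<subseteq> I}"
proof -
  have "ideal J R" using assms by (simp add: cartier_submodule_def)
  then show ?thesis using assms
  proof (induction rule: noetherian_induct)
    case (step J)
    have up: "finite {I. cartier I \<and> K \<subseteq> I}" if "cartier K" "J \<subset> K" for K
      using step(2)[of K] that by (simp add: cartier_submodule_def)
    have Jc: "J \<subseteq> carrier R" using ideal_carrier[OF step(1)] by blast
    consider "J = carrier R" | "primeideal J R" | "J \<noteq> carrier R" "\<not> primeideal J R" by blast
    then show ?case
    proof cases
      case 1
      have "{I. cartier I \<and> J \<subseteq> I} \<subseteq> {carrier R}"
        using ideal_carrier unfolding 1 cartier_submodule_def by blast
      then show ?thesis using finite_subset by blast
    next
      case 2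
      obtain c where c: "c \<in> carrier R" "c \<notin> J" "\<And>I. cartier I \<Longrightarrow> J \<subset> I \<Longrightarrow> c \<in> I"
        using cartier_test_element[OF 2] by metis
      define K where "K = \<Inter>{I. cartier I \<and> J \<subseteq> I \<and> c \<in> I}"
      have K: "cartier K"
        unfolding K_def by (rule cartier_Inter) (use cartier_carrier Jc c in auto)
      have "J \<subseteq> K" "c \<in> K" by (auto simp: K_def)
      then have "J \<subset> K" using c(2) by blast
      have "{I. cartier I \<and> J \<subseteq> I} \<subseteq> insert J {I. cartier I \<and> K \<subseteq> I}"
        using c(3) unfolding K_def by blast
      then show ?thesis using up[OF K \<open>J \<subset> K\<close>] finite_subset by blast
    next
      case 3
      obtain a b where ab: "a \<in> carrier R" "b \<in> carrier R" "a \<otimes> b \<in> J" "a \<notin> J" "b \<notin> J"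
      proof -
        have "\<exists>a\<in>carrier R. \<exists>b\<in>carrier R. a \<otimes> b \<in> J \<and> a \<notin> J \<and> b \<notin> J"
        proof (rule ccontr)
          assume "\<not> ?thesis"
          then have "primeideal J R"
            using step(1) 3(1) cring_axioms by (intro primeidealI) auto
          with 3(2) show False ..
        qed
        then show thesis using that by blast
      qed
      define J1 where "J1 = {x \<in> carrier R. \<forall>y\<in>{a}. y \<otimes> x \<in> J}"
      define J2 where "J2 = {x \<in> carrier R. \<forall>y\<in>J1. y \<otimes> x \<in> J}"
      have J1: "cartier J1" unfolding J1_def by (rule cartier_colon) (use step ab in auto)
      have J2: "cartier J2" unfolding J2_def by (rule cartier_colon) (use step in \<open>auto simp: J1_def\<close>)
      have "J \<subset> J1" using ab Jc step(1) by (auto simp: J1_def intro: ideal_mult)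
      have "J \<subset> J2"
      proof -
        have "a \<in> J2" using ab m_comm by (auto simp: J2_def J1_def)
        moreover have "J \<subseteq> J2" using Jc step(1) by (auto simp: J1_def J2_def intro: ideal_mult)
        ultimately show ?thesis using ab by blast
      qed
      define \<Phi> where "\<Phi> = (\<lambda>I. (I <+>\<^bsub>R\<^esub> J1, I <+>\<^bsub>R\<^esub> J2))"
      have rec: "I = (I <+>\<^bsub>R\<^esub> J1) \<inter> (I <+>\<^bsub>R\<^esub> J2)" if I: "cartier I" and JI: "J \<subseteq> I" for I
      proof
        have i: "ideal I R" "ideal J1 R" "ideal J2 R" using I J1 J2 by (auto simp: cartier_submodule_def)
        show "I \<subseteq> (I <+>\<^bsub>R\<^esub> J1) \<inter> (I <+>\<^bsub>R\<^esub> J2)" using sum_left i by blast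
        show "(I <+>\<^bsub>R\<^esub> J1) \<inter> (I <+>\<^bsub>R\<^esub> J2) \<subseteq> I"
        proof
          fix x assume "x \<in> (I <+>\<^bsub>R\<^esub> J1) \<inter> (I <+>\<^bsub>R\<^esub> J2)"
          then obtain u v u' v' where *: "u \<in> I" "v \<in> J1" "x = u \<oplus> v" "u' \<in> I" "v' \<in> J2" "x = u' \<oplus> v'"
            by (auto simp: set_add_def')
          have c: "u \<in> carrier R" "v \<in> carrier R" "u' \<in> carrier R" "v' \<in> carrier R"
            using * i ideal_carrier by auto
          have "v \<otimes> v' \<in> I" using * JI by (auto simp: J2_def)
          moreover have "x \<otimes> x = u \<otimes> (u' \<oplus> v') \<oplus> (v \<otimes> u' \<oplus> v \<otimes> v')"
            using c *(3,6) by (metis l_distr r_distr a_closed)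
          moreover have "u \<otimes> (u' \<oplus> v') \<in> I" "v \<otimes> u' \<in> I"
            using * c i by (simp_all add: ideal_mult ideal_mult')
          ultimately have "x \<otimes> x \<in> I" using i by (simp only: ideal_add)
          moreover have "x \<in> carrier R" unfolding *(3) using c by simp
          ultimately show "x \<in> I" using cartier_sqrt[OF I] by blast
        qed
      qed
      have "inj_on \<Phi> {I. cartier I \<and> J \<subseteq> I}"
      proof (rule inj_onI)
        fix X Y assume *: "X \<in> {I. cartier I \<and> J \<subseteq> I}" "Y \<in> {I. cartier I \<and> J \<subseteq> I}"
          and eq: "\<Phi> X = \<Phi> Y"
        have "X = (X <+>\<^bsub>R\<^esub> J1) \<inter> (X <+>\<^bsub>R\<^esub> J2)" "Y = (Y <+>\<^bsub>R\<^esub> J1) \<inter> (Y <+>\<^bsub>R\<^esub> J2)"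
          using rec * by blast+
        moreover have "X <+>\<^bsub>R\<^esub> J1 = Y <+>\<^bsub>R\<^esub> J1" "X <+>\<^bsub>R\<^esub> J2 = Y <+>\<^bsub>R\<^esub> J2"
          using eq by (auto simp: \<Phi>_def)
        ultimately show "X = Y" by metis
      qed
      moreover have "\<Phi> ` {I. cartier I \<and> J \<subseteq> I} \<subseteq>
          {I. cartier I \<and> J1 \<subseteq> I} \<times> {I. cartier I \<and> J2 \<subseteq> I}"
      proof -
        have "(I <+>\<^bsub>R\<^esub> J1) \<in> {I. cartier I \<and> J1 \<subseteq> I} \<and> (I <+>\<^bsub>R\<^esub> J2) \<in> {I. cartier I \<and> J2 \<subseteq> I}"
          if I: "cartier I" for I
          using cartier_sum[OF I J1] cartier_sum[OF I J2] sum_right[of I J1] sum_right[of I J2] I J1 J2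
          unfolding cartier_submodule_def by simp
        then show ?thesis unfolding \<Phi>_def by blast
      qed
      ultimately show ?thesis
        using up[OF J1 \<open>J \<subset> J1\<close>] up[OF J2 \<open>J \<subset> J2\<close>] by (meson finite_SigmaI finite_imageD finite_subset)
    qed
  qed
qed

theorem finite_cartier_submodules: "finite {I. cartier I}"
proof -
  have "cartier {\<zero>}" by (simp add: cartier_submodule_def zeroideal C_zero)
  from finite_cartier_above[OF this] show ?thesis
    by (rule finite_subset[rotated]) (auto simp: cartier_submodule_def ideal_zero)
qed

end

section \<open>Injective modules\<close>

lemma mod_homI:
  assumes "\<And>x. x \<in> carrier M \<Longrightarrow> h x \<in> carrier N"
    "\<And>x y. x \<in> carrier M \<Longrightarrow> y \<in> carrier M \<Longrightarrow> h (x \<oplus>\<^bsub>M\<^esub> y) = h x \<oplus>\<^bsub>N\<^esub> h y"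
    "\<And>r x. r \<in> carrier R \<Longrightarrow> x \<in> carrier M \<Longrightarrow> h (r \<odot>\<^bsub>M\<^esub> x) = r \<odot>\<^bsub>N\<^esub> h x"
  shows "h \<in> mod_hom R M N"
  using assms by (auto simp: mod_hom_def)

lemma mod_homD:
  assumes "h \<in> mod_hom R M N"
  shows "x \<in> carrier M \<Longrightarrow> h x \<in> carrier N"
    "x \<in> carrier M \<Longrightarrow> y \<in> carrier M \<Longrightarrow> h (x \<oplus>\<^bsub>M\<^esub> y) = h x \<oplus>\<^bsub>N\<^esub> h y"
    "r \<in> carrier R \<Longrightarrow> x \<in> carrier M \<Longrightarrow> h (r \<odot>\<^bsub>M\<^esub> x) = r \<odot>\<^bsub>N\<^esub> h x"
  using assms by (auto simp: mod_hom_def)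

lemma regular_module_simps [simp]:
  "carrier (regular_module R) = carrier R" "zero (regular_module R) = zero R"
  "add (regular_module R) = add R" "smult (regular_module R) = monoid.mult R"
  by (simp_all add: regular_module_def)

lemma restrict_scalars_simps [simp]:
  "carrier (restrict_scalars f M) = carrier M" "zero (restrict_scalars f M) = zero M"
  "add (restrict_scalars f M) = add M" "smult (restrict_scalars f M) r x = f r \<odot>\<^bsub>M\<^esub> x"
  by (simp_all add: restrict_scalars_def)

lemma (in cring) module_regular: "module R (regular_module R)"
proof (rule moduleI[OF cring_axioms])
  show "abelian_group (regular_module R)"
    by (rule abelian_groupI) (auto simp: a_ac intro: l_neg)
qed (auto simp: l_distr r_distr m_assoc)

lemma (in module) smult_lcomm:
  "a \<in> carrier R \<Longrightarrow> b \<in> carrier R \<Longrightarrow> x \<in> carrier M \<Longrightarrow> a \<odot>\<^bsub>M\<^esub> (b \<odot>\<^bsub>M\<^esub> x) = b \<odot>\<^bsub>M\<^esub> (a \<odot>\<^bsub>M\<^esub> x)"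
  by (metis R.m_comm smult_assoc1)

lemma (in module) module_submodule_carrier:
  assumes "H \<subseteq> carrier M" "\<zero>\<^bsub>M\<^esub> \<in> H" "\<And>x y. x \<in> H \<Longrightarrow> y \<in> H \<Longrightarrow> x \<oplus>\<^bsub>M\<^esub> y \<in> H"
    and smult: "\<And>r x. r \<in> carrier R \<Longrightarrow> x \<in> H \<Longrightarrow> r \<odot>\<^bsub>M\<^esub> x \<in> H"
  shows "submodule H R M"
proof (rule submoduleI)
  show "\<ominus>\<^bsub>M\<^esub> a \<in> H" if "a \<in> H" for a
    using smult[of "\<ominus> \<one>" a] smult_l_minus[of \<one> a] that assms(1) by auto
qed (use assms in auto)

text \<open>Injectivity tested on ideals, with the extension of \<open>g\<close> to \<open>R\<close> recorded by its value \<open>e\<close> at \<open>1\<close>.\<close>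

definition baer :: "('a, 'r) ring_scheme \<Rightarrow> ('a, 'e, 's) module_scheme \<Rightarrow> bool" where
  "baer R E \<longleftrightarrow> (\<forall>I g. ideal I R \<longrightarrow> g \<in> mod_hom R (regular_module R\<lparr>carrier := I\<rparr>) E \<longrightarrow>
    (\<exists>e\<in>carrier E. \<forall>r\<in>I. g r = r \<odot>\<^bsub>E\<^esub> e))"

lemma (in cring) injective_imp_baer:
  assumes "injective_module R E"
  shows "baer R E"
  unfolding baer_def
proof (intro allI impI)
  fix I g assume I: "ideal I R" and g: "g \<in> mod_hom R (regular_module R\<lparr>carrier := I\<rparr>) E"
  interpret reg: module R "regular_module R" by (rule module_regular)
  let ?I = "regular_module R\<lparr>carrier := I\<rparr>"
  have sub: "submodule I R (regular_module R)"
    by (rule reg.module_submodule_carrier) (use I in \<open>auto simp: ideal_carrier ideal_zero ideal_add ideal_mult\<close>)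
  have "module R ?I" by (rule submodule.submodule_is_module[OF sub module_regular])
  moreover have "id \<in> mod_hom R ?I (regular_module R)"
    by (rule mod_homI) (use I in \<open>auto simp: ideal_carrier\<close>)
  ultimately obtain h where h: "h \<in> mod_hom R (regular_module R) E" "\<forall>x\<in>I. h x = g x"
    using assms g module_regular unfolding injective_module_def by fastforce
  have "g r = r \<odot>\<^bsub>E\<^esub> h \<one>" if "r \<in> I" for r
    using mod_homD(3)[OF h(1), of r \<one>] h(2) that I ideal_carrier by auto
  moreover have "h \<one> \<in> carrier E" using mod_homD(1)[OF h(1), of \<one>] by simp
  ultimately show "\<exists>e\<in>carrier E. \<forall>r\<in>I. g r = r \<odot>\<^bsub>E\<^esub> e" by blast
qed

text \<open>A partial homomorphism from \<open>M\<close> to \<open>E\<close>, given by its graph: a submodule of \<open>M \<times> E\<close> that is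
  single valued.  As plain sets, graphs are ordered by inclusion, and Zorn's lemma applies to them.\<close>

definition linear_graph ::
  "('a, 'r) ring_scheme \<Rightarrow> ('a, 'm, 's) module_scheme \<Rightarrow> ('a, 'e, 't) module_scheme \<Rightarrow> ('m \<times> 'e) set \<Rightarrow> bool" where
  "linear_graph R M E G \<longleftrightarrow> G \<subseteq> carrier M \<times> carrier E \<and> G \<noteq> {} \<and>
    (\<forall>x y x' y'. (x, y) \<in> G \<longrightarrow> (x', y') \<in> G \<longrightarrow> (x \<oplus>\<^bsub>M\<^esub> x', y \<oplus>\<^bsub>E\<^esub> y') \<in> G) \<and>
    (\<forall>r\<in>carrier R. \<forall>x y. (x, y) \<in> G \<longrightarrow> (r \<odot>\<^bsub>M\<^esub> x, r \<odot>\<^bsub>E\<^esub> y) \<in> G) \<and>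
    (\<forall>y. (\<zero>\<^bsub>M\<^esub>, y) \<in> G \<longrightarrow> y = \<zero>\<^bsub>E\<^esub>)"

locale two_modules = M: module R M + E: module R E
  for R :: "('a, 'r) ring_scheme" (structure)
    and M :: "('a, 'm, 's) module_scheme" and E :: "('a, 'e, 't) module_scheme"
begin

abbreviation "graph \<equiv> linear_graph R M E"

lemma graph_carrier: "graph G \<Longrightarrow> (x, y) \<in> G \<Longrightarrow> x \<in> carrier M \<and> y \<in> carrier E"
  and graph_add: "graph G \<Longrightarrow> (x, y) \<in> G \<Longrightarrow> (x', y') \<in> G \<Longrightarrow> (x \<oplus>\<^bsub>M\<^esub> x', y \<oplus>\<^bsub>E\<^esub> y') \<in> G"
  and graph_smult: "graph G \<Longrightarrow> (x, y) \<in> G \<Longrightarrow> r \<in> carrier R \<Longrightarrow> (r \<odot>\<^bsub>M\<^esub> x, r \<odot>\<^bsub>E\<^esub> y) \<in> G"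
  and graph_zero: "graph G \<Longrightarrow> (\<zero>\<^bsub>M\<^esub>, y) \<in> G \<Longrightarrow> y = \<zero>\<^bsub>E\<^esub>"
  by (auto simp: linear_graph_def)

lemma graph_zero_mem:
  assumes "graph G"
  shows "(\<zero>\<^bsub>M\<^esub>, \<zero>\<^bsub>E\<^esub>) \<in> G"
proof -
  obtain x y where xy: "(x, y) \<in> G" using assms by (auto simp: linear_graph_def)
  then show ?thesis
    using graph_smult[OF assms xy, of "\<zero>\<^bsub>R\<^esub>"] graph_carrier[OF assms xy] by simp
qed

lemma graph_neg:
  assumes "graph G" "(x, y) \<in> G"
  shows "(\<ominus>\<^bsub>M\<^esub> x, \<ominus>\<^bsub>E\<^esub> y) \<in> G"
  using graph_smult[OF assms, of "\<ominus>\<^bsub>R\<^esub> \<one>\<^bsub>R\<^esub>"] graph_carrier[OF assms]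
  by (simp add: M.smult_l_minus E.smult_l_minus)

lemma graph_unique:
  assumes G: "graph G" and xy: "(x, y) \<in> G" "(x, y') \<in> G"
  shows "y = y'"
proof -
  have "(x \<oplus>\<^bsub>M\<^esub> \<ominus>\<^bsub>M\<^esub> x, y \<oplus>\<^bsub>E\<^esub> \<ominus>\<^bsub>E\<^esub> y') \<in> G"
    using graph_add[OF G xy(1) graph_neg[OF G xy(2)]] .
  then have "y \<oplus>\<^bsub>E\<^esub> \<ominus>\<^bsub>E\<^esub> y' = \<zero>\<^bsub>E\<^esub>"
    using graph_zero[OF G] graph_carrier[OF G xy(1)] by (simp add: M.M.r_neg)
  then show ?thesis using graph_carrier[OF G xy(1)] graph_carrier[OF G xy(2)]
    by (metis E.M.add.inv_closed E.M.minus_equality E.M.minus_minus)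
qed

text \<open>The one-step extension to \<open>z\<close>, which also serves to build functionals by hand.\<close>

lemma graph_adjoin:
  assumes G: "graph G" and z: "z \<in> carrier M" and e: "e \<in> carrier E"
    and compat: "\<And>r y. r \<in> carrier R \<Longrightarrow> (r \<odot>\<^bsub>M\<^esub> z, y) \<in> G \<Longrightarrow> y = r \<odot>\<^bsub>E\<^esub> e"
  obtains G' where "graph G'" "G \<subseteq> G'" "(z, e) \<in> G'"
proof -
  define G' where "G' = {(x \<oplus>\<^bsub>M\<^esub> r \<odot>\<^bsub>M\<^esub> z, y \<oplus>\<^bsub>E\<^esub> r \<odot>\<^bsub>E\<^esub> e) | x y r. (x, y) \<in> G \<and> r \<in> carrier R}"
  have sub: "G \<subseteq> G'"
  proof
    fix w assume w: "w \<in> G"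
    then obtain x y where xy: "w = (x, y)" "(x, y) \<in> G" by (cases w) auto
    then have "w = (x \<oplus>\<^bsub>M\<^esub> \<zero>\<^bsub>R\<^esub> \<odot>\<^bsub>M\<^esub> z, y \<oplus>\<^bsub>E\<^esub> \<zero>\<^bsub>R\<^esub> \<odot>\<^bsub>E\<^esub> e)" using graph_carrier[OF G xy(2)] z e by simp
    then show "w \<in> G'" using xy(2) unfolding G'_def by blast
  qed
  have "graph G'"
    unfolding linear_graph_def
  proof (intro conjI allI ballI impI)
    show "G' \<subseteq> carrier M \<times> carrier E" using graph_carrier[OF G] z e by (auto simp: G'_def)
    show "G' \<noteq> {}" using sub G by (auto simp: linear_graph_def)
    show "(x \<oplus>\<^bsub>M\<^esub> x', y \<oplus>\<^bsub>E\<^esub> y') \<in> G'" if xy: "(x, y) \<in> G'" "(x', y') \<in> G'" for x y x' y'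
    proof -
      obtain a b r a' b' r' where *: "(a, b) \<in> G" "r \<in> carrier R" "x = a \<oplus>\<^bsub>M\<^esub> r \<odot>\<^bsub>M\<^esub> z" "y = b \<oplus>\<^bsub>E\<^esub> r \<odot>\<^bsub>E\<^esub> e"
        "(a', b') \<in> G" "r' \<in> carrier R" "x' = a' \<oplus>\<^bsub>M\<^esub> r' \<odot>\<^bsub>M\<^esub> z" "y' = b' \<oplus>\<^bsub>E\<^esub> r' \<odot>\<^bsub>E\<^esub> e"
        using xy by (auto simp: G'_def)
      have "x \<oplus>\<^bsub>M\<^esub> x' = (a \<oplus>\<^bsub>M\<^esub> a') \<oplus>\<^bsub>M\<^esub> (r \<oplus>\<^bsub>R\<^esub> r') \<odot>\<^bsub>M\<^esub> z" "y \<oplus>\<^bsub>E\<^esub> y' = (b \<oplus>\<^bsub>E\<^esub> b') \<oplus>\<^bsub>E\<^esub> (r \<oplus>\<^bsub>R\<^esub> r') \<odot>\<^bsub>E\<^esub> e"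
        using * graph_carrier[OF G *(1)] graph_carrier[OF G *(5)] z e
        by (simp_all add: M.smult_l_distr E.smult_l_distr M.M.a_ac E.M.a_ac)
      then show ?thesis using graph_add[OF G *(1,5)] *(2,6) unfolding G'_def by blast
    qed
    show "(r \<odot>\<^bsub>M\<^esub> x, r \<odot>\<^bsub>E\<^esub> y) \<in> G'" if r: "r \<in> carrier R" and xy: "(x, y) \<in> G'" for r x y
    proof -
      obtain a b t where *: "(a, b) \<in> G" "t \<in> carrier R" "x = a \<oplus>\<^bsub>M\<^esub> t \<odot>\<^bsub>M\<^esub> z" "y = b \<oplus>\<^bsub>E\<^esub> t \<odot>\<^bsub>E\<^esub> e"
        using xy by (auto simp: G'_def)
      have "r \<odot>\<^bsub>M\<^esub> x = r \<odot>\<^bsub>M\<^esub> a \<oplus>\<^bsub>M\<^esub> (r \<otimes>\<^bsub>R\<^esub> t) \<odot>\<^bsub>M\<^esub> z" "r \<odot>\<^bsub>E\<^esub> y = r \<odot>\<^bsub>E\<^esub> b \<oplus>\<^bsub>E\<^esub> (r \<otimes>\<^bsub>R\<^esub> t) \<odot>\<^bsub>E\<^esub> e"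
        using * graph_carrier[OF G *(1)] z e r
        by (simp_all add: M.smult_r_distr E.smult_r_distr M.smult_assoc1 E.smult_assoc1)
      then show ?thesis using graph_smult[OF G *(1) r] *(2) r unfolding G'_def by blast
    qed
    show "y = \<zero>\<^bsub>E\<^esub>" if xy: "(\<zero>\<^bsub>M\<^esub>, y) \<in> G'" for y
    proof -
      obtain a b r where *: "(a, b) \<in> G" "r \<in> carrier R" "\<zero>\<^bsub>M\<^esub> = a \<oplus>\<^bsub>M\<^esub> r \<odot>\<^bsub>M\<^esub> z" "y = b \<oplus>\<^bsub>E\<^esub> r \<odot>\<^bsub>E\<^esub> e"
        using xy by (auto simp: G'_def)
      note ab = graph_carrier[OF G *(1)]
      have "r \<odot>\<^bsub>M\<^esub> z = \<ominus>\<^bsub>M\<^esub> a"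
        using *(2,3) ab z by (metis M.M.a_comm M.M.minus_equality M.smult_closed)
      then have "\<ominus>\<^bsub>E\<^esub> b = r \<odot>\<^bsub>E\<^esub> e" using compat[OF *(2)] graph_neg[OF G *(1)] by simp
      then show ?thesis using *(4) ab by (metis E.M.r_neg)
    qed
  qed
  moreover have "(z, e) \<in> G'"
  proof -
    have "(z, e) = (\<zero>\<^bsub>M\<^esub> \<oplus>\<^bsub>M\<^esub> \<one>\<^bsub>R\<^esub> \<odot>\<^bsub>M\<^esub> z, \<zero>\<^bsub>E\<^esub> \<oplus>\<^bsub>E\<^esub> \<one>\<^bsub>R\<^esub> \<odot>\<^bsub>E\<^esub> e)" using z e by simp
    then show ?thesis using graph_zero_mem[OF G] M.R.one_closed unfolding G'_def by blast
  qed
  ultimately show thesis using that sub by blast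
qed

lemma graph_Union:
  assumes D: "D \<noteq> {}" "\<And>G. G \<in> D \<Longrightarrow> graph G" and ch: "\<And>G G'. G \<in> D \<Longrightarrow> G' \<in> D \<Longrightarrow> G \<subseteq> G' \<or> G' \<subseteq> G"
  shows "graph (\<Union>D)"
  unfolding linear_graph_def
proof (intro conjI allI ballI impI)
  show "\<Union>D \<subseteq> carrier M \<times> carrier E" using graph_carrier[OF D(2)] by fast
  show "\<Union>D \<noteq> {}" using D graph_zero_mem by blast
  show "(x \<oplus>\<^bsub>M\<^esub> x', y \<oplus>\<^bsub>E\<^esub> y') \<in> \<Union>D" if xy: "(x, y) \<in> \<Union>D" "(x', y') \<in> \<Union>D" for x y x' y'
  proof -
    obtain G G' where G: "G \<in> D" "(x, y) \<in> G" "G' \<in> D" "(x', y') \<in> G'" using xy by blast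
    then obtain G'' where "G'' \<in> D" "(x, y) \<in> G''" "(x', y') \<in> G''" using ch[OF G(1,3)] by blast
    then show ?thesis using D(2) graph_add by blast
  qed
  show "(r \<odot>\<^bsub>M\<^esub> x, r \<odot>\<^bsub>E\<^esub> y) \<in> \<Union>D" if "r \<in> carrier R" "(x, y) \<in> \<Union>D" for r x y
    using that D(2) graph_smult by blast
  show "y = \<zero>\<^bsub>E\<^esub>" if "(\<zero>\<^bsub>M\<^esub>, y) \<in> \<Union>D" for y using that D(2) graph_zero by blast
qed

text \<open>Baer's criterion: a maximal graph is total, since for \<open>z\<close> outside its domain the ideal
  \<open>{r. r z in the domain}\<close> maps to \<open>E\<close>, and an extension of that map to \<open>R\<close> supplies a value at
  \<open>z\<close>.\<close>

lemma baer_extend: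
  assumes baer: "baer R E" and G0: "graph G0"
  obtains h where "h \<in> mod_hom R M E" "\<And>x y. (x, y) \<in> G0 \<Longrightarrow> h x = y"
proof -
  define S where "S = {G. graph G \<and> G0 \<subseteq> G}"
  have "\<exists>G\<in>S. \<forall>X\<in>S. G \<subseteq> X \<longrightarrow> X = G"
  proof (rule subset_Zorn_nonempty)
    show "S \<noteq> {}" using G0 by (auto simp: S_def)
    fix D assume D: "D \<noteq> {}" "subset.chain S D"
    then have DS: "\<And>G. G \<in> D \<Longrightarrow> graph G \<and> G0 \<subseteq> G" by (auto simp: pred_on.chain_def S_def)
    have ch: "G \<subseteq> G' \<or> G' \<subseteq> G" if "G \<in> D" "G' \<in> D" for G G'
      using D(2) that by (auto simp: pred_on.chain_def)
    have "graph (\<Union>D)" by (rule graph_Union[OF D(1) _ ch]) (use DS in blast)+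
    then show "\<Union>D \<in> S" using D(1) DS by (auto simp: S_def)
  qed
  then obtain G where G: "graph G" "G0 \<subseteq> G" and max: "\<And>X. graph X \<Longrightarrow> G \<subseteq> X \<Longrightarrow> X = G"
    by (auto simp: S_def)
  have total: "\<exists>y. (z, y) \<in> G" if z: "z \<in> carrier M" for z
  proof -
    define I where "I = {r \<in> carrier R. \<exists>y. (r \<odot>\<^bsub>M\<^esub> z, y) \<in> G}"
    define f where "f = (\<lambda>r. THE y. (r \<odot>\<^bsub>M\<^esub> z, y) \<in> G)"
    have f: "f r = y" if "(r \<odot>\<^bsub>M\<^esub> z, y) \<in> G" for r y
      unfolding f_def by (rule the_equality[where a=y]) (use that graph_unique[OF G(1)] in blast)+
    have I_mem: "(r \<odot>\<^bsub>M\<^esub> z, f r) \<in> G" if "r \<in> I" for r using that f by (auto simp: I_def)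
    have Ic: "r \<in> carrier R" if "r \<in> I" for r using that by (simp add: I_def)
    have II: "r \<in> I" if "r \<in> carrier R" "(r \<odot>\<^bsub>M\<^esub> z, y) \<in> G" for r y using that by (auto simp: I_def)
    have add: "((r \<oplus>\<^bsub>R\<^esub> r') \<odot>\<^bsub>M\<^esub> z, f r \<oplus>\<^bsub>E\<^esub> f r') \<in> G" if "r \<in> I" "r' \<in> I" for r r'
      using graph_add[OF G(1) I_mem[OF that(1)] I_mem[OF that(2)]] that z by (simp add: I_def M.smult_l_distr)
    have mult: "((r' \<otimes>\<^bsub>R\<^esub> r) \<odot>\<^bsub>M\<^esub> z, r' \<odot>\<^bsub>E\<^esub> f r) \<in> G" if "r \<in> I" "r' \<in> carrier R" for r r'
      using graph_smult[OF G(1) I_mem[OF that(1)] that(2)] that z by (simp add: I_def M.smult_assoc1)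
    have "ideal I R"
    proof (rule M.idealI_cring)
      show "I \<subseteq> carrier R" using Ic by blast
      show "\<zero>\<^bsub>R\<^esub> \<in> I" by (rule II[where y="\<zero>\<^bsub>E\<^esub>"]) (use graph_zero_mem[OF G(1)] z in auto)
      show "r \<oplus>\<^bsub>R\<^esub> r' \<in> I" if "r \<in> I" "r' \<in> I" for r r' by (rule II[OF _ add]) (use that Ic in auto)
      show "r' \<otimes>\<^bsub>R\<^esub> r \<in> I" if "r' \<in> carrier R" "r \<in> I" for r r' by (rule II[OF _ mult]) (use that Ic in auto)
    qed
    moreover have "f \<in> mod_hom R (regular_module R\<lparr>carrier := I\<rparr>) E"
      by (rule mod_homI) (use graph_carrier[OF G(1) I_mem] f[OF add] f[OF mult] in auto)
    ultimately obtain e where e: "e \<in> carrier E" "\<And>r. r \<in> I \<Longrightarrow> f r = r \<odot>\<^bsub>E\<^esub> e"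
      using baer unfolding baer_def by blast
    have "y = r \<odot>\<^bsub>E\<^esub> e" if "r \<in> carrier R" "(r \<odot>\<^bsub>M\<^esub> z, y) \<in> G" for r y
      using e(2)[OF II[OF that]] f[OF that(2)] by simp
    then obtain G' where "graph G'" "G \<subseteq> G'" "(z, e) \<in> G'" using graph_adjoin[OF G(1) z e(1)] by metis
    then show ?thesis using max by blast
  qed
  define h where "h = (\<lambda>x. THE y. (x, y) \<in> G)"
  have h: "h x = y" if "(x, y) \<in> G" for x y
    unfolding h_def by (rule the_equality) (use that graph_unique[OF G(1)] in blast)+
  have hG: "(x, h x) \<in> G" if "x \<in> carrier M" for x using total[OF that] h by auto
  have "h \<in> mod_hom R M E"
  proof (rule mod_homI)
    show "h x \<in> carrier E" if "x \<in> carrier M" for x using graph_carrier[OF G(1) hG[OF that]] by simp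
    show "h (x \<oplus>\<^bsub>M\<^esub> y) = h x \<oplus>\<^bsub>E\<^esub> h y" if "x \<in> carrier M" "y \<in> carrier M" for x y
      by (rule h[OF graph_add[OF G(1) hG[OF that(1)] hG[OF that(2)]]])
    show "h (r \<odot>\<^bsub>M\<^esub> x) = r \<odot>\<^bsub>E\<^esub> h x" if "r \<in> carrier R" "x \<in> carrier M" for r x
      by (rule h[OF graph_smult[OF G(1) hG[OF that(2)] that(1)]])
  qed
  then show thesis using that h G(2) by blast
qed

end

section \<open>Matlis duality over a complete local ring\<close>

locale noetherian_maximal = cring R + noetherian_ring R + maximalideal \<mm> R for R (structure) and \<mm>
begin

lemma m_ideal: "ideal \<mm> R" by (rule ideal_axioms)

lemma m_carrier: "t \<in> \<mm> \<Longrightarrow> t \<in> carrier R" by (rule Icarr)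

lemma one_not_m: "\<one> \<notin> \<mm>" using one_imp_carrier I_notcarr by metis

lemma unit_mod_m:
  assumes "r \<in> carrier R" "r \<notin> \<mm>"
  obtains v t where "v \<in> carrier R" "t \<in> \<mm>" "\<one> = t \<oplus> v \<otimes> r"
proof -
  have "\<mm> <+>\<^bsub>R\<^esub> PIdl r = carrier R"
    using I_maximal[OF adjoin_ideal[OF m_ideal assms(1)]] adjoin_gt[OF m_ideal assms]
      ideal_carrier[OF adjoin_ideal[OF m_ideal assms(1)]] by blast
  then have "\<one> \<in> \<mm> <+>\<^bsub>R\<^esub> PIdl r" by simp
  then show thesis using that by (auto simp: adjoin_iff)
qed

text \<open>Equivalently \<open>J\<close> contains a power of \<open>\<mm>\<close> (\<open>m_nil_imp_power\<close>), but this form is easier to verify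
  for annihilators.\<close>

definition m_nil :: "'a set \<Rightarrow> bool" where
  "m_nil J \<longleftrightarrow> (\<forall>t\<in>\<mm>. \<exists>n::nat. t [^] n \<in> J)"

lemma m_nil_mono: "m_nil J \<Longrightarrow> J \<subseteq> K \<Longrightarrow> m_nil K"
  unfolding m_nil_def by blast

text \<open>The socle of \<open>R/J\<close> is nonzero: take \<open>a \<notin> J\<close> with \<open>(J : a)\<close> maximal.  If \<open>t a \<notin> J\<close>, then
  \<open>(J : t a) = (J : a)\<close>, which forces \<open>t\<^sup>n a \<notin> J\<close> for all \<open>n\<close>.\<close>

lemma exists_socle_element:
  assumes J: "ideal J R" "J \<noteq> carrier R" "m_nil J"
  obtains a where "a \<in> carrier R" "a \<notin> J" "\<And>t. t \<in> \<mm> \<Longrightarrow> t \<otimes> a \<in> J"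
proof -
  define col where "col = (\<lambda>a. {x \<in> carrier R. \<forall>a\<in>{a}. a \<otimes> x \<in> J})"
  have col_ideal: "ideal (col a) R" if "a \<in> carrier R" for a
    unfolding col_def using colon_ideal[OF J(1), of "{a}"] that by blast
  have claim: "\<forall>a. a \<in> carrier R \<longrightarrow> a \<notin> J \<longrightarrow> K = col a \<longrightarrow> (\<exists>a\<in>carrier R. a \<notin> J \<and> (\<forall>t\<in>\<mm>. t \<otimes> a \<in> J))"
    if "ideal K R" for K
    using that
  proof (induction rule: noetherian_induct)
    case (step K)
    show ?case
    proof (intro allI impI)
      fix a assume a: "a \<in> carrier R" "a \<notin> J" and K: "K = col a"
      show "\<exists>a\<in>carrier R. a \<notin> J \<and> (\<forall>t\<in>\<mm>. t \<otimes> a \<in> J)"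
      proof (cases "\<forall>t\<in>\<mm>. t \<otimes> a \<in> J")
        case True
        then show ?thesis using a by blast
      next
        case False
        then obtain t where t: "t \<in> \<mm>" "t \<otimes> a \<notin> J" by blast
        note tc = m_carrier[OF t(1)]
        have sub: "K \<subseteq> col (t \<otimes> a)"
          using J a tc by (auto simp: K col_def m_assoc intro: ideal_mult)
        have "K \<noteq> col (t \<otimes> a)"
        proof
          assume eq: "K = col (t \<otimes> a)"
          have down: "r \<otimes> a \<in> J" if "r \<in> carrier R" "(t \<otimes> r) \<otimes> a \<in> J" for r
          proof -
            have "r \<in> col (t \<otimes> a)" using that a tc by (simp add: col_def m_ac)
            then have "r \<in> col a" using eq K by simp
            then show ?thesis using a that by (simp add: col_def m_comm)
          qed
          have "t [^] n \<otimes> a \<notin> J" for n :: nat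
          proof (induction n)
            case (Suc n)
            then show ?case using down[of "t [^] n"] tc by (auto simp: m_comm)
          qed (use a in simp)
          moreover obtain n where "t [^] (n::nat) \<in> J" using J(3) t by (auto simp: m_nil_def)
          then have "t [^] n \<otimes> a \<in> J" using J a by (auto intro: ideal_mult')
          ultimately show False by blast
        qed
        then have "K \<subset> col (t \<otimes> a)" using sub by blast
        moreover have "t \<otimes> a \<in> carrier R" using tc a by simp
        ultimately show ?thesis using step(2)[OF col_ideal, of "t \<otimes> a"] t by blast
      qed
    qed
  qed
  have "\<one> \<notin> J"
  proof
    assume "\<one> \<in> J"
    then have "x \<in> J" if "x \<in> carrier R" for x using ideal_mult[OF J(1) _ that, of \<one>] that by simp
    then show False using J(2) ideal_carrier[OF J(1)] by blast
  qed
  then have "\<exists>a\<in>carrier R. a \<notin> J \<and> (\<forall>t\<in>\<mm>. t \<otimes> a \<in> J)"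
    using claim[OF col_ideal[OF one_closed]] by blast
  then show thesis using that by blast
qed

text \<open>This replaces induction on the length of the Artinian ring \<open>R/J\<close>: each step passes from \<open>J\<close> to
  \<open>J + R a\<close> with \<open>(J + R a)/J\<close> isomorphic to the residue field.\<close>

lemma socle_induct [consumes 2, case_names carrier adjoin]:
  assumes "ideal J R" "m_nil J" and base: "P (carrier R)"
    and step: "\<And>J a. \<lbrakk>ideal J R; m_nil J; a \<in> carrier R; a \<notin> J; \<And>t. t \<in> \<mm> \<Longrightarrow> t \<otimes> a \<in> J;
      P (adjoin J a)\<rbrakk> \<Longrightarrow> P J"
  shows "P J"
  using assms(1,2)
proof (induction rule: noetherian_induct)
  case (step J)
  show ?case
  proof (cases "J = carrier R")
    case True
    then show ?thesis using base by simp
  next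
    case False
    obtain a where a: "a \<in> carrier R" "a \<notin> J" "\<And>t. t \<in> \<mm> \<Longrightarrow> t \<otimes> a \<in> J"
      using exists_socle_element[OF step(1) False step(3)] by blast
    have "P (adjoin J a)"
      using step(2)[OF adjoin_ideal[OF step(1) a(1)] adjoin_gt[OF step(1) a(1,2)]]
        m_nil_mono[OF step(3)] adjoin_gt[OF step(1) a(1,2)] by blast
    then show ?thesis using assms(4)[OF step(1,3) a] by blast
  qed
qed

definition m_power :: "nat \<Rightarrow> 'a set" where
  "m_power n = \<mm> [^]\<^bsub>ideals_set R\<^esub> n"

lemma m_power_0: "m_power 0 = carrier R"
  by (simp add: m_power_def ideals_set_def)

lemma m_power_Suc: "m_power (Suc n) = m_power n \<cdot> \<mm>"
  by (simp add: m_power_def ideals_set_def)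

lemma m_power_ideal: "ideal (m_power n) R"
  by (induction n) (auto simp: m_power_0 m_power_Suc oneideal intro: ideal_prod_is_ideal m_ideal)

lemma m_power_decreasing: "m_power (Suc n) \<subseteq> m_power n"
  using ideal_prod_inter[OF m_power_ideal m_ideal] by (auto simp: m_power_Suc)

lemma m_nil_power: "m_nil (m_power n)"
  unfolding m_nil_def
proof
  fix t assume t: "t \<in> \<mm>"
  have "t [^] n \<in> m_power n"
  proof (induction n)
    case 0
    then show ?case by (simp add: m_power_0)
  next
    case (Suc n)
    then show ?case using t by (simp add: m_power_Suc ideal_prod.prod)
  qed
  then show "\<exists>n'::nat. t [^] n' \<in> m_power n" by blast
qed

lemma m_nil_imp_power:
  assumes "ideal J R" "m_nil J"
  shows "\<exists>n. m_power n \<subseteq> J"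
  using assms
proof (induction rule: socle_induct)
  case carrier
  show ?case by (rule exI[of _ 0]) (simp add: m_power_0)
next
  case (adjoin J a)
  then obtain n where n: "m_power n \<subseteq> adjoin J a" by blast
  have "x \<in> J" if "x \<in> m_power n \<cdot> \<mm>" for x
    using that
  proof (induction rule: ideal_prod.induct)
    case (prod i t)
    obtain j r where jr: "j \<in> J" "r \<in> carrier R" "i = j \<oplus> r \<otimes> a"
      using subsetD[OF n prod(1)] unfolding adjoin_iff by blast
    have c: "j \<in> carrier R" "t \<in> carrier R" using jr adjoin(1) prod m_carrier ideal_carrier by auto
    have "i \<otimes> t = j \<otimes> t \<oplus> (r \<otimes> a) \<otimes> t" using jr c adjoin(3) by (simp add: l_distr)
    also have "\<dots> = j \<otimes> t \<oplus> r \<otimes> (t \<otimes> a)" using jr(2) c adjoin(3) by (simp add: m_ac)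
    also have "\<dots> \<in> J" using jr c adjoin prod by (intro ideal_add) (auto intro: ideal_mult ideal_mult')
    finally show ?case .
  qed (use adjoin in \<open>auto intro: ideal_add\<close>)
  then show ?case by (intro exI[of _ "Suc n"]) (auto simp: m_power_Suc)
qed

end

text \<open>The injective hull of \<open>R/\<mm>\<close>, presented by a generator \<open>s\<close> of its socle: \<open>R s\<close> is a copy of the
  residue field, and the extension \<open>R s \<subseteq> E\<close> is essential.\<close>

locale residue_hull = noetherian_maximal R \<mm> + E: module R E for R :: "('a, 'r) ring_scheme" (structure)
    and \<mm> and E :: "('a, 'e, 't) module_scheme" +
  fixes s :: 'e
  assumes baer: "baer R E"
    and s_closed [simp]: "s \<in> carrier E"
    and s_ann: "\<And>t. t \<in> \<mm> \<Longrightarrow> t \<odot>\<^bsub>E\<^esub> s = \<zero>\<^bsub>E\<^esub>"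
    and s_nonzero: "s \<noteq> \<zero>\<^bsub>E\<^esub>"
    and essential: "\<And>x. x \<in> carrier E \<Longrightarrow> x \<noteq> \<zero>\<^bsub>E\<^esub> \<Longrightarrow>
      \<exists>r\<in>carrier R. \<exists>u\<in>carrier R. r \<odot>\<^bsub>E\<^esub> x = u \<odot>\<^bsub>E\<^esub> s \<and> u \<odot>\<^bsub>E\<^esub> s \<noteq> \<zero>\<^bsub>E\<^esub>"
begin

abbreviation E_add (infixl "\<oplus>\<^sub>E" 65) where "x \<oplus>\<^sub>E y \<equiv> x \<oplus>\<^bsub>E\<^esub> y"
abbreviation E_neg ("\<ominus>\<^sub>E _" [81] 80) where "\<ominus>\<^sub>E x \<equiv> \<ominus>\<^bsub>E\<^esub> x"
abbreviation E_smult (infixl "\<odot>\<^sub>E" 70) where "r \<odot>\<^sub>E x \<equiv> r \<odot>\<^bsub>E\<^esub> x"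
abbreviation E_zero ("\<zero>\<^sub>E") where "\<zero>\<^sub>E \<equiv> \<zero>\<^bsub>E\<^esub>"

lemma essential':
  assumes "x \<in> carrier E" "x \<noteq> \<zero>\<^sub>E"
  obtains r where "r \<in> carrier R" "r \<odot>\<^sub>E x = s"
proof -
  obtain r u where ru: "r \<in> carrier R" "u \<in> carrier R" "r \<odot>\<^sub>E x = u \<odot>\<^sub>E s" "u \<odot>\<^sub>E s \<noteq> \<zero>\<^sub>E"
    using essential[OF assms] by blast
  then have "u \<notin> \<mm>" using s_ann by blast
  then obtain v t where v: "v \<in> carrier R" "t \<in> \<mm>" "\<one> = t \<oplus> v \<otimes> u" using unit_mod_m ru by metis
  have "s = (t \<oplus> v \<otimes> u) \<odot>\<^sub>E s" using v(3) E.smult_one by simp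
  also have "\<dots> = v \<odot>\<^sub>E (u \<odot>\<^sub>E s)"
    using v ru m_carrier by (simp add: E.smult_l_distr E.smult_assoc1 s_ann)
  also have "\<dots> = (v \<otimes> r) \<odot>\<^sub>E x" using v ru assms by (simp add: E.smult_assoc1)
  finally show thesis using that[of "v \<otimes> r"] v ru by simp
qed

lemma socle:
  assumes "x \<in> carrier E" "\<And>t. t \<in> \<mm> \<Longrightarrow> t \<odot>\<^sub>E x = \<zero>\<^sub>E"
  obtains u where "u \<in> carrier R" "x = u \<odot>\<^sub>E s"
proof (cases "x = \<zero>\<^sub>E")
  case True
  then show thesis using that[of \<zero>] by simp
next
  case False
  obtain r where r: "r \<in> carrier R" "r \<odot>\<^sub>E x = s" by (rule essential'[OF assms(1) False])
  then have "r \<notin> \<mm>" using assms(2) s_nonzero by auto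
  then obtain v t where v: "v \<in> carrier R" "t \<in> \<mm>" "\<one> = t \<oplus> v \<otimes> r" using unit_mod_m r by metis
  have "x = (t \<oplus> v \<otimes> r) \<odot>\<^sub>E x" using v(3) E.smult_one assms by simp
  also have "\<dots> = v \<odot>\<^sub>E s" using v r m_carrier assms by (simp add: E.smult_l_distr E.smult_assoc1)
  finally show thesis using that v by blast
qed

text \<open>Some multiple \<open>r t\<^sup>n x\<close> equals \<open>s\<close> as long as \<open>t\<^sup>n x \<noteq> 0\<close>, and then \<open>r\<close> annihilates \<open>t\<^sup>n\<^sup>+\<^sup>1 x\<close> but not
  \<open>t\<^sup>n x\<close>.  So the annihilators of the \<open>t\<^sup>n x\<close> would increase forever.\<close>

lemma torsion:
  assumes x: "x \<in> carrier E" and t: "t \<in> \<mm>"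
  shows "\<exists>n::nat. t [^] n \<odot>\<^sub>E x = \<zero>\<^sub>E"
proof (rule ccontr)
  assume neg: "\<not> ?thesis"
  have tc: "t \<in> carrier R" by (rule m_carrier[OF t])
  define ann where "ann = (\<lambda>y. {r \<in> carrier R. r \<odot>\<^sub>E y = \<zero>\<^sub>E})"
  have ann_ideal: "ideal (ann y) R" if "y \<in> carrier E" for y
    unfolding ann_def using that by (intro idealI_cring) (auto simp: E.smult_l_distr E.smult_assoc1)
  have "\<forall>n::nat. K \<noteq> ann (t [^] n \<odot>\<^sub>E x)" if "ideal K R" for K
    using that
  proof (induction rule: noetherian_induct)
    case (step K)
    show ?case
    proof (intro allI notI)
      fix n :: nat
      let ?y = "t [^] n \<odot>\<^sub>E x" and ?z = "t [^] Suc n \<odot>\<^sub>E x"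
      assume K: "K = ann ?y"
      have y: "?y \<in> carrier E" "?y \<noteq> \<zero>\<^sub>E" using x tc neg by auto
      have z: "?z = t \<odot>\<^sub>E ?y" "?z \<in> carrier E"
        using x tc by (simp_all add: m_comm flip: E.smult_assoc1)
      obtain r where r: "r \<in> carrier R" "r \<odot>\<^sub>E ?y = s" by (rule essential'[OF y])
      have rt: "r' \<odot>\<^sub>E ?z = t \<odot>\<^sub>E (r' \<odot>\<^sub>E ?y)" if "r' \<in> carrier R" for r'
        unfolding z(1) using that tc y(1) by (simp add: m_comm flip: E.smult_assoc1 del: nat_pow_Suc)
      have "ann ?y \<subseteq> ann ?z" using rt tc by (auto simp: ann_def simp del: nat_pow_Suc)
      moreover have "r \<in> ann ?z" "r \<notin> ann ?y"
        using rt r s_ann[OF t] s_nonzero by (auto simp: ann_def simp del: nat_pow_Suc)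
      ultimately have "K \<subset> ann ?z" using K by blast
      then show False using step(2)[OF ann_ideal[OF z(2)]] by blast
    qed
  qed
  from this[OF ann_ideal] show False using x by (metis E.smult_one nat_pow_0 one_closed E.smult_closed)
qed

text \<open>The module \<open>E\<close> cogenerates, which is the form in which its injectivity gets used.  The graph of
  the zero map on \<open>N\<close> extends by \<open>w \<mapsto> s\<close> because \<open>r w \<in> N\<close> happens only for \<open>r \<in> \<mm>\<close>.\<close>

lemma residue_functional:
  assumes M: "module R M" and N: "submodule N R M" and w: "w \<in> carrier M" "w \<notin> N"
    and mw: "\<And>t. t \<in> \<mm> \<Longrightarrow> t \<odot>\<^bsub>M\<^esub> w \<in> N"
  obtains h where "h \<in> mod_hom R M E" "\<And>x. x \<in> N \<Longrightarrow> h x = \<zero>\<^sub>E" "h w = s"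
proof -
  interpret M: module R M by (rule M)
  note NE = M.submoduleE[OF N]
  have zN: "\<zero>\<^bsub>M\<^esub> \<in> N" using subgroup.one_closed[OF submodule.axioms(1)[OF N]] by simp
  have unit: "r \<in> \<mm>" if r: "r \<in> carrier R" "r \<odot>\<^bsub>M\<^esub> w \<in> N" for r
  proof (rule ccontr)
    assume "r \<notin> \<mm>"
    then obtain v t where v: "v \<in> carrier R" "t \<in> \<mm>" "\<one> = t \<oplus> v \<otimes> r" using unit_mod_m r by metis
    have "w = (t \<oplus> v \<otimes> r) \<odot>\<^bsub>M\<^esub> w" using v(3) w by (metis M.smult_one)
    also have "\<dots> = t \<odot>\<^bsub>M\<^esub> w \<oplus>\<^bsub>M\<^esub> v \<odot>\<^bsub>M\<^esub> (r \<odot>\<^bsub>M\<^esub> w)"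
      using v r m_carrier w by (simp add: M.smult_l_distr M.smult_assoc1)
    also have "\<dots> \<in> N" using mw[OF v(2)] r v NE by blast
    finally show False using w by simp
  qed
  interpret two_modules R M E by unfold_locales
  have "linear_graph R M E (N \<times> {\<zero>\<^sub>E})"
    unfolding linear_graph_def using NE zN by auto
  moreover have "y = r \<odot>\<^sub>E s" if "r \<in> carrier R" "(r \<odot>\<^bsub>M\<^esub> w, y) \<in> N \<times> {\<zero>\<^sub>E}" for r y
    using that unit[of r] s_ann[of r] by auto
  ultimately obtain G where G: "linear_graph R M E G" "N \<times> {\<zero>\<^sub>E} \<subseteq> G" "(w, s) \<in> G"
    using graph_adjoin[OF _ w(1) s_closed] by metis
  obtain h where h: "h \<in> mod_hom R M E" "\<And>x y. (x, y) \<in> G \<Longrightarrow> h x = y"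
    using baer_extend[OF baer G(1)] by metis
  show thesis by (rule that[OF h(1)]) (use h(2) G in auto)
qed

definition ann_E :: "'a set \<Rightarrow> 'e set" where
  "ann_E J = {x \<in> carrier E. \<forall>j\<in>J. j \<odot>\<^sub>E x = \<zero>\<^sub>E}"

lemma ann_E_closed:
  assumes "J \<subseteq> carrier R"
  shows "x \<in> ann_E J \<Longrightarrow> x \<in> carrier E" "x \<in> ann_E J \<Longrightarrow> y \<in> ann_E J \<Longrightarrow> x \<oplus>\<^sub>E y \<in> ann_E J"
    "r \<in> carrier R \<Longrightarrow> x \<in> ann_E J \<Longrightarrow> r \<odot>\<^sub>E x \<in> ann_E J"
proof -
  show "x \<in> ann_E J \<Longrightarrow> x \<in> carrier E" by (simp add: ann_E_def)
  show "x \<in> ann_E J \<Longrightarrow> y \<in> ann_E J \<Longrightarrow> x \<oplus>\<^sub>E y \<in> ann_E J"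
    using assms by (auto simp: ann_E_def E.smult_r_distr subset_iff)
  show "r \<odot>\<^sub>E x \<in> ann_E J" if "r \<in> carrier R" "x \<in> ann_E J"
  proof -
    have "j \<odot>\<^sub>E (r \<odot>\<^sub>E x) = r \<odot>\<^sub>E (j \<odot>\<^sub>E x)" if "j \<in> J" for j
      using that \<open>r \<in> carrier R\<close> \<open>x \<in> ann_E J\<close> assms
      by (intro E.smult_lcomm) (auto simp: ann_E_def)
    then show ?thesis using that by (auto simp: ann_E_def)
  qed
qed

lemma ann_E_adjoin:
  assumes "ideal J R" "a \<in> carrier R"
  shows "x \<in> ann_E (adjoin J a) \<longleftrightarrow> x \<in> ann_E J \<and> a \<odot>\<^sub>E x = \<zero>\<^sub>E"
proof
  assume x: "x \<in> ann_E (adjoin J a)"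
  have "a \<in> adjoin J a" using sum_right[OF assms(1) cgenideal_ideal[OF assms(2)]] cgenideal_self[OF assms(2)] by blast
  moreover have "J \<subseteq> adjoin J a" using sum_left[OF assms(1) cgenideal_ideal[OF assms(2)]] .
  ultimately show "x \<in> ann_E J \<and> a \<odot>\<^sub>E x = \<zero>\<^sub>E" using x by (auto simp: ann_E_def)
next
  assume "x \<in> ann_E J \<and> a \<odot>\<^sub>E x = \<zero>\<^sub>E"
  then show "x \<in> ann_E (adjoin J a)"
    using assms ideal_carrier by (auto simp: ann_E_def adjoin_iff E.smult_l_distr E.smult_assoc1)
qed

lemma socle_dual:
  assumes J: "ideal J R" and a: "a \<in> carrier R" "a \<notin> J" "\<And>t. t \<in> \<mm> \<Longrightarrow> t \<otimes> a \<in> J"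
  obtains z where "z \<in> ann_E J" "a \<odot>\<^sub>E z = s"
proof -
  interpret reg: module R "regular_module R" by (rule module_regular)
  have "submodule J R (regular_module R)"
    by (rule reg.module_submodule_carrier) (use J in \<open>auto simp: ideal_carrier ideal_zero ideal_add ideal_mult\<close>)
  then obtain h where h: "h \<in> mod_hom R (regular_module R) E" "\<And>x. x \<in> J \<Longrightarrow> h x = \<zero>\<^sub>E" "h a = s"
    using residue_functional[OF module_regular, of J a] a by auto
  have h1: "h r = r \<odot>\<^sub>E h \<one>" if "r \<in> carrier R" for r
    using mod_homD(3)[OF h(1), of r \<one>] that by simp
  show thesis
  proof (rule that)
    have "j \<odot>\<^sub>E h \<one> = \<zero>\<^sub>E" if "j \<in> J" for j
      using h1[OF ideal_carrier[OF J that]] h(2)[OF that] by simp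
    then show "h \<one> \<in> ann_E J" using mod_homD(1)[OF h(1), of \<one>] by (simp add: ann_E_def)
    show "a \<odot>\<^sub>E h \<one> = s" using h1[OF a(1)] h(3) by simp
  qed
qed

text \<open>For \<open>r \<notin> J\<close> some multiple of \<open>r\<close> represents a socle element of \<open>R/J\<close>, and the functional dual to
  that element is not killed by \<open>r\<close>.\<close>

lemma ann_ann_E:
  assumes J: "ideal J R" "m_nil J" and r: "r \<in> carrier R" "\<And>x. x \<in> ann_E J \<Longrightarrow> r \<odot>\<^sub>E x = \<zero>\<^sub>E"
  shows "r \<in> J"
proof (rule ccontr)
  assume rJ: "r \<notin> J"
  define K where "K = {x \<in> carrier R. \<forall>a\<in>{r}. a \<otimes> x \<in> J}"
  have K: "ideal K R" unfolding K_def using colon_ideal[OF J(1), of "{r}"] r by simp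
  have "J \<subseteq> K" using J r ideal_carrier by (auto simp: K_def intro: ideal_mult)
  moreover have "K \<noteq> carrier R"
  proof
    assume "K = carrier R"
    then have "\<one> \<in> K" by simp
    then show False using rJ r by (simp add: K_def)
  qed
  ultimately obtain b where b: "b \<in> carrier R" "b \<notin> K" "\<And>t. t \<in> \<mm> \<Longrightarrow> t \<otimes> b \<in> K"
    using exists_socle_element[OF K] m_nil_mono[OF J(2)] by blast
  have "t \<otimes> (r \<otimes> b) \<in> J" if "t \<in> \<mm>" for t
    using b(3)[OF that] r b m_carrier[OF that] by (simp add: K_def m_lcomm)
  moreover have "r \<otimes> b \<in> carrier R" "r \<otimes> b \<notin> J" using r b by (auto simp: K_def)
  ultimately obtain z where z: "z \<in> ann_E J" "(r \<otimes> b) \<odot>\<^sub>E z = s"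
    using socle_dual[OF J(1), of "r \<otimes> b"] by blast
  have Jc: "J \<subseteq> carrier R" using ideal_carrier[OF J(1)] by blast
  have "r \<odot>\<^sub>E (b \<odot>\<^sub>E z) = \<zero>\<^sub>E" using r(2) ann_E_closed(3)[OF Jc b(1) z(1)] by blast
  moreover have "r \<odot>\<^sub>E (b \<odot>\<^sub>E z) = (r \<otimes> b) \<odot>\<^sub>E z"
    by (rule E.smult_assoc1[symmetric]) (use r b ann_E_closed(1)[OF Jc z(1)] in auto)
  ultimately show False using z(2) s_nonzero by simp
qed

text \<open>\<open>R/J\<close> is the dual of its own dual \<open>ann_E J\<close>.  In the inductive step \<open>h\<close> minus a scalar vanishes on
  \<open>ann_E (J + R a)\<close>.  The quotient of \<open>ann_E J\<close> by that submodule is spanned by an element \<open>z\<close> with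
  \<open>a z = s\<close>, so a multiple of \<open>a\<close> corrects the remaining value at \<open>z\<close>, which lies in the socle.\<close>

lemma hom_ann_E_scalar:
  assumes "ideal J R" "m_nil J" "h \<in> mod_hom R (E\<lparr>carrier := ann_E J\<rparr>) E"
  shows "\<exists>r\<in>carrier R. \<forall>x\<in>ann_E J. h x = r \<odot>\<^sub>E x"
  using assms
proof (induction arbitrary: h rule: socle_induct)
  case carrier
  have null: "x = \<zero>\<^sub>E" if "x \<in> ann_E (carrier R)" for x
    using that E.smult_one[of x] by (auto simp: ann_E_def)
  have "h x = \<zero> \<odot>\<^sub>E x" if x: "x \<in> ann_E (carrier R)" for x
  proof -
    have "h x = h (\<zero> \<odot>\<^sub>E x)" by (simp add: null[OF x])
    also have "\<dots> = \<zero> \<odot>\<^sub>E h x" using mod_homD(3)[OF carrier(1), of \<zero> x] x by simp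
    also have "\<dots> = \<zero> \<odot>\<^sub>E x" using mod_homD(1)[OF carrier(1), of x] x null[OF x] by simp
    finally show ?thesis .
  qed
  then show ?case by (intro bexI[of _ \<zero>]) auto
next
  case (adjoin J a)
  let ?J' = "adjoin J a"
  have Jc: "J \<subseteq> carrier R" using ideal_carrier[OF adjoin(1)] by blast
  note cl = ann_E_closed[OF Jc]
  note aJ' = ann_E_adjoin[OF adjoin(1,3)]
  have h: "x \<in> ann_E J \<Longrightarrow> h x \<in> carrier E" "x \<in> ann_E J \<Longrightarrow> y \<in> ann_E J \<Longrightarrow> h (x \<oplus>\<^sub>E y) = h x \<oplus>\<^sub>E h y"
    "r \<in> carrier R \<Longrightarrow> x \<in> ann_E J \<Longrightarrow> h (r \<odot>\<^sub>E x) = r \<odot>\<^sub>E h x" for r x y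
    using mod_homD[OF adjoin(7)] by auto
  have "h \<in> mod_hom R (E\<lparr>carrier := ann_E ?J'\<rparr>) E"
    by (rule mod_homI) (use h aJ' in auto)
  then obtain r where r: "r \<in> carrier R" "\<And>x. x \<in> ann_E ?J' \<Longrightarrow> h x = r \<odot>\<^sub>E x"
    using adjoin(6) by blast
  obtain z where z: "z \<in> ann_E J" "a \<odot>\<^sub>E z = s" using socle_dual[OF adjoin(1,3-5)] by blast
  note zc = cl(1)[OF z(1)]
  define y where "y = h z \<oplus>\<^sub>E \<ominus>\<^sub>E (r \<odot>\<^sub>E z)"
  have y: "y \<in> carrier E" using h(1)[OF z(1)] r zc by (simp add: y_def)
  have "t \<odot>\<^sub>E y = \<zero>\<^sub>E" if t: "t \<in> \<mm>" for t
  proof -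
    note tc = m_carrier[OF t]
    have "a \<odot>\<^sub>E (t \<odot>\<^sub>E z) = t \<odot>\<^sub>E s"
      using adjoin(3) tc zc z(2) by (metis E.smult_assoc1 m_comm)
    then have tz: "t \<odot>\<^sub>E z \<in> ann_E ?J'" using aJ' cl(3)[OF tc z(1)] s_ann[OF t] by simp
    have "t \<odot>\<^sub>E y = h (t \<odot>\<^sub>E z) \<oplus>\<^sub>E \<ominus>\<^sub>E (r \<odot>\<^sub>E (t \<odot>\<^sub>E z))"
      using h(1,3) z(1) tc r zc by (simp add: y_def E.smult_r_distr E.smult_r_minus m_comm flip: E.smult_assoc1)
    also have "\<dots> = \<zero>\<^sub>E" using r(2)[OF tz] r(1) zc tc by (simp add: E.M.r_neg)
    finally show ?thesis .
  qed
  then obtain u where u: "u \<in> carrier R" "y = u \<odot>\<^sub>E s" using socle[OF y] by blast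
  let ?r = "r \<oplus> u \<otimes> a"
  have "h x = ?r \<odot>\<^sub>E x" if x: "x \<in> ann_E J" for x
  proof -
    note xc = cl(1)[OF x]
    have "t \<odot>\<^sub>E (a \<odot>\<^sub>E x) = \<zero>\<^sub>E" if "t \<in> \<mm>" for t
      using adjoin(5)[OF that] x m_carrier[OF that] adjoin(3) by (auto simp: ann_E_def simp flip: E.smult_assoc1)
    then obtain v where v: "v \<in> carrier R" "a \<odot>\<^sub>E x = v \<odot>\<^sub>E s" using socle[of "a \<odot>\<^sub>E x"] adjoin(3) xc by auto
    define x' where "x' = x \<oplus>\<^sub>E (\<ominus> v) \<odot>\<^sub>E z"
    have vz: "(\<ominus> v) \<odot>\<^sub>E z \<in> ann_E J" using cl(3) v z by simp
    have x'J: "x' \<in> ann_E J" unfolding x'_def using cl(2) x vz by blast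
    have "a \<odot>\<^sub>E x' = a \<odot>\<^sub>E x \<oplus>\<^sub>E (\<ominus> v) \<odot>\<^sub>E (a \<odot>\<^sub>E z)"
      using xc zc v adjoin(3) by (simp add: x'_def E.smult_r_distr m_comm flip: E.smult_assoc1)
    also have "\<dots> = \<zero>\<^sub>E" using v by (simp add: z(2) E.smult_l_minus E.M.r_neg)
    finally have x': "x' \<in> ann_E ?J'" using aJ' x'J by simp
    have x'c: "x' \<in> carrier E" using cl(1)[OF x'J] .
    have hz: "h z = r \<odot>\<^sub>E z \<oplus>\<^sub>E u \<odot>\<^sub>E s"
      unfolding u(2)[symmetric] y_def using h(1)[OF z(1)] r zc by (simp add: E.M.a_ac E.M.r_neg)
    have xe: "x = x' \<oplus>\<^sub>E v \<odot>\<^sub>E z"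
      using xc zc v by (simp add: x'_def E.smult_l_minus E.M.a_assoc E.M.l_neg)
    have "h x = h x' \<oplus>\<^sub>E v \<odot>\<^sub>E h z"
      unfolding xe using h(2,3) x'J z v cl(3) by simp
    also have "\<dots> = r \<odot>\<^sub>E x' \<oplus>\<^sub>E v \<odot>\<^sub>E (r \<odot>\<^sub>E z \<oplus>\<^sub>E u \<odot>\<^sub>E s)"
      using r(2)[OF x'] hz by simp
    also have "\<dots> = r \<odot>\<^sub>E (x' \<oplus>\<^sub>E v \<odot>\<^sub>E z) \<oplus>\<^sub>E u \<odot>\<^sub>E (v \<odot>\<^sub>E s)"
    proof -
      have "v \<odot>\<^sub>E (r \<odot>\<^sub>E z) = r \<odot>\<^sub>E (v \<odot>\<^sub>E z)" "v \<odot>\<^sub>E (u \<odot>\<^sub>E s) = u \<odot>\<^sub>E (v \<odot>\<^sub>E s)"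
        using v u r zc by (simp_all add: m_comm flip: E.smult_assoc1)
      then show ?thesis using v u r zc x'c by (simp add: E.smult_r_distr E.M.a_assoc)
    qed
    also have "\<dots> = ?r \<odot>\<^sub>E x"
      unfolding xe[symmetric] v(2)[symmetric] using r u adjoin(3) xc by (simp add: E.smult_l_distr E.smult_assoc1)
    finally show ?thesis .
  qed
  then show ?case using r u adjoin(3) by (intro bexI[of _ ?r]) auto
qed

lemma mem_ann_E_power:
  assumes "x \<in> carrier E"
  shows "\<exists>n. x \<in> ann_E (m_power n)"
proof -
  let ?J = "{r \<in> carrier R. r \<odot>\<^sub>E x = \<zero>\<^sub>E}"
  have "ideal ?J R"
    using assms by (intro idealI_cring) (auto simp: E.smult_l_distr E.smult_assoc1)
  moreover have "m_nil ?J" using torsion[OF assms] m_carrier by (auto simp: m_nil_def)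
  ultimately obtain n where "m_power n \<subseteq> ?J" using m_nil_imp_power by blast
  then show ?thesis using assms by (auto simp: ann_E_def)
qed

end

locale complete_residue_hull = residue_hull +
  assumes complete: "adically_complete R \<mm>"
begin

text \<open>The scalars \<open>f n\<close> that describe \<open>h\<close> on the submodules killed by \<open>\<mm>\<^sup>n\<close> form a Cauchy sequence, and
  completeness of \<open>R\<close> provides the limit.\<close>

lemma endomorphism_scalar:
  assumes h: "h \<in> mod_hom R E E"
  obtains r where "r \<in> carrier R" "\<And>x. x \<in> carrier E \<Longrightarrow> h x = r \<odot>\<^sub>E x"
proof -
  have "\<exists>r\<in>carrier R. \<forall>x\<in>ann_E (m_power n). h x = r \<odot>\<^sub>E x" for n
  proof (rule hom_ann_E_scalar[OF m_power_ideal m_nil_power])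
    show "h \<in> mod_hom R (E\<lparr>carrier := ann_E (m_power n)\<rparr>) E"
      by (rule mod_homI) (use mod_homD[OF h] in \<open>auto simp: ann_E_def\<close>)
  qed
  then obtain f where f: "\<And>n. f n \<in> carrier R" "\<And>n x. x \<in> ann_E (m_power n) \<Longrightarrow> h x = f n \<odot>\<^sub>E x"
    by metis
  have step: "f (Suc n) \<ominus> f n \<in> m_power n" for n
  proof (rule ann_ann_E[OF m_power_ideal m_nil_power])
    fix x assume x: "x \<in> ann_E (m_power n)"
    then have x': "x \<in> ann_E (m_power (Suc n))" using m_power_decreasing by (auto simp: ann_E_def)
    have "x \<in> carrier E" using x by (simp add: ann_E_def)
    then show "(f (Suc n) \<ominus> f n) \<odot>\<^sub>E x = \<zero>\<^sub>E"
      using f(2)[OF x] f(2)[OF x'] f(1)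
      by (simp add: a_minus_def E.smult_l_distr E.smult_l_minus E.M.r_neg flip: f(2)[OF x])
  qed (use f in simp)
  define c where "c = (\<lambda>n. m_power n +> f n)"
  have cSuc: "c (Suc n) \<subseteq> c n" for n
  proof
    fix x assume "x \<in> c (Suc n)"
    then obtain i where i: "i \<in> m_power (Suc n)" "x = i \<oplus> f (Suc n)" by (auto simp: c_def a_r_coset_def')
    have ic: "i \<in> m_power n" "i \<in> carrier R" using i(1) m_power_decreasing ideal_carrier[OF m_power_ideal] by blast+
    have "x = (i \<oplus> (f (Suc n) \<ominus> f n)) \<oplus> f n"
      using i(2) ic f(1) by (simp add: a_minus_def a_assoc l_neg)
    moreover have "i \<oplus> (f (Suc n) \<ominus> f n) \<in> m_power n" using ic step m_power_ideal by (simp add: ideal_add)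
    ultimately show "x \<in> c n" by (auto simp: c_def a_r_coset_def')
  qed
  have "c n \<in> carrier (R Quot (m_power n))" for n
    using f(1) by (auto simp: c_def FactRing_def A_RCOSETS_def')
  then have "c \<in> {c. \<forall>n. c n \<in> carrier (R Quot (\<mm> [^]\<^bsub>ideals_set R\<^esub> n)) \<and> c (Suc n) \<subseteq> c n}"
    using cSuc by (simp add: m_power_def)
  then have "c \<in> (\<lambda>a n. (\<mm> [^]\<^bsub>ideals_set R\<^esub> n) +> a) ` carrier R"
    using complete unfolding adically_complete_def bij_betw_def by simp
  then obtain a where a: "a \<in> carrier R" "\<And>n. c n = m_power n +> a"
    by (auto simp: m_power_def)
  have diff: "a \<ominus> f n \<in> m_power n" for n
  proof -
    have "a \<in> c n" using a ideal_zero[OF m_power_ideal, of n] by (force simp: a_r_coset_def')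
    then obtain i where "i \<in> m_power n" "a = i \<oplus> f n" by (auto simp: c_def a_r_coset_def')
    then show ?thesis using f(1) ideal_carrier[OF m_power_ideal] by (simp add: a_minus_def a_assoc r_neg)
  qed
  have "h x = a \<odot>\<^sub>E x" if x: "x \<in> carrier E" for x
  proof -
    obtain n where n: "x \<in> ann_E (m_power n)" using mem_ann_E_power[OF x] by blast
    have "a \<odot>\<^sub>E x = ((a \<ominus> f n) \<oplus> f n) \<odot>\<^sub>E x" using a f(1) by (simp add: a_minus_def a_assoc l_neg)
    also have "\<dots> = (a \<ominus> f n) \<odot>\<^sub>E x \<oplus>\<^sub>E f n \<odot>\<^sub>E x" using a f(1) x by (intro E.smult_l_distr) auto
    also have "(a \<ominus> f n) \<odot>\<^sub>E x = \<zero>\<^sub>E" using n diff by (auto simp: ann_E_def)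
    finally show ?thesis using f(2)[OF n] f(1) x by simp
  qed
  then show thesis using that a by blast
qed

text \<open>If \<open>x \<notin> N\<close>, some functional \<open>h: E \<longrightarrow> E\<close> kills \<open>N\<close> but not \<open>x\<close>.  Being multiplication by a scalar, it
  exhibits an element of the annihilator of \<open>N\<close> that does not annihilate \<open>x\<close>.\<close>

lemma double_annihilator:
  assumes N: "submodule N R E" and x: "x \<in> carrier E"
    and ann: "\<And>r. r \<in> carrier R \<Longrightarrow> (\<And>y. y \<in> N \<Longrightarrow> r \<odot>\<^sub>E y = \<zero>\<^sub>E) \<Longrightarrow> r \<odot>\<^sub>E x = \<zero>\<^sub>E"
  shows "x \<in> N"
proof (rule ccontr)
  assume xN: "x \<notin> N"
  note NE = E.submoduleE[OF N]
  have zN: "\<zero>\<^sub>E \<in> N" using subgroup.one_closed[OF submodule.axioms(1)[OF N]] by simp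
  define J where "J = {r \<in> carrier R. r \<odot>\<^sub>E x \<in> N}"
  have J: "ideal J R"
    unfolding J_def using x NE zN by (intro idealI_cring) (auto simp: E.smult_l_distr E.smult_assoc1)
  have Jnil: "m_nil J" unfolding m_nil_def
  proof
    fix t assume t: "t \<in> \<mm>"
    obtain n where "t [^] (n::nat) \<odot>\<^sub>E x = \<zero>\<^sub>E" using torsion[OF x t] by blast
    then show "\<exists>n::nat. t [^] n \<in> J" using zN m_carrier[OF t] by (auto simp: J_def intro!: exI[of _ n])
  qed
  have "\<one> \<notin> J" using xN x by (simp add: J_def)
  then have "J \<noteq> carrier R" by auto
  then obtain a where a: "a \<in> carrier R" "a \<notin> J" "\<And>t. t \<in> \<mm> \<Longrightarrow> t \<otimes> a \<in> J"
    using exists_socle_element[OF J _ Jnil] by blast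
  have "t \<odot>\<^sub>E (a \<odot>\<^sub>E x) \<in> N" if "t \<in> \<mm>" for t
    using a(3)[OF that] a(1) x m_carrier[OF that] by (simp add: J_def E.smult_assoc1)
  moreover have "a \<odot>\<^sub>E x \<notin> N" "a \<odot>\<^sub>E x \<in> carrier E" using a x by (auto simp: J_def)
  ultimately obtain h where h: "h \<in> mod_hom R E E" "\<And>y. y \<in> N \<Longrightarrow> h y = \<zero>\<^sub>E" "h (a \<odot>\<^sub>E x) = s"
    using residue_functional[OF E.module_axioms N] by blast
  obtain r where r: "r \<in> carrier R" "\<And>x. x \<in> carrier E \<Longrightarrow> h x = r \<odot>\<^sub>E x"
    by (rule endomorphism_scalar[OF h(1)]) (rule that)
  have "r \<odot>\<^sub>E x = \<zero>\<^sub>E"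
    using h(2) r(2) NE(1) by (intro ann[OF r(1)]) (metis subsetD)
  then have "h (a \<odot>\<^sub>E x) = \<zero>\<^sub>E"
    using mod_homD(3)[OF h(1) a(1) x] r(2)[OF x] a by simp
  then show False using h(3) s_nonzero by simp
qed

end

lemma complete_residue_hull_exists:
  assumes noeth: "noetherian_ring R" and local: "complete_local_ring R \<mm>"
    and hull: "injective_hull R (residue_module R \<mm>) E"
  obtains s where "complete_residue_hull R \<mm> E s"
proof -
  have R: "cring R" and m: "maximalideal \<mm> R" and compl: "adically_complete R \<mm>"
    using local unfolding complete_local_ring_def local_ring_def by auto
  interpret cring R by (rule R)
  interpret noetherian_ring R by (rule noeth)
  interpret m: maximalideal \<mm> R by (rule m)
  interpret noetherian_maximal R \<mm> by unfold_locales
  have E: "module R E" using hull by (simp add: injective_hull_def injective_module_def)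
  interpret E: module R E by (rule E)
  let ?k = "residue_module R \<mm>"
  obtain i where i: "i \<in> mod_hom R ?k E" "inj_on i (carrier ?k)"
    and ess: "\<And>N. submodule N R E \<Longrightarrow> N \<noteq> {\<zero>\<^bsub>E\<^esub>} \<Longrightarrow> N \<inter> i ` carrier ?k \<noteq> {\<zero>\<^bsub>E\<^esub>}"
    using hull by (auto simp: injective_hull_def)
  have coset: "a_r_coset (regular_module R) \<mm> a = \<mm> +>\<^bsub>R\<^esub> a" for a by (simp add: a_r_coset_def')
  have carrier_k: "carrier ?k = {\<mm> +>\<^bsub>R\<^esub> a | a. a \<in> carrier R}"
    by (auto simp: residue_module_def quot_module_def A_RCOSETS_def' coset)
  have coset_eq: "\<mm> +>\<^bsub>R\<^esub> a = \<mm> +>\<^bsub>R\<^esub> b \<longleftrightarrow> a \<ominus>\<^bsub>R\<^esub> b \<in> \<mm>" if "a \<in> carrier R" "b \<in> carrier R" for a b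
    using quotient_eq_iff_same_a_r_cos[OF m_ideal that] by simp
  have smult_k: "a \<odot>\<^bsub>?k\<^esub> (\<mm> +>\<^bsub>R\<^esub> \<one>\<^bsub>R\<^esub>) = \<mm> +>\<^bsub>R\<^esub> a" if a: "a \<in> carrier R" for a
  proof -
    have "\<mm> +>\<^bsub>R\<^esub> (a \<otimes>\<^bsub>R\<^esub> x) = \<mm> +>\<^bsub>R\<^esub> a" if x: "x \<in> \<mm> +>\<^bsub>R\<^esub> \<one>\<^bsub>R\<^esub>" for x
    proof -
      obtain h where h: "h \<in> \<mm>" "x = h \<oplus>\<^bsub>R\<^esub> \<one>\<^bsub>R\<^esub>" using x by (auto simp: a_r_coset_def')
      note hc = m_carrier[OF h(1)]
      have "a \<otimes>\<^bsub>R\<^esub> x \<ominus>\<^bsub>R\<^esub> a = a \<otimes>\<^bsub>R\<^esub> h" using h hc a by (simp add: r_distr a_minus_def a_assoc r_neg)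
      then show ?thesis using coset_eq[of "a \<otimes>\<^bsub>R\<^esub> x" a] h hc a by (simp add: ideal_mult[OF m_ideal])
    qed
    moreover have "\<one>\<^bsub>R\<^esub> \<in> \<mm> +>\<^bsub>R\<^esub> \<one>\<^bsub>R\<^esub>" using ideal_zero[OF m_ideal] by (force simp: a_r_coset_def')
    ultimately have "(\<Union>x\<in>\<mm> +>\<^bsub>R\<^esub> \<one>\<^bsub>R\<^esub>. \<mm> +>\<^bsub>R\<^esub> (a \<otimes>\<^bsub>R\<^esub> x)) = \<mm> +>\<^bsub>R\<^esub> a" by blast
    then show ?thesis by (simp add: residue_module_def quot_module_def coset)
  qed
  have one_k: "\<mm> +>\<^bsub>R\<^esub> \<one>\<^bsub>R\<^esub> \<in> carrier ?k" using carrier_k by blast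
  define s where "s = i (\<mm> +>\<^bsub>R\<^esub> \<one>\<^bsub>R\<^esub>)"
  have s: "s \<in> carrier E" using mod_homD(1)[OF i(1) one_k] by (simp add: s_def)
  have i_coset: "i (\<mm> +>\<^bsub>R\<^esub> a) = a \<odot>\<^bsub>E\<^esub> s" if "a \<in> carrier R" for a
    using mod_homD(3)[OF i(1) that one_k] smult_k[OF that] by (simp add: s_def)
  have eq_iff: "a \<odot>\<^bsub>E\<^esub> s = \<zero>\<^bsub>E\<^esub> \<longleftrightarrow> a \<in> \<mm>" if a: "a \<in> carrier R" for a
  proof -
    have "a \<odot>\<^bsub>E\<^esub> s = \<zero>\<^bsub>E\<^esub> \<longleftrightarrow> i (\<mm> +>\<^bsub>R\<^esub> a) = i (\<mm> +>\<^bsub>R\<^esub> \<zero>\<^bsub>R\<^esub>)" using i_coset a s by simp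
    also have "\<dots> \<longleftrightarrow> \<mm> +>\<^bsub>R\<^esub> a = \<mm> +>\<^bsub>R\<^esub> \<zero>\<^bsub>R\<^esub>"
      using a by (intro inj_on_eq_iff[OF i(2)]) (auto simp: carrier_k)
    also have "\<dots> \<longleftrightarrow> a \<in> \<mm>" using coset_eq[of a "\<zero>\<^bsub>R\<^esub>"] a by (simp add: a_minus_def)
    finally show ?thesis .
  qed
  have "complete_residue_hull R \<mm> E s"
  proof (unfold_locales)
    show "baer R E" by (rule injective_imp_baer) (use hull in \<open>simp add: injective_hull_def\<close>)
    show "s \<in> carrier E" by (rule s)
    show "t \<odot>\<^bsub>E\<^esub> s = \<zero>\<^bsub>E\<^esub>" if "t \<in> \<mm>" for t using eq_iff m_carrier that by blast
    show "s \<noteq> \<zero>\<^bsub>E\<^esub>" using eq_iff[of "\<one>\<^bsub>R\<^esub>"] one_not_m s by auto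
    show "adically_complete R \<mm>" by (rule compl)
    fix x assume x: "x \<in> carrier E" "x \<noteq> \<zero>\<^bsub>E\<^esub>"
    define N where "N = {r \<odot>\<^bsub>E\<^esub> x | r. r \<in> carrier R}"
    have NI: "r \<odot>\<^bsub>E\<^esub> x \<in> N" if "r \<in> carrier R" for r using that by (auto simp: N_def)
    have "submodule N R E"
    proof (rule E.module_submodule_carrier)
      show "N \<subseteq> carrier E" using x by (auto simp: N_def)
      show "\<zero>\<^bsub>E\<^esub> \<in> N" using NI[of "\<zero>\<^bsub>R\<^esub>"] x by simp
      show "y \<oplus>\<^bsub>E\<^esub> z \<in> N" if "y \<in> N" "z \<in> N" for y z
        using that x NI[of "_ \<oplus>\<^bsub>R\<^esub> _"] by (auto simp: N_def simp flip: E.smult_l_distr)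
      show "r \<odot>\<^bsub>E\<^esub> y \<in> N" if "r \<in> carrier R" "y \<in> N" for r y
        using that x by (auto simp: N_def simp flip: E.smult_assoc1)
    qed
    moreover have "N \<noteq> {\<zero>\<^bsub>E\<^esub>}" using NI[of "\<one>\<^bsub>R\<^esub>"] x by auto
    ultimately have "N \<inter> i ` carrier ?k \<noteq> {\<zero>\<^bsub>E\<^esub>}" by (rule ess)
    moreover have "\<zero>\<^bsub>E\<^esub> \<in> N \<inter> i ` carrier ?k"
    proof
      show "\<zero>\<^bsub>E\<^esub> \<in> N" using NI[of "\<zero>\<^bsub>R\<^esub>"] x by simp
      have "\<mm> +>\<^bsub>R\<^esub> \<zero>\<^bsub>R\<^esub> \<in> carrier ?k" unfolding carrier_k by blast
      moreover have "i (\<mm> +>\<^bsub>R\<^esub> \<zero>\<^bsub>R\<^esub>) = \<zero>\<^bsub>E\<^esub>" using i_coset[of "\<zero>\<^bsub>R\<^esub>"] s by simp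
      ultimately show "\<zero>\<^bsub>E\<^esub> \<in> i ` carrier ?k" by (metis imageI)
    qed
    ultimately obtain y where y: "y \<in> N" "y \<in> i ` carrier ?k" "y \<noteq> \<zero>\<^bsub>E\<^esub>" by blast
    obtain r where r: "r \<in> carrier R" "y = r \<odot>\<^bsub>E\<^esub> x" using y(1) by (auto simp: N_def)
    obtain u where u: "u \<in> carrier R" "y = u \<odot>\<^bsub>E\<^esub> s" using y(2) i_coset by (auto simp: carrier_k)
    show "\<exists>r\<in>carrier R. \<exists>u\<in>carrier R. r \<odot>\<^bsub>E\<^esub> x = u \<odot>\<^bsub>E\<^esub> s \<and> u \<odot>\<^bsub>E\<^esub> s \<noteq> \<zero>\<^bsub>E\<^esub>"
      using r u y(3) by (intro bexI[of _ r] bexI[of _ u]) auto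
  qed
  then show thesis by (rule that)
qed

section \<open>The Frobenius action on the injective hull\<close>

locale F_split_hull = F_split_ring R q C + complete_residue_hull R \<mm> E s
  for R :: "('a, 'r) ring_scheme" (structure) and q C \<mm> and E :: "('a, 'e, 't) module_scheme" and s
begin

lemma frob_m: "t \<in> \<mm> \<Longrightarrow> t [^] q \<in> \<mm>"
  by (rule frob_mem[OF m_ideal])

text \<open>These are the \<open>R\<close>-linear maps \<open>F\<^sub>*R \<longrightarrow> E\<close>.\<close>

definition q_lin :: "('a \<Rightarrow> 'e) \<Rightarrow> bool" where
  "q_lin f \<longleftrightarrow> (\<forall>a\<in>carrier R. f a \<in> carrier E) \<and>
    (\<forall>a\<in>carrier R. \<forall>b\<in>carrier R. f (a \<oplus> b) = f a \<oplus>\<^sub>E f b) \<and>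
    (\<forall>r\<in>carrier R. \<forall>a\<in>carrier R. f (r [^] q \<otimes> a) = r \<odot>\<^sub>E f a)"

lemma q_linD:
  assumes "q_lin f"
  shows "a \<in> carrier R \<Longrightarrow> f a \<in> carrier E"
    "a \<in> carrier R \<Longrightarrow> b \<in> carrier R \<Longrightarrow> f (a \<oplus> b) = f a \<oplus>\<^sub>E f b"
    "r \<in> carrier R \<Longrightarrow> a \<in> carrier R \<Longrightarrow> f (r [^] q \<otimes> a) = r \<odot>\<^sub>E f a"
  using assms by (auto simp: q_lin_def)

lemma q_linI:
  assumes "\<And>a. a \<in> carrier R \<Longrightarrow> f a \<in> carrier E"
    "\<And>a b. a \<in> carrier R \<Longrightarrow> b \<in> carrier R \<Longrightarrow> f (a \<oplus> b) = f a \<oplus>\<^sub>E f b"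
    "\<And>r a. r \<in> carrier R \<Longrightarrow> a \<in> carrier R \<Longrightarrow> f (r [^] q \<otimes> a) = r \<odot>\<^sub>E f a"
  shows "q_lin f"
  using assms by (auto simp: q_lin_def)

lemma q_lin_zero: "q_lin f \<Longrightarrow> f \<zero> = \<zero>\<^sub>E"
  using q_linD(1)[of f \<zero>] q_linD(3)[of f \<zero> \<zero>] by (simp add: frob_zero)

lemma q_lin_diff:
  assumes "q_lin f" "q_lin g"
  shows "q_lin (\<lambda>a. f a \<oplus>\<^sub>E \<ominus>\<^sub>E g a)"
  by (rule q_linI) (use q_linD[OF assms(1)] q_linD[OF assms(2)] in
    \<open>auto simp: E.M.a_ac E.M.minus_add E.smult_r_distr E.smult_r_minus\<close>)

lemma q_lin_mult:
  assumes "q_lin f" "b \<in> carrier R"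
  shows "q_lin (\<lambda>a. f (a \<otimes> b))"
  by (rule q_linI) (use q_linD[OF assms(1)] assms(2) in \<open>auto simp: l_distr m_assoc\<close>)

text \<open>An \<open>R\<close>-linear map \<open>F\<^sub>*E \<longrightarrow> E\<close>, normalized on the socle.  It plays the role of the trace map that
  identifies \<open>E\<close> with \<open>Hom(F\<^sub>*R, E)\<close>.\<close>

definition is_trace :: "('e \<Rightarrow> 'e) \<Rightarrow> bool" where
  "is_trace \<tau> \<longleftrightarrow> (\<forall>x\<in>carrier E. \<tau> x \<in> carrier E) \<and>
    (\<forall>x\<in>carrier E. \<forall>y\<in>carrier E. \<tau> (x \<oplus>\<^sub>E y) = \<tau> x \<oplus>\<^sub>E \<tau> y) \<and>
    (\<forall>r\<in>carrier R. \<forall>x\<in>carrier E. \<tau> (r [^] q \<odot>\<^sub>E x) = r \<odot>\<^sub>E \<tau> x) \<and> \<tau> s = s"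

lemma exists_trace: "\<exists>\<tau>. is_trace \<tau>"
proof -
  let ?M = "restrict_scalars (frob R q) E"
  have M: "module R ?M"
  proof (rule moduleI[OF cring_axioms])
    show "abelian_group ?M"
    proof (rule abelian_groupI)
      show "\<exists>y\<in>carrier ?M. y \<oplus>\<^bsub>?M\<^esub> x = \<zero>\<^bsub>?M\<^esub>" if "x \<in> carrier ?M" for x
        using that by (intro bexI[of _ "\<ominus>\<^sub>E x"]) (auto simp: E.M.l_neg)
    qed (simp_all add: E.M.a_ac)
  qed (simp_all add: frob_def frob_add nat_pow_distrib E.smult_l_distr E.smult_r_distr E.smult_assoc1)
  interpret M: module R ?M by (rule M)
  have "submodule {\<zero>\<^sub>E} R ?M"
    by (rule M.module_submodule_carrier) (auto simp: frob_def)
  moreover have "t \<odot>\<^bsub>?M\<^esub> s \<in> {\<zero>\<^sub>E}" if "t \<in> \<mm>" for t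
    using s_ann[OF frob_m[OF that]] by (simp add: frob_def)
  ultimately obtain h where "h \<in> mod_hom R ?M E" "h s = s"
    using residue_functional[OF M, of "{\<zero>\<^sub>E}" s] s_nonzero by auto
  then show ?thesis
    using mod_homD[of h R ?M E] by (intro exI[of _ h]) (auto simp: is_trace_def frob_def)
qed

definition trace :: "'e \<Rightarrow> 'e" where "trace = (SOME \<tau>. is_trace \<tau>)"

lemma trace_closed [simp]: "x \<in> carrier E \<Longrightarrow> trace x \<in> carrier E"
  and trace_add: "x \<in> carrier E \<Longrightarrow> y \<in> carrier E \<Longrightarrow> trace (x \<oplus>\<^sub>E y) = trace x \<oplus>\<^sub>E trace y"
  and trace_smult: "r \<in> carrier R \<Longrightarrow> x \<in> carrier E \<Longrightarrow> trace (r [^] q \<odot>\<^sub>E x) = r \<odot>\<^sub>E trace x"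
  and trace_s: "trace s = s"
proof -
  have "is_trace trace" unfolding trace_def by (rule someI_ex[OF exists_trace])
  then show "x \<in> carrier E \<Longrightarrow> trace x \<in> carrier E"
    "x \<in> carrier E \<Longrightarrow> y \<in> carrier E \<Longrightarrow> trace (x \<oplus>\<^sub>E y) = trace x \<oplus>\<^sub>E trace y"
    "r \<in> carrier R \<Longrightarrow> x \<in> carrier E \<Longrightarrow> trace (r [^] q \<odot>\<^sub>E x) = r \<odot>\<^sub>E trace x" "trace s = s"
    unfolding is_trace_def by blast+
qed

lemma trace_zero: "trace \<zero>\<^sub>E = \<zero>\<^sub>E"
  using trace_smult[of \<zero> "\<zero>\<^sub>E"] by simp

lemma q_lin_trace:
  assumes y: "y \<in> carrier E"
  shows "q_lin (\<lambda>a. trace (a \<odot>\<^sub>E y))"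
  by (rule q_linI) (use y in \<open>auto simp: E.smult_l_distr trace_add E.smult_assoc1 trace_smult\<close>)

definition form :: "'a \<Rightarrow> 'a \<Rightarrow> 'e" where "form d a = trace ((a \<otimes> d) \<odot>\<^sub>E s)"

lemma form_q_lin: "d \<in> carrier R \<Longrightarrow> q_lin (form d)"
  using q_lin_mult[OF q_lin_trace[OF s_closed], of d] by (simp add: form_def[abs_def])

lemma form_m: "d \<in> carrier R \<Longrightarrow> t \<in> \<mm> \<Longrightarrow> form d t = \<zero>\<^sub>E"
  using s_ann[OF ideal_mult'[OF m_ideal]] by (simp add: form_def trace_zero)

lemma form_comb:
  assumes "r \<in> carrier R" "d \<in> carrier R" "e \<in> carrier R" "a \<in> carrier R"
  shows "form (e \<oplus> r [^] q \<otimes> d) a = form e a \<oplus>\<^sub>E r \<odot>\<^sub>E form d a"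
proof -
  have "a \<otimes> (e \<oplus> r [^] q \<otimes> d) = a \<otimes> e \<oplus> r [^] q \<otimes> (a \<otimes> d)" using assms by (simp add: r_distr m_lcomm)
  then show ?thesis using assms unfolding form_def
    by (simp add: E.smult_l_distr E.smult_assoc1 trace_add trace_smult)
qed

lemma q_lin_socle_value:
  assumes f: "q_lin f" and fm: "\<And>t. t \<in> \<mm> \<Longrightarrow> f t = \<zero>\<^sub>E" and a: "a \<in> carrier R"
  obtains w where "w \<in> carrier R" "f a = w \<odot>\<^sub>E s"
proof -
  have "t \<odot>\<^sub>E f a = \<zero>\<^sub>E" if t: "t \<in> \<mm>" for t
    using q_linD(3)[OF f, of t a] fm[OF ideal_mult'[OF m_ideal frob_m[OF t] a]] a m_carrier[OF t] by simp
  then show thesis using socle[of "f a"] q_linD(1)[OF f a] that by metis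
qed

lemma form_normalize:
  assumes d: "d \<in> carrier R" and b: "b \<in> carrier R" "form d b \<noteq> \<zero>\<^sub>E"
  obtains d' where "d' \<in> carrier R" "form d' b = s" "\<And>a. a \<in> carrier R \<Longrightarrow> form d a = \<zero>\<^sub>E \<Longrightarrow> form d' a = \<zero>\<^sub>E"
proof -
  note lin = form_q_lin[OF d]
  obtain v where v: "v \<in> carrier R" "v \<odot>\<^sub>E form d b = s"
    by (rule essential'[OF q_linD(1)[OF lin b(1)] b(2)])
  have eq: "form (v [^] q \<otimes> d) a = v \<odot>\<^sub>E form d a" if a: "a \<in> carrier R" for a
    using a v(1) d m_lcomm[of a "v [^] q" d] by (simp add: form_def E.smult_assoc1 trace_smult)
  show thesis by (rule that[of "v [^] q \<otimes> d"]) (use eq v d b in auto)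
qed

text \<open>Modulo \<open>\<mm>\<close>, the form \<open>(d, a) \<mapsto> \<tau>(a d s)\<close> is nondegenerate on the residue field, a vector
  space over its \<open>q\<close>-th powers.  Hence the span of a finite set is cut out by the functionals
  \<open>form d\<close> that vanish on it, which is what this lemma says in a form that avoids naming the span.\<close>

lemma form_separates:
  assumes f: "q_lin f" and fm: "\<And>t. t \<in> \<mm> \<Longrightarrow> f t = \<zero>\<^sub>E"
    and "B \<subseteq> carrier R" "finite B" "\<And>b'. b' \<in> B \<Longrightarrow> f b' = \<zero>\<^sub>E" "b \<in> carrier R"
    and "\<And>d. d \<in> carrier R \<Longrightarrow> (\<And>b'. b' \<in> B \<Longrightarrow> form d b' = \<zero>\<^sub>E) \<Longrightarrow> form d b = \<zero>\<^sub>E"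
  shows "f b = \<zero>\<^sub>E"
  using assms(4,3,5-)
proof (induction B arbitrary: b rule: finite_induct)
  case empty
  have "b \<in> \<mm>"
  proof (rule ccontr)
    assume "b \<notin> \<mm>"
    then obtain v t where v: "v \<in> carrier R" "t \<in> \<mm>" "\<one> = t \<oplus> v \<otimes> b" using unit_mod_m empty by metis
    have "s = (t \<oplus> v \<otimes> b) \<odot>\<^sub>E s" unfolding v(3)[symmetric] by (simp add: E.smult_one)
    also have "\<dots> = (b \<otimes> v) \<odot>\<^sub>E s" using v empty m_carrier by (simp add: E.smult_l_distr s_ann m_comm)
    finally have "form v b = s" using trace_s by (simp add: form_def)
    then show False using empty(4)[OF v(1)] s_nonzero by simp
  qed
  then show ?case by (rule fm)
next
  case (insert b0 B)
  have c: "b0 \<in> carrier R" "B \<subseteq> carrier R" "b \<in> carrier R" using insert by auto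
  show ?case
  proof (cases "\<forall>d\<in>carrier R. (\<forall>b'\<in>B. form d b' = \<zero>\<^sub>E) \<longrightarrow> form d b0 = \<zero>\<^sub>E")
    case True
    show ?thesis
    proof (rule insert.IH[OF c(2) _ c(3)])
      fix d assume d: "d \<in> carrier R" and dB: "\<And>b'. b' \<in> B \<Longrightarrow> form d b' = \<zero>\<^sub>E"
      then have "form d b0 = \<zero>\<^sub>E" using True by blast
      then show "form d b = \<zero>\<^sub>E" using dB by (intro insert.prems(4)[OF d]) auto
    qed (use insert.prems in auto)
  next
    case False
    then obtain d' where "d' \<in> carrier R" "\<forall>b'\<in>B. form d' b' = \<zero>\<^sub>E" "form d' b0 \<noteq> \<zero>\<^sub>E" by blast
    then obtain d0 where d0: "d0 \<in> carrier R" "form d0 b0 = s" "\<forall>b'\<in>B. form d0 b' = \<zero>\<^sub>E"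
      using form_normalize[OF _ c(1)] c(2) by (metis subsetD)
    note lin0 = form_q_lin[OF d0(1)]
    obtain w where w: "w \<in> carrier R" "form d0 b = w \<odot>\<^sub>E s"
      using q_lin_socle_value[OF lin0 form_m[OF d0(1)] c(3)] by blast
    define b1 where "b1 = b \<ominus> w [^] q \<otimes> b0"
    have b1: "b1 \<in> carrier R" using w c by (simp add: b1_def)
    have b_eq: "b = w [^] q \<otimes> b0 \<oplus> b1" using w c by (simp add: b1_def a_minus_def a_ac r_neg r_neg1 r_neg2)
    have split: "g b = w \<odot>\<^sub>E g b0 \<oplus>\<^sub>E g b1" if g: "q_lin g" for g
      unfolding b_eq using q_linD[OF g] w c b1 by simp
    have f01: "form d0 b1 = \<zero>\<^sub>E"
    proof -
      have "w \<odot>\<^sub>E s \<oplus>\<^sub>E form d0 b1 = w \<odot>\<^sub>E s \<oplus>\<^sub>E \<zero>\<^sub>E"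
        using split[OF lin0] w d0(2) by simp
      then show ?thesis using w(1) q_linD(1)[OF lin0 b1] by (subst (asm) E.M.add.l_cancel) auto
    qed
    have "f b1 = \<zero>\<^sub>E"
    proof (rule insert.IH[OF c(2) _ b1])
      fix d assume d: "d \<in> carrier R" and dB: "\<And>b'. b' \<in> B \<Longrightarrow> form d b' = \<zero>\<^sub>E"
      obtain v where v: "v \<in> carrier R" "form d b0 = v \<odot>\<^sub>E s"
        using q_lin_socle_value[OF form_q_lin[OF d] form_m[OF d] c(1)] by blast
      define e where "e = d \<oplus> (\<ominus> v) [^] q \<otimes> d0"
      have e: "e \<in> carrier R" using d v d0 by (simp add: e_def)
      have fe: "form e a = form d a \<oplus>\<^sub>E (\<ominus> v) \<odot>\<^sub>E form d0 a" if "a \<in> carrier R" for a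
        unfolding e_def using form_comb v d d0 that by simp
      have e0: "form e b0 = \<zero>\<^sub>E" using fe[OF c(1)] v d0(2) by (simp add: E.smult_l_minus E.M.r_neg)
      have "form e b' = \<zero>\<^sub>E" if "b' \<in> insert b0 B" for b'
        using that e0 fe[of b'] dB d0(3) c v by auto
      then have "form e b = \<zero>\<^sub>E" by (rule insert.prems(4)[OF e])
      then have "form e b1 = \<zero>\<^sub>E" using split[OF form_q_lin[OF e]] e0 w q_linD(1)[OF form_q_lin[OF e] b1] by simp
      then show "form d b1 = \<zero>\<^sub>E" using fe[OF b1] f01 v q_linD(1)[OF form_q_lin[OF d] b1] by simp
    qed (use insert.prems in auto)
    then show ?thesis using split[OF f] insert.prems w by simp
  qed
qed

text \<open>The socle of \<open>Hom(F\<^sub>*R, E)\<close> is generated by \<open>a \<mapsto> \<tau>(a s)\<close>.  This is where the residue field has to be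
  finite over its \<open>q\<close>-th powers.\<close>

lemma q_lin_socle:
  assumes f: "q_lin f" and fm: "\<And>t. t \<in> \<mm> \<Longrightarrow> f t = \<zero>\<^sub>E"
  obtains u where "u \<in> carrier R" "\<And>a. a \<in> carrier R \<Longrightarrow> f a = form u a"
proof -
  obtain gs where gs: "set gs \<subseteq> carrier R" "\<And>S. frob_closed S \<Longrightarrow> set gs \<subseteq> S \<Longrightarrow> S = carrier R"
    using frob_generators by blast
  have "\<exists>u\<in>carrier R. \<forall>b\<in>B. f b = form u b" if "finite B" "B \<subseteq> carrier R" for B
    using that
  proof (induction B rule: finite_induct)
    case empty
    show ?case by auto
  next
    case (insert b B)
    have c: "b \<in> carrier R" "B \<subseteq> carrier R" using insert by auto
    obtain u where u: "u \<in> carrier R" "\<And>b. b \<in> B \<Longrightarrow> f b = form u b" using insert by auto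
    define g where "g = (\<lambda>a. f a \<oplus>\<^sub>E \<ominus>\<^sub>E form u a)"
    have g: "q_lin g" unfolding g_def by (rule q_lin_diff[OF f form_q_lin[OF u(1)]])
    have gm: "g t = \<zero>\<^sub>E" if "t \<in> \<mm>" for t using fm form_m u that by (simp add: g_def)
    have gB: "g b' = \<zero>\<^sub>E" if "b' \<in> B" for b'
    proof -
      have "form u b' \<in> carrier E" using that c q_linD(1)[OF form_q_lin[OF u(1)]] by blast
      then show ?thesis using u(2)[OF that] by (simp add: g_def E.M.r_neg)
    qed
    have f_eq: "f b = form u b \<oplus>\<^sub>E g b"
      using q_linD(1)[OF f c(1)] q_linD(1)[OF form_q_lin[OF u(1)] c(1)]
      by (simp add: g_def E.M.a_ac E.M.r_neg E.M.r_neg1 E.M.r_neg2)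
    show ?case
    proof (cases "\<forall>d\<in>carrier R. (\<forall>b'\<in>B. form d b' = \<zero>\<^sub>E) \<longrightarrow> form d b = \<zero>\<^sub>E")
      case True
      have "g b = \<zero>\<^sub>E" by (rule form_separates[OF g gm c(2) insert(1) gB c(1)]) (use True in auto)
      then show ?thesis using f_eq u q_linD(1)[OF form_q_lin[OF u(1)] c(1)] by (intro bexI[of _ u]) auto
    next
      case False
      then obtain d' where "d' \<in> carrier R" "\<forall>b'\<in>B. form d' b' = \<zero>\<^sub>E" "form d' b \<noteq> \<zero>\<^sub>E" by blast
      then obtain d where d: "d \<in> carrier R" "form d b = s" "\<forall>b'\<in>B. form d b' = \<zero>\<^sub>E"
        using form_normalize[OF _ c(1)] c(2) by (metis subsetD)
      obtain w where w: "w \<in> carrier R" "g b = w \<odot>\<^sub>E s" using q_lin_socle_value[OF g gm c(1)] by blast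
      have "f b' = form (u \<oplus> w [^] q \<otimes> d) b'" if b': "b' \<in> insert b B" for b'
      proof (cases "b' = b")
        case True
        then show ?thesis using form_comb[OF w(1) d(1) u(1) c(1)] f_eq d w by simp
      next
        case False
        then have "b' \<in> B" "b' \<in> carrier R" using b' c by auto
        then show ?thesis
          using form_comb[OF w(1) d(1) u(1), of b'] u(2) d(3) w q_linD(1)[OF form_q_lin[OF u(1)], of b'] by simp
      qed
      then show ?thesis using u w d by (intro bexI[of _ "u \<oplus> w [^] q \<otimes> d"]) auto
    qed
  qed
  then obtain u where u: "u \<in> carrier R" "\<forall>b\<in>set gs. f b = form u b" using gs(1) by blast
  note lin = form_q_lin[OF u(1)]
  have "{a \<in> carrier R. f a = form u a} = carrier R"
    by (rule gs(2))
      (use gs(1) u q_linD[OF f] q_linD[OF lin] q_lin_zero[OF f] q_lin_zero[OF lin] in \<open>auto simp: frob_closed_def\<close>)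
  then show thesis using that u(1) by blast
qed

text \<open>Surjectivity of \<open>E \<longrightarrow> Hom(F\<^sub>*R, E)\<close>, one socle layer at a time: \<open>x \<mapsto> f (x a)\<close> lies in the socle, hence is
  \<open>x \<mapsto> \<tau>(x u s)\<close>, and \<open>s = a z\<close> allows to subtract the functional of \<open>u z\<close> from \<open>f\<close>.\<close>

lemma q_lin_representable:
  assumes "ideal J R" "m_nil J" "q_lin f" "\<And>j. j \<in> J \<Longrightarrow> f j = \<zero>\<^sub>E"
  shows "\<exists>y\<in>ann_E J. \<forall>a\<in>carrier R. f a = trace (a \<odot>\<^sub>E y)"
  using assms
proof (induction arbitrary: f rule: socle_induct)
  case carrier
  have "\<zero>\<^sub>E \<in> ann_E (carrier R)" by (auto simp: ann_E_def)
  then show ?case using carrier by (intro bexI[of _ "\<zero>\<^sub>E"]) (auto simp: trace_zero)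
next
  case (adjoin J a)
  note J = adjoin(1) and a = adjoin(3) and f = adjoin(7)
  have Jc: "J \<subseteq> carrier R" using ideal_carrier[OF J] by blast
  obtain z where z: "z \<in> ann_E J" "a \<odot>\<^sub>E z = s" using socle_dual[OF J adjoin(3-5)] by blast
  note zc = ann_E_closed(1)[OF Jc z(1)]
  have "q_lin (\<lambda>x. f (x \<otimes> a))" by (rule q_lin_mult[OF f a])
  then obtain u where u: "u \<in> carrier R" "\<And>x. x \<in> carrier R \<Longrightarrow> f (x \<otimes> a) = trace ((x \<otimes> u) \<odot>\<^sub>E s)"
    using q_lin_socle[of "\<lambda>x. f (x \<otimes> a)"] adjoin(5,8) unfolding form_def by metis
  have uz: "u \<odot>\<^sub>E z \<in> ann_E J" using ann_E_closed(3)[OF Jc u(1) z(1)] .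
  have uzc: "u \<odot>\<^sub>E z \<in> carrier E" using ann_E_closed(1)[OF Jc uz] .
  define g where "g = (\<lambda>x. f x \<oplus>\<^sub>E \<ominus>\<^sub>E trace (x \<odot>\<^sub>E (u \<odot>\<^sub>E z)))"
  have g: "q_lin g" unfolding g_def by (rule q_lin_diff[OF f q_lin_trace[OF uzc]])
  have gJ: "g j = \<zero>\<^sub>E" if "j \<in> J" for j
    using adjoin(8)[OF that] uz that by (auto simp: g_def ann_E_def trace_zero)
  have ga: "g (r \<otimes> a) = \<zero>\<^sub>E" if r: "r \<in> carrier R" for r
  proof -
    have "(r \<otimes> a) \<odot>\<^sub>E (u \<odot>\<^sub>E z) = (r \<otimes> u) \<odot>\<^sub>E s"
      using r a u zc E.smult_lcomm[OF a u(1) zc] by (simp add: z(2) E.smult_assoc1)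
    then show ?thesis using u r by (simp add: g_def E.M.r_neg)
  qed
  have "g j = \<zero>\<^sub>E" if "j \<in> adjoin J a" for j
    using that gJ ga q_linD(2)[OF g] Jc a by (auto simp: adjoin_iff subset_iff)
  then obtain y where y: "y \<in> ann_E (adjoin J a)" "\<forall>x\<in>carrier R. g x = trace (x \<odot>\<^sub>E y)"
    using adjoin(6)[OF g] by blast
  have yJ: "y \<in> ann_E J" using y(1) ann_E_adjoin[OF J a] by blast
  note yc = ann_E_closed(1)[OF Jc yJ]
  have "f x = trace (x \<odot>\<^sub>E (y \<oplus>\<^sub>E u \<odot>\<^sub>E z))" if x: "x \<in> carrier R" for x
  proof -
    have "trace (x \<odot>\<^sub>E (y \<oplus>\<^sub>E u \<odot>\<^sub>E z)) = g x \<oplus>\<^sub>E trace (x \<odot>\<^sub>E (u \<odot>\<^sub>E z))"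
      using x yc uzc y(2) by (simp add: E.smult_r_distr trace_add)
    also have "\<dots> = f x" using x uzc q_linD(1)[OF f x] by (simp add: g_def E.M.a_assoc E.M.l_neg)
    finally show ?thesis by simp
  qed
  then show ?case using ann_E_closed(2)[OF Jc yJ uz] by blast
qed

lemma trace_nondegenerate:
  assumes y: "y \<in> carrier E" and "\<And>a. a \<in> carrier R \<Longrightarrow> trace (a \<odot>\<^sub>E y) = \<zero>\<^sub>E"
  shows "y = \<zero>\<^sub>E"
proof (rule ccontr)
  assume "y \<noteq> \<zero>\<^sub>E"
  then obtain r where r: "r \<in> carrier R" "r \<odot>\<^sub>E y = s" by (rule essential'[OF y])
  then show False using assms(2)[OF r(1)] trace_s s_nonzero by simp
qed

text \<open>The Matlis dual of \<open>C\<close>, up to the identification of \<open>E\<close> with \<open>Hom(F\<^sub>*R, E)\<close>.\<close>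

definition hull_frob :: "'e \<Rightarrow> 'e" where
  "hull_frob x = (THE y. y \<in> carrier E \<and> (\<forall>a\<in>carrier R. trace (a \<odot>\<^sub>E y) = C a \<odot>\<^sub>E x))"

lemma hull_frob_unique:
  assumes "y \<in> carrier E" "z \<in> carrier E" "\<And>a. a \<in> carrier R \<Longrightarrow> trace (a \<odot>\<^sub>E y) = trace (a \<odot>\<^sub>E z)"
  shows "y = z"
proof -
  have "trace (a \<odot>\<^sub>E (y \<oplus>\<^sub>E \<ominus>\<^sub>E z)) = \<zero>\<^sub>E" if a: "a \<in> carrier R" for a
  proof -
    have neg: "trace (\<ominus>\<^sub>E w) = \<ominus>\<^sub>E trace w" if "w \<in> carrier E" for w
      using trace_add[of "\<ominus>\<^sub>E w" w] that by (simp add: E.M.l_neg trace_zero E.M.minus_equality)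
    show ?thesis using assms a by (simp add: E.smult_r_distr trace_add E.smult_r_minus neg E.M.r_neg)
  qed
  then have "y \<oplus>\<^sub>E \<ominus>\<^sub>E z = \<zero>\<^sub>E" using trace_nondegenerate assms(1,2) by simp
  then show ?thesis using assms(1,2) by (metis E.M.add.inv_closed E.M.minus_equality E.M.minus_minus)
qed

lemma hull_frob:
  assumes x: "x \<in> carrier E"
  shows "hull_frob x \<in> carrier E" "a \<in> carrier R \<Longrightarrow> trace (a \<odot>\<^sub>E hull_frob x) = C a \<odot>\<^sub>E x"
proof -
  define J where "J = {a \<in> carrier R. \<forall>b\<in>carrier R. C (a \<otimes> b) \<odot>\<^sub>E x = \<zero>\<^sub>E}"
  have J: "ideal J R"
  proof (rule idealI_cring)
    show "r \<otimes> y \<in> J" if "r \<in> carrier R" "y \<in> J" for r y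
    proof -
      have "C (r \<otimes> y \<otimes> b) \<odot>\<^sub>E x = \<zero>\<^sub>E" if b: "b \<in> carrier R" for b
      proof -
        have "r \<otimes> y \<otimes> b = y \<otimes> (r \<otimes> b)" using \<open>r \<in> carrier R\<close> \<open>y \<in> J\<close> b by (simp add: J_def m_ac)
        then show ?thesis using \<open>r \<in> carrier R\<close> \<open>y \<in> J\<close> b by (auto simp: J_def)
      qed
      then show ?thesis using that by (simp add: J_def)
    qed
  qed (use x in \<open>auto simp: J_def C_zero l_distr C_add E.smult_l_distr\<close>)
  have Jnil: "m_nil J"
    unfolding m_nil_def
  proof
    fix t assume t: "t \<in> \<mm>"
    note tc = m_carrier[OF t]
    obtain n where n: "t [^] (n::nat) \<odot>\<^sub>E x = \<zero>\<^sub>E" using torsion[OF x t] by blast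
    have "C (t [^] (n * q) \<otimes> b) \<odot>\<^sub>E x = \<zero>\<^sub>E" if b: "b \<in> carrier R" for b
    proof -
      have "C (t [^] (n * q) \<otimes> b) = C b \<otimes> t [^] n"
        using C_smult[of "t [^] n" b] tc b by (simp add: nat_pow_pow m_comm)
      then show ?thesis using n tc b x by (simp add: E.smult_assoc1)
    qed
    then show "\<exists>n::nat. t [^] n \<in> J" using tc by (intro exI[of _ "n * q"]) (auto simp: J_def)
  qed
  have lin: "q_lin (\<lambda>a. C a \<odot>\<^sub>E x)"
    by (rule q_linI) (use x in \<open>auto simp: C_add C_smult E.smult_l_distr E.smult_assoc1\<close>)
  have "C j \<odot>\<^sub>E x = \<zero>\<^sub>E" if "j \<in> J" for j
    using that unfolding J_def by (metis (mono_tags, lifting) mem_Collect_eq one_closed r_one)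
  then obtain y where y: "y \<in> ann_E J" "\<forall>a\<in>carrier R. C a \<odot>\<^sub>E x = trace (a \<odot>\<^sub>E y)"
    using q_lin_representable[OF J Jnil lin] by blast
  have "\<exists>!y. y \<in> carrier E \<and> (\<forall>a\<in>carrier R. trace (a \<odot>\<^sub>E y) = C a \<odot>\<^sub>E x)" (is "\<exists>!y. ?P y")
  proof (rule ex1I)
    have "y \<in> carrier E" using y(1) unfolding ann_E_def by blast
    then show yc: "?P y" using y(2) by metis
    fix z assume z: "?P z"
    show "z = y" by (rule hull_frob_unique) (use yc z in auto)
  qed
  from theI'[OF this]
  have "hull_frob x \<in> carrier E \<and> (\<forall>a\<in>carrier R. trace (a \<odot>\<^sub>E hull_frob x) = C a \<odot>\<^sub>E x)"
    unfolding hull_frob_def .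
  then show "hull_frob x \<in> carrier E" "a \<in> carrier R \<Longrightarrow> trace (a \<odot>\<^sub>E hull_frob x) = C a \<odot>\<^sub>E x" by blast+
qed

lemma hull_frob_RF_module: "RF_module R q E hull_frob"
  unfolding RF_module_def
proof (intro conjI ballI)
  show "module R E" by (rule E.module_axioms)
  show "hull_frob \<in> carrier E \<rightarrow> carrier E" using hull_frob(1) by blast
  show "hull_frob (x \<oplus>\<^sub>E y) = hull_frob x \<oplus>\<^sub>E hull_frob y" if "x \<in> carrier E" "y \<in> carrier E" for x y
    by (rule hull_frob_unique)
      (use that hull_frob in \<open>auto simp: E.smult_r_distr trace_add\<close>)
  show "hull_frob (r \<odot>\<^sub>E x) = r [^] q \<odot>\<^sub>E hull_frob x" if r: "r \<in> carrier R" and x: "x \<in> carrier E" for r x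
  proof (rule hull_frob_unique)
    fix a assume a: "a \<in> carrier R"
    have "a \<odot>\<^sub>E (r [^] q \<odot>\<^sub>E hull_frob x) = r [^] q \<odot>\<^sub>E (a \<odot>\<^sub>E hull_frob x)"
      using a r hull_frob(1)[OF x] by (intro E.smult_lcomm) auto
    then have "trace (a \<odot>\<^sub>E (r [^] q \<odot>\<^sub>E hull_frob x)) = r \<odot>\<^sub>E (C a \<odot>\<^sub>E x)"
      using a r hull_frob[OF x] trace_smult[of r "a \<odot>\<^sub>E hull_frob x"] by simp
    then show "trace (a \<odot>\<^sub>E hull_frob (r \<odot>\<^sub>E x)) = trace (a \<odot>\<^sub>E (r [^] q \<odot>\<^sub>E hull_frob x))"
      using a r x hull_frob(2)[of "r \<odot>\<^sub>E x" a] E.smult_lcomm[of "C a" r x] by simp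
  qed (use r x hull_frob in auto)
qed

text \<open>Both finiteness results for modules over \<open>R[F]\<close> come from this: if \<open>a \<phi>(x) = 0\<close> implies
  \<open>C(a) x = 0\<close>, then annihilators of stable submodules are Cartier submodules of \<open>R\<close>, and a
  submodule of \<open>E\<close> is determined by its annihilator.\<close>

lemma finite_stable_submodules:
  assumes sub: "\<And>N. N \<in> S \<Longrightarrow> submodule N R E"
    and stable: "\<And>N a. N \<in> S \<Longrightarrow> a \<in> carrier R \<Longrightarrow> (\<And>x. x \<in> N \<Longrightarrow> a \<odot>\<^sub>E x = \<zero>\<^sub>E) \<Longrightarrow>
      (\<And>x. x \<in> N \<Longrightarrow> C a \<odot>\<^sub>E x = \<zero>\<^sub>E)"
  shows "finite S"
proof -
  define Ann where "Ann = (\<lambda>N. {a \<in> carrier R. \<forall>x\<in>N. a \<odot>\<^sub>E x = \<zero>\<^sub>E})"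
  have "inj_on Ann S"
  proof (rule inj_onI)
    have le: "N \<subseteq> N'" if N: "N \<in> S" "N' \<in> S" "Ann N = Ann N'" for N N'
    proof
      fix x assume x: "x \<in> N"
      show "x \<in> N'"
      proof (rule double_annihilator[OF sub[OF N(2)]])
        show "x \<in> carrier E" using x E.submoduleE(1)[OF sub[OF N(1)]] by blast
        show "r \<odot>\<^sub>E x = \<zero>\<^sub>E" if "r \<in> carrier R" "\<And>y. y \<in> N' \<Longrightarrow> r \<odot>\<^sub>E y = \<zero>\<^sub>E" for r
        proof -
          have "r \<in> Ann N'" using that by (simp add: Ann_def)
          then show ?thesis using N(3) x by (auto simp: Ann_def)
        qed
      qed
    qed
    show "N = N'" if "N \<in> S" "N' \<in> S" "Ann N = Ann N'" for N N'
      using le[OF that] le[OF that(2,1) that(3)[symmetric]] by blast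
  qed
  moreover have "Ann N \<in> {I. cartier_submodule R C I}" if N: "N \<in> S" for N
  proof -
    have Nc: "N \<subseteq> carrier E" by (rule E.submoduleE(1)[OF sub[OF N]])
    have "ideal (Ann N) R"
      unfolding Ann_def using Nc by (intro idealI_cring) (auto simp: E.smult_l_distr E.smult_assoc1 subset_iff)
    moreover have "C ` Ann N \<subseteq> Ann N" using stable[OF N] by (auto simp: Ann_def)
    ultimately show ?thesis by (simp add: cartier_submodule_def)
  qed
  ultimately show ?thesis using finite_cartier_submodules by (meson finite_imageD finite_subset image_subsetI)
qed

theorem finite_RF_submodules_hull: "finite {N. RF_submodule R E hull_frob N}"
proof (rule finite_stable_submodules)
  fix N assume "N \<in> {N. RF_submodule R E hull_frob N}"
  then have N: "submodule N R E" "hull_frob ` N \<subseteq> N" by (auto simp: RF_submodule_def)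
  then show "submodule N R E" by simp
  fix a x assume a: "a \<in> carrier R" "\<And>x. x \<in> N \<Longrightarrow> a \<odot>\<^sub>E x = \<zero>\<^sub>E" and x: "x \<in> N"
  have xc: "x \<in> carrier E" using x E.submoduleE(1)[OF N(1)] by blast
  have "hull_frob x \<in> N" using N(2) x by blast
  then have "a \<odot>\<^sub>E hull_frob x = \<zero>\<^sub>E" by (rule a(2))
  then show "C a \<odot>\<^sub>E x = \<zero>\<^sub>E" using hull_frob(2)[OF xc a(1)] trace_zero by simp
qed

end

section \<open>Localization at one element\<close>

context cring
begin

lemma pow_pow_mult:
  assumes "f \<in> carrier R" "a \<in> carrier R"
  shows "f [^] (i::nat) \<otimes> (f [^] (j::nat) \<otimes> a) = f [^] (i + j) \<otimes> a"
  using assms by (simp add: m_assoc flip: nat_pow_mult)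

lemma loc_rel_iff:
  assumes "f \<in> carrier R"
  shows "((a, m), (b, n)) \<in> loc_rel R f \<longleftrightarrow> a \<in> carrier R \<and> b \<in> carrier R \<and>
    (\<exists>k::nat. f [^] (k + n) \<otimes> a = f [^] (k + m) \<otimes> b)"
  using assms by (auto simp: loc_rel_def pow_pow_mult)

lemma loc_rel_equiv:
  assumes f: "f \<in> carrier R"
  shows "equiv {(a, m). a \<in> carrier R} (loc_rel R f)"
proof (rule equivI)
  show "loc_rel R f \<subseteq> {(a, m). a \<in> carrier R} \<times> {(a, m). a \<in> carrier R}" by (auto simp: loc_rel_def)
  show "refl_on {(a, m). a \<in> carrier R} (loc_rel R f)"
    by (auto simp: refl_on_def loc_rel_iff[OF f])
  show "sym (loc_rel R f)"
  proof (rule symI, clarify)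
    fix a m b n assume "((a, m), (b, n)) \<in> loc_rel R f"
    then show "((b, n), (a, m)) \<in> loc_rel R f" unfolding loc_rel_iff[OF f] by metis
  qed
  show "trans (loc_rel R f)"
  proof (rule transI, clarify)
    fix a m b n c p assume *: "((a, m), (b, n)) \<in> loc_rel R f" "((b, n), (c, p)) \<in> loc_rel R f"
    then obtain k l where kl: "f [^] (k + n) \<otimes> a = f [^] (k + m) \<otimes> b" "f [^] (l + p) \<otimes> b = f [^] (l + n) \<otimes> c"
      and abc: "a \<in> carrier R" "b \<in> carrier R" "c \<in> carrier R"
      unfolding loc_rel_iff[OF f] by blast
    have "f [^] ((k + l + n) + p) \<otimes> a = f [^] (l + p) \<otimes> (f [^] (k + n) \<otimes> a)"
      using f abc by (simp add: pow_pow_mult ac_simps)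
    also have "\<dots> = f [^] (k + m) \<otimes> (f [^] (l + p) \<otimes> b)"
      unfolding kl(1) using f abc by (simp add: pow_pow_mult ac_simps)
    also have "\<dots> = f [^] ((k + l + n) + m) \<otimes> c"
      unfolding kl(2) using f abc by (simp add: pow_pow_mult ac_simps)
    finally show "((a, m), (c, p)) \<in> loc_rel R f" unfolding loc_rel_iff[OF f] using abc by blast
  qed
qed

lemma loc_frac_eq_iff:
  assumes "f \<in> carrier R" "a \<in> carrier R" "b \<in> carrier R"
  shows "loc_frac R f a m = loc_frac R f b n \<longleftrightarrow> (\<exists>k::nat. f [^] (k + n) \<otimes> a = f [^] (k + m) \<otimes> b)"
  unfolding loc_frac_def
  by (subst eq_equiv_class_iff[OF loc_rel_equiv[OF assms(1)]]) (use assms in \<open>auto simp: loc_rel_iff\<close>)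

lemma loc_frac_eqI:
  assumes "f \<in> carrier R" "a \<in> carrier R" "b \<in> carrier R" "f [^] (k + n :: nat) \<otimes> a = f [^] (k + m) \<otimes> b"
  shows "loc_frac R f a m = loc_frac R f b n"
  using assms by (subst loc_frac_eq_iff) blast+

lemma loc_frac_UN:
  assumes f: "f \<in> carrier R" and a: "a \<in> carrier R"
    and resp: "\<And>b n. b \<in> carrier R \<Longrightarrow> loc_frac R f b n = loc_frac R f a m \<Longrightarrow> F b n = F a m"
  shows "(\<Union>(b, n)\<in>loc_frac R f a m. F b n) = F a m"
proof -
  have "(a, m) \<in> loc_frac R f a m" using f a by (auto simp: loc_frac_def loc_rel_iff)
  moreover have "F b n = F a m" if "(b, n) \<in> loc_frac R f a m" for b n
  proof -
    have "((a, m), (b, n)) \<in> loc_rel R f" using that by (simp add: loc_frac_def)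
    then have "loc_frac R f a m = loc_frac R f b n" unfolding loc_frac_def
      by (rule equiv_class_eq[OF loc_rel_equiv[OF f]])
    then show ?thesis using resp that by (auto simp: loc_frac_def loc_rel_iff[OF f])
  qed
  ultimately show ?thesis by fast
qed

lemma loc_frac_expand:
  assumes "f \<in> carrier R" "a \<in> carrier R" "m \<le> M"
  shows "loc_frac R f a m = loc_frac R f (f [^] (M - m) \<otimes> a) M"
proof -
  have "f [^] (0 + M) \<otimes> a = f [^] (0 + m) \<otimes> (f [^] (M - m) \<otimes> a)"
    using assms by (simp add: pow_pow_mult)
  then show ?thesis by (rule loc_frac_eqI[rotated 3]) (use assms in auto)
qed

lemma loc_carrier_iff: "X \<in> carrier (localization R f) \<longleftrightarrow> (\<exists>a m. a \<in> carrier R \<and> X = loc_frac R f a m)"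
  by (auto simp: localization_def)

lemma loc_frac_closed [simp]: "a \<in> carrier R \<Longrightarrow> loc_frac R f a m \<in> carrier (localization R f)"
  by (auto simp: loc_carrier_iff)

text \<open>Addition is computed on numerators over a common denominator.  Exponents divisible by \<open>q\<close> are
  provided for the sake of \<open>C\<close>, which is \<open>C(a / f\<^sup>q\<^sup>m) = C(a) / f\<^sup>m\<close>; the case \<open>q = 1\<close> is just a common
  denominator.\<close>

lemma loc_common_denominator:
  assumes f: "f \<in> carrier R" and q: "q \<ge> (1::nat)"
    and XYZ: "X \<in> carrier (localization R f)" "Y \<in> carrier (localization R f)" "Z \<in> carrier (localization R f)"
  obtains a b c m where "a \<in> carrier R" "b \<in> carrier R" "c \<in> carrier R"
    "X = loc_frac R f a (q * m)" "Y = loc_frac R f b (q * m)" "Z = loc_frac R f c (q * m)"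
proof -
  obtain a m b n c p where *: "a \<in> carrier R" "b \<in> carrier R" "c \<in> carrier R"
    "X = loc_frac R f a m" "Y = loc_frac R f b n" "Z = loc_frac R f c p"
    using XYZ by (auto simp: loc_carrier_iff)
  let ?M = "m + n + p"
  have "?M \<le> q * ?M" using mult_le_mono1[OF q, of ?M] by simp
  then have le: "m \<le> q * ?M" "n \<le> q * ?M" "p \<le> q * ?M" by linarith+
  show thesis
  proof (rule that)
    show "X = loc_frac R f (f [^] (q * ?M - m) \<otimes> a) (q * ?M)"
      unfolding *(4) by (rule loc_frac_expand[OF f *(1) le(1)])
    show "Y = loc_frac R f (f [^] (q * ?M - n) \<otimes> b) (q * ?M)"
      unfolding *(5) by (rule loc_frac_expand[OF f *(2) le(2)])
    show "Z = loc_frac R f (f [^] (q * ?M - p) \<otimes> c) (q * ?M)"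
      unfolding *(6) by (rule loc_frac_expand[OF f *(3) le(3)])
  qed (use * f in simp_all)
qed

lemma loc_add:
  assumes f: "f \<in> carrier R" and ab: "a \<in> carrier R" "b \<in> carrier R"
  shows "loc_frac R f a m \<oplus>\<^bsub>localization R f\<^esub> loc_frac R f b m = loc_frac R f (a \<oplus> b) m"
proof -
  define F where "F = (\<lambda>a m b n. loc_frac R f (f [^] n \<otimes> a \<oplus> f [^] m \<otimes> b) (m + n))"
  have 1: "F a m b n = F a' m' b n" if c: "a \<in> carrier R" "a' \<in> carrier R" "b \<in> carrier R"
    and e: "loc_frac R f a m = loc_frac R f a' m'" for a m a' m' b n
  proof -
    obtain k where k: "f [^] (k + m') \<otimes> a = f [^] (k + m) \<otimes> a'"
      using e unfolding loc_frac_eq_iff[OF f c(1,2)] by blast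
    have "f [^] (k + (m' + n)) \<otimes> (f [^] n \<otimes> a \<oplus> f [^] m \<otimes> b)
      = f [^] (n + n) \<otimes> (f [^] (k + m') \<otimes> a) \<oplus> f [^] (k + m' + m + n) \<otimes> b"
      using f c by (simp add: r_distr pow_pow_mult ac_simps)
    also have "\<dots> = f [^] (k + (m + n)) \<otimes> (f [^] n \<otimes> a' \<oplus> f [^] m' \<otimes> b)"
      unfolding k using f c by (simp add: r_distr pow_pow_mult ac_simps)
    finally show ?thesis using f c unfolding F_def by (subst loc_frac_eq_iff) auto
  qed
  have sym: "F a m b n = F b n a m" if "a \<in> carrier R" "b \<in> carrier R" for a m b n
    using f that by (simp add: F_def a_comm add.commute)
  have 2: "F a m b n = F a m b' n'" if "a \<in> carrier R" "b \<in> carrier R" "b' \<in> carrier R"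
    and "loc_frac R f b n = loc_frac R f b' n'" for a m b b' n n'
    using 1[of b b' a n n' m] sym that by simp
  have "loc_frac R f a m \<oplus>\<^bsub>localization R f\<^esub> loc_frac R f b m
    = (\<Union>(a', m')\<in>loc_frac R f a m. \<Union>(b', n')\<in>loc_frac R f b m. F a' m' b' n')"
    by (simp add: localization_def F_def)
  also have "\<dots> = (\<Union>(b', n')\<in>loc_frac R f b m. F a m b' n')"
  proof (rule loc_frac_UN[OF f ab(1)])
    fix a' m' assume *: "a' \<in> carrier R" "loc_frac R f a' m' = loc_frac R f a m"
    have "(\<Union>(b', n')\<in>loc_frac R f b m. F a'' m'' b' n') = F a'' m'' b m" if "a'' \<in> carrier R" for a'' m''
      by (rule loc_frac_UN[OF f ab(2)]) (use 2 that ab in blast)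
    then show "(\<Union>(b', n')\<in>loc_frac R f b m. F a' m' b' n') = (\<Union>(b', n')\<in>loc_frac R f b m. F a m b' n')"
      using 1[OF *(1) ab(1,2) *(2)] * ab by simp
  qed
  also have "\<dots> = F a m b m"
    by (rule loc_frac_UN[OF f ab(2)]) (use 2 ab in blast)
  also have "\<dots> = loc_frac R f (a \<oplus> b) m"
  proof -
    have "f [^] (0 + m) \<otimes> (f [^] m \<otimes> a \<oplus> f [^] m \<otimes> b) = f [^] (0 + (m + m)) \<otimes> (a \<oplus> b)"
      using f ab by (simp add: r_distr pow_pow_mult)
    then show ?thesis unfolding F_def by (rule loc_frac_eqI[rotated 3]) (use f ab in auto)
  qed
  finally show ?thesis .
qed

lemma loc_zero: "f \<in> carrier R \<Longrightarrow> \<zero>\<^bsub>localization R f\<^esub> = loc_frac R f \<zero> m"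
  by (simp add: localization_def loc_frac_eq_iff)

lemma loc_smult:
  assumes f: "f \<in> carrier R" and ra: "r \<in> carrier R" "a \<in> carrier R"
  shows "r \<odot>\<^bsub>localization R f\<^esub> loc_frac R f a m = loc_frac R f (r \<otimes> a) m"
proof -
  have "(\<Union>(a, m)\<in>loc_frac R f a m. loc_frac R f (r \<otimes> a) m) = loc_frac R f (r \<otimes> a) m"
  proof (rule loc_frac_UN[OF f ra(2)])
    fix b n assume b: "b \<in> carrier R" "loc_frac R f b n = loc_frac R f a m"
    then obtain k where "f [^] (k + m) \<otimes> b = f [^] (k + n) \<otimes> a" using f ra by (auto simp: loc_frac_eq_iff)
    then have "f [^] (k + m) \<otimes> (r \<otimes> b) = f [^] (k + n) \<otimes> (r \<otimes> a)"
      using f ra b by (metis m_lcomm nat_pow_closed)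
    then show "loc_frac R f (r \<otimes> b) n = loc_frac R f (r \<otimes> a) m"
      using f ra b by (subst loc_frac_eq_iff) auto
  qed
  then show ?thesis by (simp add: localization_def)
qed

lemma loc_map_frac:
  assumes f: "f \<in> carrier R" and g: "g \<in> carrier R" and a: "a \<in> carrier R"
  shows "loc_map R f g (loc_frac R f a m) = loc_frac R (f \<otimes> g) (a \<otimes> g [^] m) m"
  unfolding loc_map_def
proof (rule loc_frac_UN[OF f a])
  fix b n assume b: "b \<in> carrier R" "loc_frac R f b n = loc_frac R f a m"
  then obtain k where k: "f [^] (k + m) \<otimes> b = f [^] (k + n) \<otimes> a" using f a by (auto simp: loc_frac_eq_iff)
  have eq: "(f \<otimes> g) [^] (k + m) \<otimes> (b \<otimes> g [^] n) = g [^] (k + m + n) \<otimes> (f [^] (k + m) \<otimes> b)"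
    if "b \<in> carrier R" for b m n
    using f g that by (simp add: nat_pow_distrib nat_pow_mult[symmetric] m_ac)
  have "(f \<otimes> g) [^] (k + m) \<otimes> (b \<otimes> g [^] n) = g [^] (k + n + m) \<otimes> (f [^] (k + n) \<otimes> a)"
    unfolding eq[OF b(1)] k by (simp add: ac_simps)
  also have "\<dots> = (f \<otimes> g) [^] (k + n) \<otimes> (a \<otimes> g [^] m)" unfolding eq[OF a] ..
  finally show "loc_frac R (f \<otimes> g) (b \<otimes> g [^] n) n = loc_frac R (f \<otimes> g) (a \<otimes> g [^] m) m"
    using f g a b by (subst loc_frac_eq_iff) auto
qed

lemma loc_frob_frac:
  assumes f: "f \<in> carrier R" and a: "a \<in> carrier R"
  shows "loc_frob R q f (loc_frac R f a m) = loc_frac R f (a [^] q) (q * m)"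
  unfolding loc_frob_def
proof (rule loc_frac_UN[OF f a])
  fix b n assume b: "b \<in> carrier R" "loc_frac R f b n = loc_frac R f a m"
  then obtain k where k: "f [^] (k + m) \<otimes> b = f [^] (k + n) \<otimes> a" using f a by (auto simp: loc_frac_eq_iff)
  have eq: "f [^] (q * k + q * m) \<otimes> b [^] q = (f [^] (k + m) \<otimes> b) [^] q" if "b \<in> carrier R" for b m
    using f that by (simp add: nat_pow_distrib nat_pow_pow algebra_simps)
  have "f [^] (q * k + q * m) \<otimes> b [^] q = f [^] (q * k + q * n) \<otimes> a [^] q"
    unfolding eq[OF b(1)] k eq[OF a] ..
  then show "loc_frac R f (b [^] q) (q * n) = loc_frac R f (a [^] q) (q * m)"
    using f a b by (subst loc_frac_eq_iff) auto
qed

lemma localization_abelian_group: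
  assumes f: "f \<in> carrier R"
  shows "abelian_group (localization R f)"
proof (rule abelian_groupI)
  note common = loc_common_denominator[OF f order_refl[of "1::nat"]]
  let ?L = "localization R f"
  show "\<zero>\<^bsub>?L\<^esub> \<in> carrier ?L" using loc_zero[OF f, of 0] by simp
  fix X assume X: "X \<in> carrier ?L"
  {
    fix Y assume Y: "Y \<in> carrier ?L"
    obtain a b c m where *: "a \<in> carrier R" "b \<in> carrier R" "X = loc_frac R f a (1 * m)" "Y = loc_frac R f b (1 * m)"
      using common[OF X Y Y] by metis
    show "X \<oplus>\<^bsub>?L\<^esub> Y \<in> carrier ?L" using * by (simp add: loc_add[OF f])
    show "X \<oplus>\<^bsub>?L\<^esub> Y = Y \<oplus>\<^bsub>?L\<^esub> X" using * by (simp add: loc_add[OF f] a_comm)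
    fix Z assume Z: "Z \<in> carrier ?L"
    obtain a b c m where *: "a \<in> carrier R" "b \<in> carrier R" "c \<in> carrier R"
      "X = loc_frac R f a (1 * m)" "Y = loc_frac R f b (1 * m)" "Z = loc_frac R f c (1 * m)"
      using common[OF X Y Z] by metis
    show "X \<oplus>\<^bsub>?L\<^esub> Y \<oplus>\<^bsub>?L\<^esub> Z = X \<oplus>\<^bsub>?L\<^esub> (Y \<oplus>\<^bsub>?L\<^esub> Z)" using * by (simp add: loc_add[OF f] a_assoc)
  }
  obtain a m where *: "a \<in> carrier R" "X = loc_frac R f a m" using X by (auto simp: loc_carrier_iff)
  show "\<zero>\<^bsub>?L\<^esub> \<oplus>\<^bsub>?L\<^esub> X = X" using * by (simp add: loc_zero[OF f, of m] loc_add[OF f])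
  show "\<exists>Y\<in>carrier ?L. Y \<oplus>\<^bsub>?L\<^esub> X = \<zero>\<^bsub>?L\<^esub>"
    using * by (intro bexI[of _ "loc_frac R f (\<ominus> a) m"]) (auto simp: loc_zero[OF f, of m] loc_add[OF f] l_neg)
qed

lemma loc_map_add:
  assumes f: "f \<in> carrier R" and g: "g \<in> carrier R"
    and XY: "X \<in> carrier (localization R f)" "Y \<in> carrier (localization R f)"
  shows "loc_map R f g (X \<oplus>\<^bsub>localization R f\<^esub> Y) = loc_map R f g X \<oplus>\<^bsub>localization R (f \<otimes> g)\<^esub> loc_map R f g Y"
proof -
  obtain a b c m where *: "a \<in> carrier R" "b \<in> carrier R" "X = loc_frac R f a (1 * m)" "Y = loc_frac R f b (1 * m)"
    using loc_common_denominator[OF f order_refl[of "1::nat"] XY XY(2)] by metis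
  then show ?thesis using f g by (simp add: loc_add loc_map_frac l_distr)
qed

lemma loc_map_closed:
  assumes "f \<in> carrier R" "g \<in> carrier R" "X \<in> carrier (localization R f)"
  shows "loc_map R f g X \<in> carrier (localization R (f \<otimes> g))"
  using assms by (auto simp: loc_carrier_iff[of _ f] loc_map_frac)

end

text \<open>The extension of \<open>C\<close> to the localization.  All fractions in the union are equal.\<close>

definition loc_split :: "('a, 'r) ring_scheme \<Rightarrow> nat \<Rightarrow> ('a \<Rightarrow> 'a) \<Rightarrow> 'a \<Rightarrow> ('a \<times> nat) set \<Rightarrow> ('a \<times> nat) set" where
  "loc_split R q C f X = \<Union>{loc_frac R f (C a) m | a m. a \<in> carrier R \<and> X = loc_frac R f a (q * m)}"

context F_split_ring
begin

lemma loc_split_frac: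
  assumes f: "f \<in> carrier R" and a: "a \<in> carrier R"
  shows "loc_split R q C f (loc_frac R f a (q * m)) = loc_frac R f (C a) m"
proof -
  have "loc_frac R f (C b) n = loc_frac R f (C a) m"
    if b: "b \<in> carrier R" "loc_frac R f a (q * m) = loc_frac R f b (q * n)" for b n
  proof -
    obtain k where k: "f [^] (k + q * n) \<otimes> a = f [^] (k + q * m) \<otimes> b"
      using b f a by (auto simp: loc_frac_eq_iff)
    have k_le: "k \<le> q * k" using q_ge_2 by (cases q) auto
    have eq: "f [^] (k + n) \<otimes> C a = C (f [^] (q * k - k) \<otimes> (f [^] (k + q * n) \<otimes> a))" if "a \<in> carrier R" for a n
    proof -
      have "f [^] (k + n) \<otimes> C a = C ((f [^] (k + n)) [^] q \<otimes> a)" using C_smult f that by simp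
      also have "(f [^] (k + n)) [^] q \<otimes> a = f [^] (q * k - k) \<otimes> (f [^] (k + q * n) \<otimes> a)"
      proof -
        have "(k + n) * q = q * k + q * n" by (simp add: algebra_simps)
        then have "(k + n) * q = q * k - k + (k + q * n)" using k_le by linarith
        then show ?thesis using f that by (simp add: nat_pow_pow pow_pow_mult)
      qed
      finally show ?thesis .
    qed
    have "f [^] (k + n) \<otimes> C a = f [^] (k + m) \<otimes> C b" unfolding eq[OF a] k eq[OF b(1)] ..
    then show ?thesis using f a b by (subst loc_frac_eq_iff) (auto intro: exI[of _ k])
  qed
  then have "{loc_frac R f (C b) n | b n. b \<in> carrier R \<and> loc_frac R f a (q * m) = loc_frac R f b (q * n)}
    = {loc_frac R f (C a) m}" using a by blast
  then show ?thesis by (simp add: loc_split_def)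
qed

lemma q_ge_1: "q \<ge> 1" using q_ge_2 by simp

lemma loc_rep_q:
  assumes "f \<in> carrier R" "X \<in> carrier (localization R f)"
  obtains a m where "a \<in> carrier R" "X = loc_frac R f a (q * m)"
  using loc_common_denominator[OF assms(1) q_ge_1 assms(2,2,2)] by metis

lemma loc_split_closed:
  assumes "f \<in> carrier R" "X \<in> carrier (localization R f)"
  shows "loc_split R q C f X \<in> carrier (localization R f)"
  using loc_rep_q[OF assms] assms by (metis loc_split_frac loc_frac_closed C_closed)

lemma loc_split_add:
  assumes f: "f \<in> carrier R" and XY: "X \<in> carrier (localization R f)" "Y \<in> carrier (localization R f)"
  shows "loc_split R q C f (X \<oplus>\<^bsub>localization R f\<^esub> Y) = loc_split R q C f X \<oplus>\<^bsub>localization R f\<^esub> loc_split R q C f Y"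
proof -
  obtain a b c m where *: "a \<in> carrier R" "b \<in> carrier R" "X = loc_frac R f a (q * m)" "Y = loc_frac R f b (q * m)"
    using loc_common_denominator[OF f q_ge_1 XY XY(2)] by metis
  then show ?thesis using f by (simp add: loc_add loc_split_frac C_add)
qed

lemma loc_split_map:
  assumes f: "f \<in> carrier R" and g: "g \<in> carrier R" and X: "X \<in> carrier (localization R f)"
  shows "loc_split R q C (f \<otimes> g) (loc_map R f g X) = loc_map R f g (loc_split R q C f X)"
proof -
  obtain a m where *: "a \<in> carrier R" "X = loc_frac R f a (q * m)" using loc_rep_q[OF f X] by metis
  have "g [^] (q * m) = (g [^] m) [^] q" using g by (simp add: nat_pow_pow mult.commute)
  then show ?thesis using * f g by (simp add: loc_map_frac loc_split_frac C_smult')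
qed

text \<open>The numerator identity behind this is \<open>C(a b\<^sup>q) = C(a) b\<close>.\<close>

lemma loc_split_smult_frob:
  assumes f: "f \<in> carrier R" and a: "a \<in> carrier R" and X: "X \<in> carrier (localization R f)"
  shows "loc_split R q C f (a \<odot>\<^bsub>localization R f\<^esub> loc_frob R q f X) = C a \<odot>\<^bsub>localization R f\<^esub> X"
proof -
  obtain b m where *: "b \<in> carrier R" "X = loc_frac R f b m" using X by (auto simp: loc_carrier_iff)
  then show ?thesis using f a by (simp add: loc_frob_frac loc_smult loc_split_frac C_smult')
qed

end

section \<open>Local cohomology\<close>

lemma additive_map_neg:
  assumes G: "abelian_group G" and H: "abelian_group H"
    and T: "\<And>x. x \<in> carrier G \<Longrightarrow> T x \<in> carrier H"
      "\<And>x y. x \<in> carrier G \<Longrightarrow> y \<in> carrier G \<Longrightarrow> T (x \<oplus>\<^bsub>G\<^esub> y) = T x \<oplus>\<^bsub>H\<^esub> T y"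
  shows "T \<zero>\<^bsub>G\<^esub> = \<zero>\<^bsub>H\<^esub>" "x \<in> carrier G \<Longrightarrow> T (\<ominus>\<^bsub>G\<^esub> x) = \<ominus>\<^bsub>H\<^esub> T x"
    "finite A \<Longrightarrow> f \<in> A \<rightarrow> carrier G \<Longrightarrow> T (finsum G f A) = finsum H (\<lambda>i. T (f i)) A"
proof -
  interpret G: abelian_group G by (rule G)
  interpret H: abelian_group H by (rule H)
  show zero: "T \<zero>\<^bsub>G\<^esub> = \<zero>\<^bsub>H\<^esub>"
    using T(2)[of "\<zero>\<^bsub>G\<^esub>" "\<zero>\<^bsub>G\<^esub>"] T(1)[of "\<zero>\<^bsub>G\<^esub>"] by simp
  show "T (\<ominus>\<^bsub>G\<^esub> x) = \<ominus>\<^bsub>H\<^esub> T x" if "x \<in> carrier G"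
    using T(2)[of "\<ominus>\<^bsub>G\<^esub> x" x] T(1) that by (simp add: G.l_neg zero H.minus_equality)
  show "T (finsum G f A) = finsum H (\<lambda>i. T (f i)) A" if "finite A" "f \<in> A \<rightarrow> carrier G"
    using that
  proof (induction A rule: finite_induct)
    case (insert x F)
    then have "f x \<in> carrier G" "f \<in> F \<rightarrow> carrier G" by auto
    with insert show ?case using T by (simp add: Pi_iff)
  qed (simp add: zero)
qed

locale cech_ring = cring R for R (structure) +
  fixes xs :: "'a list"
  assumes xs: "set xs \<subseteq> carrier R"
begin

abbreviation "elt S \<equiv> cech_elt R xs S"
abbreviation "loc S \<equiv> localization R (cech_elt R xs S)"

lemma cech_indexD:
  assumes "S \<in> cech_index xs i"
  shows "S \<subseteq> {..<length xs}" "finite S" "card S = i"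
  using assms finite_subset[of S "{..<length xs}"] by (auto simp: cech_index_def)

lemma xs_nth: "j < length xs \<Longrightarrow> xs ! j \<in> carrier R"
  using xs by auto

lemma elt_closed: "S \<subseteq> {..<length xs} \<Longrightarrow> elt S \<in> carrier R"
  unfolding cech_elt_def by (rule finprod_closed) (use xs_nth in auto)

lemma elt_remove:
  assumes "S \<in> cech_index xs i" "j \<in> S"
  shows "elt (S - {j}) \<otimes> xs ! j = elt S"
proof -
  have S: "finite (S - {j})" "S = insert j (S - {j})" "S \<subseteq> {..<length xs}" using assms cech_indexD[OF assms(1)] by auto
  have "elt S = finprod R (\<lambda>j. xs ! j) (insert j (S - {j}))" using S(2) by (simp add: cech_elt_def)
  also have "\<dots> = xs ! j \<otimes> elt (S - {j})"
    unfolding cech_elt_def using S assms xs_nth by (intro finprod_insert) auto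
  also have "\<dots> = elt (S - {j}) \<otimes> xs ! j"
  proof (rule m_comm)
    show "xs ! j \<in> carrier R" "elt (S - {j}) \<in> carrier R"
      using S(3) assms(2) xs_nth elt_closed[of "S - {j}"] by auto
  qed
  finally show ?thesis by simp
qed

lemma index_remove:
  assumes "S \<in> cech_index xs (Suc i)" "j \<in> S"
  shows "S - {j} \<in> cech_index xs i"
  using assms cech_indexD[OF assms(1)] by (auto simp: cech_index_def)

lemma loc_abelian_group: "S \<in> cech_index xs i \<Longrightarrow> abelian_group (loc S)"
  using localization_abelian_group elt_closed cech_indexD(1) by blast

lemma cochains_simps:
  "carrier (cech_cochains R xs i) = (\<Pi>\<^sub>E S\<in>cech_index xs i. carrier (loc S))"
  "\<zero>\<^bsub>cech_cochains R xs i\<^esub> = (\<lambda>S\<in>cech_index xs i. \<zero>\<^bsub>loc S\<^esub>)"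
  "c \<oplus>\<^bsub>cech_cochains R xs i\<^esub> c' = (\<lambda>S\<in>cech_index xs i. c S \<oplus>\<^bsub>loc S\<^esub> c' S)"
  "r \<odot>\<^bsub>cech_cochains R xs i\<^esub> c = (\<lambda>S\<in>cech_index xs i. r \<odot>\<^bsub>loc S\<^esub> c S)"
  by (simp_all add: cech_cochains_def Let_def)

abbreviation "cochains \<equiv> cech_cochains R xs"

lemma cochain_component: "c \<in> carrier (cochains i) \<Longrightarrow> S \<in> cech_index xs i \<Longrightarrow> c S \<in> carrier (loc S)"
  by (auto simp: cochains_simps)

lemma cochains_abelian_group: "abelian_group (cochains i)"
proof (rule abelian_groupI)
  note G = abelian_groupE[OF loc_abelian_group]
  let ?M = "cochains i"
  fix c assume c: "c \<in> carrier ?M"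
  show "\<zero>\<^bsub>?M\<^esub> \<oplus>\<^bsub>?M\<^esub> c = c"
    using c G(5) cochain_component[OF c] by (intro ext) (auto simp: cochains_simps PiE_def extensional_def)
  have "\<exists>y. y \<in> carrier (loc S) \<and> y \<oplus>\<^bsub>loc S\<^esub> c S = \<zero>\<^bsub>loc S\<^esub>" if "S \<in> cech_index xs i" for S
    using G(6)[OF that cochain_component[OF c that]] by blast
  then obtain n where n: "\<And>S. S \<in> cech_index xs i \<Longrightarrow> n S \<in> carrier (loc S) \<and> n S \<oplus>\<^bsub>loc S\<^esub> c S = \<zero>\<^bsub>loc S\<^esub>"
    by metis
  show "\<exists>y\<in>carrier ?M. y \<oplus>\<^bsub>?M\<^esub> c = \<zero>\<^bsub>?M\<^esub>"
  proof (rule bexI[of _ "\<lambda>S\<in>cech_index xs i. n S"])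
    show "restrict n (cech_index xs i) \<in> carrier ?M" using n by (auto simp: cochains_simps)
    show "restrict n (cech_index xs i) \<oplus>\<^bsub>?M\<^esub> c = \<zero>\<^bsub>?M\<^esub>"
      unfolding cochains_simps by (rule restrict_ext) (use n in auto)
  qed
  fix c' assume c': "c' \<in> carrier ?M"
  show "c \<oplus>\<^bsub>?M\<^esub> c' \<in> carrier ?M"
    using G(1) cochain_component[OF c] cochain_component[OF c'] by (auto simp: cochains_simps)
  show "c \<oplus>\<^bsub>?M\<^esub> c' = c' \<oplus>\<^bsub>?M\<^esub> c"
    unfolding cochains_simps by (rule restrict_ext) (use G(4) cochain_component[OF c] cochain_component[OF c'] in auto)
  fix c'' assume c'': "c'' \<in> carrier ?M"
  show "c \<oplus>\<^bsub>?M\<^esub> c' \<oplus>\<^bsub>?M\<^esub> c'' = c \<oplus>\<^bsub>?M\<^esub> (c' \<oplus>\<^bsub>?M\<^esub> c'')"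
    unfolding cochains_simps
    by (rule restrict_ext) (use G(3) cochain_component[OF c] cochain_component[OF c'] cochain_component[OF c''] in auto)
next
  show "\<zero>\<^bsub>cochains i\<^esub> \<in> carrier (cochains i)"
    using abelian_groupE(2)[OF loc_abelian_group] by (auto simp: cochains_simps)
qed

definition face :: "nat set \<Rightarrow> nat \<Rightarrow> (nat set \<Rightarrow> ('a \<times> nat) set) \<Rightarrow> ('a \<times> nat) set" where
  "face S j c = (let y = loc_map R (elt (S - {j})) (xs ! j) (c (S - {j})) in
    if even (card {k\<in>S. k < j}) then y else \<ominus>\<^bsub>loc S\<^esub> y)"

lemma cech_diff_face: "cech_diff R xs i c = (\<lambda>S\<in>cech_index xs (Suc i). finsum (loc S) (\<lambda>j. face S j c) S)"
  by (simp add: cech_diff_def face_def Let_def)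

lemma loc_map_component:
  assumes c: "c \<in> carrier (cochains i)" and S: "S \<in> cech_index xs (Suc i)" "j \<in> S"
  shows "loc_map R (elt (S - {j})) (xs ! j) (c (S - {j})) \<in> carrier (loc S)"
proof -
  have "xs ! j \<in> carrier R" "elt (S - {j}) \<in> carrier R"
    using S cech_indexD(1)[OF S(1)] xs_nth elt_closed[of "S - {j}"] by auto
  then show ?thesis
    using loc_map_closed[OF _ _ cochain_component[OF c index_remove[OF S]]] elt_remove[OF S] by metis
qed

lemma face_closed:
  assumes c: "c \<in> carrier (cochains i)" and S: "S \<in> cech_index xs (Suc i)" "j \<in> S"
  shows "face S j c \<in> carrier (loc S)"
  using loc_map_component[OF assms] abelian_group.a_inv_closed[OF loc_abelian_group[OF S(1)]]
  by (simp add: face_def Let_def)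

lemma face_add:
  assumes c: "c \<in> carrier (cochains i)" "c' \<in> carrier (cochains i)"
    and S: "S \<in> cech_index xs (Suc i)" "j \<in> S"
  shows "face S j (c \<oplus>\<^bsub>cochains i\<^esub> c') = face S j c \<oplus>\<^bsub>loc S\<^esub> face S j c'"
proof -
  interpret L: abelian_group "loc S" by (rule loc_abelian_group[OF S(1)])
  have e: "xs ! j \<in> carrier R" "elt (S - {j}) \<in> carrier R"
    using S cech_indexD(1)[OF S(1)] xs_nth elt_closed[of "S - {j}"] by auto
  have "loc_map R (elt (S - {j})) (xs ! j) (c (S - {j}) \<oplus>\<^bsub>loc (S - {j})\<^esub> c' (S - {j}))
    = loc_map R (elt (S - {j})) (xs ! j) (c (S - {j})) \<oplus>\<^bsub>loc S\<^esub> loc_map R (elt (S - {j})) (xs ! j) (c' (S - {j}))"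
    using loc_map_add[OF e(2,1) cochain_component[OF c(1) index_remove[OF S]] cochain_component[OF c(2) index_remove[OF S]]]
    unfolding elt_remove[OF S] .
  then show ?thesis
    using loc_map_component[OF c(1) S] loc_map_component[OF c(2) S] index_remove[OF S]
    by (simp add: face_def Let_def cochains_simps(3) L.minus_add)
qed

lemma cech_diff_closed:
  assumes c: "c \<in> carrier (cochains i)"
  shows "cech_diff R xs i c \<in> carrier (cochains (Suc i))"
  unfolding cech_diff_face cochains_simps
proof (rule restrict_PiE[THEN iffD2], intro PiE_I Pi_I)
  fix S assume S: "S \<in> cech_index xs (Suc i)"
  interpret L: abelian_group "loc S" by (rule loc_abelian_group[OF S])
  show "finsum (loc S) (\<lambda>j. face S j c) S \<in> carrier (loc S)"
    by (rule L.finsum_closed) (use face_closed[OF c S] in auto)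
qed

lemma cech_diff_add:
  assumes c: "c \<in> carrier (cochains i)" "c' \<in> carrier (cochains i)"
  shows "cech_diff R xs i (c \<oplus>\<^bsub>cochains i\<^esub> c') =
    cech_diff R xs i c \<oplus>\<^bsub>cochains (Suc i)\<^esub> cech_diff R xs i c'"
proof -
  have "finsum (loc S) (\<lambda>j. face S j (c \<oplus>\<^bsub>cochains i\<^esub> c')) S
    = finsum (loc S) (\<lambda>j. face S j c) S \<oplus>\<^bsub>loc S\<^esub> finsum (loc S) (\<lambda>j. face S j c') S"
    if S: "S \<in> cech_index xs (Suc i)" for S
  proof -
    interpret L: abelian_group "loc S" by (rule loc_abelian_group[OF S])
    have "finsum (loc S) (\<lambda>j. face S j (c \<oplus>\<^bsub>cochains i\<^esub> c')) S
      = finsum (loc S) (\<lambda>j. face S j c \<oplus>\<^bsub>loc S\<^esub> face S j c') S"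
      by (rule L.finsum_cong') (use face_add[OF c S] face_closed[OF c(1) S] face_closed[OF c(2) S] in auto)
    then show ?thesis using face_closed[OF c(1) S] face_closed[OF c(2) S] by (simp add: L.finsum_addf Pi_iff)
  qed
  then have "cech_diff R xs i (c \<oplus>\<^bsub>cochains i\<^esub> c') = (\<lambda>S\<in>cech_index xs (Suc i).
      finsum (loc S) (\<lambda>j. face S j c) S \<oplus>\<^bsub>loc S\<^esub> finsum (loc S) (\<lambda>j. face S j c') S)"
    unfolding cech_diff_face by (intro restrict_ext)
  also have "\<dots> = cech_diff R xs i c \<oplus>\<^bsub>cochains (Suc i)\<^esub> cech_diff R xs i c'"
    unfolding cech_diff_face cochains_simps by (rule restrict_ext) simp
  finally show ?thesis .
qed

lemma cech_coboundaries_subgroup: "subgroup (cech_coboundaries R xs i) (add_monoid (cochains i))"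
proof (cases i)
  case 0
  interpret M: abelian_group "cochains 0" by (rule cochains_abelian_group)
  show ?thesis using M.add.triv_subgroup 0 by (simp add: cech_coboundaries_def)
next
  case (Suc j)
  interpret M: abelian_group "cochains j" by (rule cochains_abelian_group)
  interpret N: abelian_group "cochains i" by (rule cochains_abelian_group)
  interpret d: group_hom "add_monoid (cochains j)" "add_monoid (cochains i)" "cech_diff R xs j"
    by unfold_locales (use cech_diff_closed cech_diff_add Suc in \<open>auto simp: hom_def\<close>)
  show ?thesis using d.img_is_subgroup Suc by (simp add: cech_coboundaries_def)
qed

end


locale F_split_cech = F_split_ring R q C + cech_ring R xs for R (structure) and q C xs
begin

definition cech_split :: "nat \<Rightarrow> (nat set \<Rightarrow> ('a \<times> nat) set) \<Rightarrow> (nat set \<Rightarrow> ('a \<times> nat) set)" where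
  "cech_split i c = (\<lambda>S\<in>cech_index xs i. loc_split R q C (elt S) (c S))"

lemma loc_split_component:
  assumes "S \<in> cech_index xs i" "X \<in> carrier (loc S)"
  shows "loc_split R q C (elt S) X \<in> carrier (loc S)"
  using loc_split_closed[OF elt_closed] cech_indexD(1) assms by blast

lemma cech_split_closed:
  assumes c: "c \<in> carrier (cochains i)"
  shows "cech_split i c \<in> carrier (cochains i)"
  using loc_split_component cochain_component[OF c] by (auto simp: cech_split_def cochains_simps)

lemma cech_split_zero: "cech_split i \<zero>\<^bsub>cochains i\<^esub> = \<zero>\<^bsub>cochains i\<^esub>"
  unfolding cech_split_def cochains_simps
proof (rule restrict_ext)
  fix S assume S: "S \<in> cech_index xs i"
  note G = loc_abelian_group[OF S]
  have "loc_split R q C (elt S) \<zero>\<^bsub>loc S\<^esub> = \<zero>\<^bsub>loc S\<^esub>"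
    by (rule additive_map_neg(1)[OF G G])
      (use loc_split_component[OF S] loc_split_add[OF elt_closed[OF cech_indexD(1)[OF S]]] in auto)
  then show "loc_split R q C (elt S) ((\<lambda>S\<in>cech_index xs i. \<zero>\<^bsub>loc S\<^esub>) S) = \<zero>\<^bsub>loc S\<^esub>" using S by simp
qed

lemma face_split:
  assumes c: "c \<in> carrier (cochains i)" and S: "S \<in> cech_index xs (Suc i)" "j \<in> S"
  shows "face S j (cech_split i c) = loc_split R q C (elt S) (face S j c)"
proof -
  have e: "xs ! j \<in> carrier R" "elt (S - {j}) \<in> carrier R" "elt S \<in> carrier R"
    using S cech_indexD(1)[OF S(1)] xs_nth elt_closed[of "S - {j}"] elt_closed[of S] by auto
  have "loc_split R q C (elt S) (loc_map R (elt (S - {j})) (xs ! j) (c (S - {j})))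
    = loc_map R (elt (S - {j})) (xs ! j) (cech_split i c (S - {j}))"
    using loc_split_map[OF e(2,1) cochain_component[OF c index_remove[OF S]]] index_remove[OF S]
    unfolding elt_remove[OF S] by (simp add: cech_split_def)
  moreover have "loc_split R q C (elt S) (\<ominus>\<^bsub>loc S\<^esub> X) = \<ominus>\<^bsub>loc S\<^esub> loc_split R q C (elt S) X"
    if "X \<in> carrier (loc S)" for X
    by (rule additive_map_neg(2)[OF loc_abelian_group[OF S(1)] loc_abelian_group[OF S(1)]])
      (use loc_split_component[OF S(1)] loc_split_add[OF e(3)] that in auto)
  ultimately show ?thesis
    using loc_map_component[OF c S] by (simp add: face_def Let_def)
qed

lemma cech_split_diff:
  assumes c: "c \<in> carrier (cochains i)"
  shows "cech_diff R xs i (cech_split i c) = cech_split (Suc i) (cech_diff R xs i c)"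
proof -
  have "finsum (loc S) (\<lambda>j. face S j (cech_split i c)) S = loc_split R q C (elt S) (finsum (loc S) (\<lambda>j. face S j c) S)"
    if S: "S \<in> cech_index xs (Suc i)" for S
  proof -
    interpret L: abelian_group "loc S" by (rule loc_abelian_group[OF S])
    have "loc_split R q C (elt S) (finsum (loc S) (\<lambda>j. face S j c) S)
      = finsum (loc S) (\<lambda>j. loc_split R q C (elt S) (face S j c)) S"
      by (rule additive_map_neg(3)[OF L.abelian_group_axioms L.abelian_group_axioms])
        (use loc_split_component[OF S] loc_split_add[OF elt_closed[OF cech_indexD(1)[OF S]]]
          cech_indexD(2)[OF S] face_closed[OF c S] in auto)
    also have "\<dots> = finsum (loc S) (\<lambda>j. face S j (cech_split i c)) S"
      by (rule L.finsum_cong') (use face_split[OF c S] face_closed[OF cech_split_closed[OF c] S] in auto)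
    finally show ?thesis by simp
  qed
  then have "cech_diff R xs i (cech_split i c)
    = (\<lambda>S\<in>cech_index xs (Suc i). loc_split R q C (elt S) (finsum (loc S) (\<lambda>j. face S j c) S))"
    unfolding cech_diff_face by (intro restrict_ext)
  also have "\<dots> = cech_split (Suc i) (cech_diff R xs i c)"
    unfolding cech_diff_face cech_split_def by (rule restrict_ext) simp
  finally show ?thesis .
qed

lemma cech_split_coboundary:
  assumes "c \<in> cech_coboundaries R xs i"
  shows "cech_split i c \<in> cech_coboundaries R xs i"
proof (cases i)
  case 0
  then show ?thesis using assms cech_split_zero by (simp add: cech_coboundaries_def)
next
  case (Suc j)
  then obtain b where b: "b \<in> carrier (cochains j)" "c = cech_diff R xs j b"
    using assms by (auto simp: cech_coboundaries_def)
  then show ?thesis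
    using cech_split_diff[OF b(1)] imageI[OF cech_split_closed[OF b(1)], of "cech_diff R xs j"] Suc
    by (simp add: cech_coboundaries_def)
qed

lemma cech_split_smult_frob:
  assumes a: "a \<in> carrier R" and c: "c \<in> carrier (cochains i)"
  shows "cech_split i (a \<odot>\<^bsub>cochains i\<^esub> cech_frob R q xs i c) = C a \<odot>\<^bsub>cochains i\<^esub> c"
  unfolding cech_split_def cochains_simps cech_frob_def
proof (rule restrict_ext)
  fix S assume S: "S \<in> cech_index xs i"
  show "loc_split R q C (elt S) ((\<lambda>S\<in>cech_index xs i. a \<odot>\<^bsub>loc S\<^esub>
      (\<lambda>S\<in>cech_index xs i. loc_frob R q (elt S) (c S)) S) S) = C a \<odot>\<^bsub>loc S\<^esub> c S"
    using S loc_split_smult_frob[OF elt_closed[OF cech_indexD(1)[OF S]] a cochain_component[OF c S]] by simp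
qed

lemma cech_frob_closed:
  assumes c: "c \<in> carrier (cochains i)"
  shows "cech_frob R q xs i c \<in> carrier (cochains i)"
proof -
  have "loc_frob R q (elt S) (c S) \<in> carrier (loc S)" if S: "S \<in> cech_index xs i" for S
  proof -
    have "elt S \<in> carrier R" by (rule elt_closed[OF cech_indexD(1)[OF S]])
    moreover obtain b m where "b \<in> carrier R" "c S = loc_frac R (elt S) b m"
      using cochain_component[OF c S] by (auto simp: loc_carrier_iff)
    ultimately show ?thesis by (simp add: loc_frob_frac)
  qed
  then show ?thesis by (auto simp: cech_frob_def cochains_simps)
qed

lemma cochain_smult_closed:
  assumes a: "a \<in> carrier R" and c: "c \<in> carrier (cochains i)"
  shows "a \<odot>\<^bsub>cochains i\<^esub> c \<in> carrier (cochains i)"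
proof -
  have "a \<odot>\<^bsub>loc S\<^esub> c S \<in> carrier (loc S)" if S: "S \<in> cech_index xs i" for S
  proof -
    have "elt S \<in> carrier R" by (rule elt_closed[OF cech_indexD(1)[OF S]])
    moreover obtain b m where "b \<in> carrier R" "c S = loc_frac R (elt S) b m"
      using cochain_component[OF c S] by (auto simp: loc_carrier_iff)
    ultimately show ?thesis using a by (simp add: loc_smult)
  qed
  then show ?thesis by (auto simp: cochains_simps)
qed

lemma cochain_smult_zero:
  assumes c: "c \<in> carrier (cochains i)"
  shows "\<zero> \<odot>\<^bsub>cochains i\<^esub> c = \<zero>\<^bsub>cochains i\<^esub>"
  unfolding cochains_simps
proof (rule restrict_ext)
  fix S assume S: "S \<in> cech_index xs i"
  have e: "elt S \<in> carrier R" by (rule elt_closed[OF cech_indexD(1)[OF S]])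
  obtain b m where b: "b \<in> carrier R" "c S = loc_frac R (elt S) b m"
    using cochain_component[OF c S] by (auto simp: loc_carrier_iff)
  then show "\<zero> \<odot>\<^bsub>loc S\<^esub> c S = \<zero>\<^bsub>loc S\<^esub>" using e by (simp add: loc_smult loc_zero[OF e, of m])
qed

text \<open>The map \<open>C\<close> extends to the Cech complex, so that \<open>C(a \<phi>(c)) = C(a) c\<close> there.  In this way the
  standard Frobenius satisfies the hypothesis of the finiteness criterion.\<close>

lemma local_cohomology_split:
  fixes i
  defines "H \<equiv> local_cohomology R xs i"
  assumes X: "X \<in> carrier H" and a: "a \<in> carrier R"
    and zero: "a \<odot>\<^bsub>H\<^esub> local_cohomology_frob R q xs i X = \<zero> \<odot>\<^bsub>H\<^esub> X"
  shows "C a \<odot>\<^bsub>H\<^esub> X = \<zero> \<odot>\<^bsub>H\<^esub> X"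
proof -
  let ?M = "cochains i" and ?B = "cech_coboundaries R xs i"
  interpret M: abelian_group ?M by (rule cochains_abelian_group)
  have B: "subgroup ?B (add_monoid ?M)" by (rule cech_coboundaries_subgroup)
  have Bc: "b \<in> carrier ?M" if "b \<in> ?B" for b using subgroup.subset[OF B] that by auto
  have Bz: "\<zero>\<^bsub>?M\<^esub> \<in> ?B" using subgroup.one_closed[OF B] by simp
  have smult_H: "r \<odot>\<^bsub>H\<^esub> Y = (\<Union>y\<in>Y. ?B +>\<^bsub>?M\<^esub> (r \<odot>\<^bsub>?M\<^esub> y))" for r Y
    by (simp add: H_def local_cohomology_def quot_module_def a_r_coset_def')
  obtain c where c: "c \<in> carrier ?M" "X = ?B +>\<^bsub>?M\<^esub> c"
    using X by (auto simp: H_def local_cohomology_def quot_module_def A_RCOSETS_def' a_r_coset_def' cech_cocycles_def)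
  have cX: "c \<in> X" using c Bz by (force simp: a_r_coset_def')
  have Xc: "x \<in> carrier ?M" if "x \<in> X" for x using that c Bc by (auto simp: a_r_coset_def')
  have coset_B: "?B +>\<^bsub>?M\<^esub> b = ?B" if "b \<in> ?B" for b
    using M.a_coset_join2[OF Bc[OF that] B that] .
  have self: "y \<in> ?B +>\<^bsub>?M\<^esub> y" if "y \<in> carrier ?M" for y using that Bz by (force simp: a_r_coset_def')
  have zero_X: "\<zero> \<odot>\<^bsub>H\<^esub> X = ?B"
    unfolding smult_H using cX cochain_smult_zero[OF Xc] coset_B[OF Bz] by auto
  have "C a \<odot>\<^bsub>?M\<^esub> x \<in> ?B" if x: "x \<in> X" for x
  proof -
    let ?\<phi> = "cech_frob R q xs i x"
    have \<phi>: "?\<phi> \<in> carrier ?M" by (rule cech_frob_closed[OF Xc[OF x]])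
    have "?\<phi> \<in> local_cohomology_frob R q xs i X"
      unfolding local_cohomology_frob_def using x self[OF \<phi>] by blast
    then have "a \<odot>\<^bsub>?M\<^esub> ?\<phi> \<in> a \<odot>\<^bsub>H\<^esub> local_cohomology_frob R q xs i X"
      unfolding smult_H using self[OF cochain_smult_closed[OF a \<phi>]] by blast
    then have "a \<odot>\<^bsub>?M\<^esub> ?\<phi> \<in> ?B" using zero zero_X by simp
    then have "cech_split i (a \<odot>\<^bsub>?M\<^esub> ?\<phi>) \<in> ?B" by (rule cech_split_coboundary)
    then show ?thesis using cech_split_smult_frob[OF a Xc[OF x]] by simp
  qed
  then have "C a \<odot>\<^bsub>H\<^esub> X = ?B" unfolding smult_H using cX coset_B by auto
  then show ?thesis using zero_X by simp
qed

end

text \<open>Only the \<open>R\<close>-module structure is carried over to \<open>E\<close>.  The standard Frobenius need not correspond to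
  \<open>hull_frob\<close> under the isomorphism, so its relation to \<open>C\<close> is taken from the Cech complex.\<close>

theorem finite_RF_submodules_local_cohomology:
  assumes hull: "F_split_hull R q C \<mm> E s" and xs: "set xs \<subseteq> carrier R"
    and iso: "mod_isomorphic R (local_cohomology R xs i) E"
  shows "finite {N. RF_submodule R (local_cohomology R xs i) (local_cohomology_frob R q xs i) N}"
proof -
  interpret F_split_hull R q C \<mm> E s by (rule hull)
  interpret F_split_cech R q C xs by unfold_locales (rule xs)
  let ?H = "local_cohomology R xs i" and ?\<phi> = "local_cohomology_frob R q xs i"
  obtain h where h: "h \<in> mod_hom R ?H E" and bij: "bij_betw h (carrier ?H) (carrier E)"
    using iso by (auto simp: mod_isomorphic_def)
  have inj: "inj_on h (carrier ?H)" using bij by (rule bij_betw_imp_inj_on)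
  define S where "S = {N. RF_submodule R ?H ?\<phi> N}"
  have sub: "submodule N R ?H" and stable: "?\<phi> ` N \<subseteq> N" if "N \<in> S" for N
    using that by (auto simp: S_def RF_submodule_def)
  have Nc: "X \<in> carrier ?H" if "N \<in> S" "X \<in> N" for N X
    using subgroup.subset[OF submodule.axioms(1)[OF sub[OF that(1)]]] that(2) by auto
  have N_smult: "r \<odot>\<^bsub>?H\<^esub> X \<in> N" if "N \<in> S" "r \<in> carrier R" "X \<in> N" for N r X
    using submodule.smult_closed[OF sub[OF that(1)]] that by blast
  have N_add: "X \<oplus>\<^bsub>?H\<^esub> Y \<in> N" if "N \<in> S" "X \<in> N" "Y \<in> N" for N X Y
    using subgroup.m_closed[OF submodule.axioms(1)[OF sub[OF that(1)]]] that by simp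
  have h_smult: "h (r \<odot>\<^bsub>?H\<^esub> X) = r \<odot>\<^bsub>E\<^esub> h X" if "N \<in> S" "r \<in> carrier R" "X \<in> N" for N r X
    using mod_homD(3)[OF h that(2) Nc[OF that(1,3)]] .
  have h_zero: "h (\<zero>\<^bsub>R\<^esub> \<odot>\<^bsub>?H\<^esub> X) = \<zero>\<^bsub>E\<^esub>" if "N \<in> S" "X \<in> N" for N X
    using h_smult[OF that(1) _ that(2), of "\<zero>\<^bsub>R\<^esub>"] mod_homD(1)[OF h Nc[OF that]] by simp
  have "finite ((`) h ` S)"
  proof (rule finite_stable_submodules)
    fix N' assume "N' \<in> (`) h ` S"
    then obtain N where N: "N \<in> S" "N' = h ` N" by blast
    obtain X0 where X0: "X0 \<in> N" using subgroup.one_closed[OF submodule.axioms(1)[OF sub[OF N(1)]]] by blast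
    show "submodule N' R E"
    proof (rule E.module_submodule_carrier)
      show "N' \<subseteq> carrier E" using mod_homD(1)[OF h Nc[OF N(1)]] N(2) by blast
      show "\<zero>\<^bsub>E\<^esub> \<in> N'"
        using h_zero[OF N(1) X0] N_smult[OF N(1) _ X0, of "\<zero>\<^bsub>R\<^esub>"] N(2) by (metis image_eqI ideal_zero oneideal)
      show "x \<oplus>\<^bsub>E\<^esub> y \<in> N'" if xy: "x \<in> N'" "y \<in> N'" for x y
      proof -
        obtain X Y where XY: "X \<in> N" "Y \<in> N" "x = h X" "y = h Y" using xy N by blast
        then have "x \<oplus>\<^bsub>E\<^esub> y = h (X \<oplus>\<^bsub>?H\<^esub> Y)" using mod_homD(2)[OF h Nc[OF N(1)] Nc[OF N(1)]] by simp
        then show ?thesis using N_add[OF N(1) XY(1,2)] N(2) by simp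
      qed
      show "r \<odot>\<^bsub>E\<^esub> x \<in> N'" if rx: "r \<in> carrier R" "x \<in> N'" for r x
      proof -
        obtain X where X: "X \<in> N" "x = h X" using rx N by blast
        then show ?thesis using h_smult[OF N(1) rx(1) X(1)] N_smult[OF N(1) rx(1) X(1)] N(2) by (metis image_eqI)
      qed
    qed
    fix a x assume a: "a \<in> carrier R" "\<And>x. x \<in> N' \<Longrightarrow> a \<odot>\<^bsub>E\<^esub> x = \<zero>\<^bsub>E\<^esub>" and x: "x \<in> N'"
    obtain X where X: "X \<in> N" "x = h X" using x N by blast
    have \<phi>X: "?\<phi> X \<in> N" using stable[OF N(1)] X by blast
    have "h (a \<odot>\<^bsub>?H\<^esub> ?\<phi> X) = \<zero>\<^bsub>E\<^esub>"
      using h_smult[OF N(1) a(1) \<phi>X] a(2) \<phi>X N(2) by simp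
    also have "\<dots> = h (\<zero>\<^bsub>R\<^esub> \<odot>\<^bsub>?H\<^esub> X)" using h_zero[OF N(1) X(1)] by simp
    finally have "a \<odot>\<^bsub>?H\<^esub> ?\<phi> X = \<zero>\<^bsub>R\<^esub> \<odot>\<^bsub>?H\<^esub> X"
      by (rule inj_onD[OF inj]) (use Nc[OF N(1)] N_smult[OF N(1)] a(1) \<phi>X X(1) ideal_zero[OF oneideal] in auto)
    then have "C a \<odot>\<^bsub>?H\<^esub> X = \<zero>\<^bsub>R\<^esub> \<odot>\<^bsub>?H\<^esub> X"
      using local_cohomology_split[OF Nc[OF N(1) X(1)] a(1)] by simp
    then show "C a \<odot>\<^bsub>E\<^esub> x = \<zero>\<^bsub>E\<^esub>"
      using h_smult[OF N(1) C_closed[OF a(1)] X(1)] h_zero[OF N(1) X(1)] X(2) by simp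
  qed
  moreover have "inj_on ((`) h) S"
    by (rule inj_onI) (use inj_on_image_eq_iff[OF inj] Nc in blast)
  ultimately have "finite S" by (rule finite_imageD)
  then show ?thesis by (simp add: S_def)
qed

theorem mainTheorem6:
  fixes p e q d :: nat
    and K :: "('k, 's) ring_scheme" and \<eta> :: "'k \<Rightarrow> 'a"
    and R :: "('a, 'r) ring_scheme" and C :: "'a \<Rightarrow> 'a"
    and \<mm> :: "'a set" and E :: "('a, 'e, 't) module_scheme" and xs :: "'a list"
  assumes "Factorial_Ring.prime p" and "e \<ge> 1" and "q = p ^ e"
    and "field K" and "card (carrier K) = q"
    and "cring R" and "\<eta> \<in> ring_hom K R"
    and "[p] \<cdot>\<^bsub>R\<^esub> \<one>\<^bsub>R\<^esub> = \<zero>\<^bsub>R\<^esub>"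
    and "noetherian_ring R"
    and "F_finite R q"
    and "frob_splitting R q C"
  shows "finite {I. cartier_submodule R C I}
    \<and> (complete_local_ring R \<mm> \<and> injective_hull R (residue_module R \<mm>) E \<longrightarrow>
         (\<exists>\<phi>. RF_module R q E \<phi> \<and> finite {N. RF_submodule R E \<phi> N}))
    \<and> (complete_local_ring R \<mm> \<and> injective_hull R (residue_module R \<mm>) E
         \<and> krull_dim R = enat d \<and> generates_up_to_radical R xs \<mm>
         \<and> mod_isomorphic R (local_cohomology R xs d) E \<longrightarrow>
         finite {N. RF_submodule R (local_cohomology R xs d) (local_cohomology_frob R q xs d) N})"
proof -
  have p2: "2 \<le> p" using assms(1) by (rule prime_ge_2_nat)
  also have "p \<le> p ^ e" using assms(2) p2 by (intro self_le_power) auto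
  finally have q2: "2 \<le> q" using assms(3) by simp
  have split: "F_split_ring R q C"
    using assms(6,9-11) q2 by (simp add: F_split_ring_def F_split_ring_axioms_def)
  then interpret F_split_ring R q C .
  have hull: "\<exists>s. F_split_hull R q C \<mm> E s"
    if "complete_local_ring R \<mm>" "injective_hull R (residue_module R \<mm>) E"
    using complete_residue_hull_exists[OF assms(9) that] split unfolding F_split_hull_def by metis
  show ?thesis
  proof (intro conjI impI)
    show "finite {I. cartier_submodule R C I}" by (rule finite_cartier_submodules)
    show "\<exists>\<phi>. RF_module R q E \<phi> \<and> finite {N. RF_submodule R E \<phi> N}"
      if h: "complete_local_ring R \<mm> \<and> injective_hull R (residue_module R \<mm>) E"
    proof -
      obtain s where "F_split_hull R q C \<mm> E s" using hull h by blast
      then interpret F_split_hull R q C \<mm> E s .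
      show ?thesis using hull_frob_RF_module finite_RF_submodules_hull by blast
    qed
    show "finite {N. RF_submodule R (local_cohomology R xs d) (local_cohomology_frob R q xs d) N}"
      if h: "complete_local_ring R \<mm> \<and> injective_hull R (residue_module R \<mm>) E
         \<and> krull_dim R = enat d \<and> generates_up_to_radical R xs \<mm>
         \<and> mod_isomorphic R (local_cohomology R xs d) E"
    proof -
      obtain s where "F_split_hull R q C \<mm> E s" using hull h by blast
      then show ?thesis
        by (rule finite_RF_submodules_local_cohomology) (use h in \<open>auto simp: generates_up_to_radical_def\<close>)
    qed
  qed
qed

end
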